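(* Let $t\ge 3$ be an integer, $g=2t-1$, and $\mathbf{x}=(x_1,\dots,x_t)$ be independent variables. The Macdonald identity for the affine root system of type $B^{(1)}_t$ can be rewritten as follows: $$\sum_{\lambda\in\mathcal{DD}_{g}^{'1}} (-1)^{|H_{<g,+}|+|H_{<g,+}\cap \Delta|}\,T^{|\lambda|/2}\,\mathrm{so}_{\mu}(\mathbf{x})=(T;T)_\infty^{t}\, K_T(t,\mathbf{x})\prod_{i=1}^t (Tx_i;T)_\infty(Tx_i^{-1};T)_\infty,$$ where $\Delta$ is the main diagonal of $\lambda$, $H_{<g,+}=\{s\in\lambda\mid h_s<g,\ \varepsilon_s=1\}$, and $\mu=\mu(\lambda)$ is the partition given by $\mu_i=v_i+i-g$ for $1\le i\le t$, with $\mathbf{v}$ the $V_{g,t}$-coding of $\lambda$.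
   Context: $(a;T)_\infty=\prod_{j\ge0}(1-aT^j)$, and $K_T(t,\mathbf{x})=\prod_{1\le i<j\le t}(Tx_ix_j;T)_\infty(Tx_ix_j^{-1};T)_\infty(Tx_i^{-1}x_j;T)_\infty(Tx_i^{-1}x_j^{-1};T)_\infty$. The identity is between formal power series in $T$ with Laurent polynomial coefficients in the $x_i$. For a partition $\lambda$, $h_s$ is the hook length of a box $s$, $d_\lambda=\max\{s:\lambda_s\ge s\}$ is the Durfee square size, $\Delta$ is the set of boxes on the main diagonal (English convention), and $\varepsilon_s=-1$ if $s$ is strictly below the main diagonal, $\varepsilon_s=1$ otherwise. $\mathcal{DD}$ is the set of partitions with $\lambda_i=\lambda'_i+1$ for $1\le i\le d_\lambda$ ($\lambda'$ the conjugate; the empty partition included), and $\mathcal{DD}'=\{\lambda'\mid\lambda\in\mathcal{DD}\}$. Word of a partition: $\psi(\lambda)=(c_k)_{k\in\mathbb{Z}}\in\{0,1\}^{\mathbb{Z}}$ encodes the border of the Ferrers diagram read from South-West to North-East ($0$ vertical step, $1$ horizontal step), indexed so that $\#\{k\le -1: c_k=1\}=\#\{k\ge 0: c_k=0\}$; equivalently $c_k=0$ iff $k=\lambda_i-i$ for some $i\ge1$ (with $\lambda_i=0$ beyond the length). The $g$-quotient of $\lambda$ is $(\nu^{(0)},\dots,\nu^{(g-1)})$, where $\nu^{(k)}$ is the partition whose word is, up to a shift of indices, the subword $(c_{gi+k})_{i\in\mathbb{Z}}$. $\mathcal{DD}_{2t-1}^{'1}$ is the set of $\lambda\in\mathcal{DD}'$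 whose $(2t-1)$-quotient satisfies $\nu^{(k)}=\emptyset$ for all $k\ne 2t-2$ and $\nu^{(2t-2)}$ is, for some integer $m_1\ge 1$, the rectangular partition with $m_1$ parts all equal to $m_1-1$ (empty if $m_1=1$). $V_{g,t}$-coding: for $i\in\{0,\dots,g-1\}$ let $\beta_i=\max\{(k+1)g+i\mid k\in\mathbb{Z},\ c_{kg+i}=0\}$; the $V_{g,t}$-coding is $\mathbf{v}=(v_1>\dots>v_t)$, the $t$ largest of the distinct integers $\beta_0,\dots,\beta_{g-1}$ in decreasing order. Odd orthogonal character: $\mathrm{so}_\mu(\mathbf{x})=\dfrac{\det_{1\le i,j\le t}\big(x_i^{\mu_j+t-j+1}-x_i^{-(\mu_j+t-j)}\big)}{\det_{1\le i,j\le t}\big(x_i^{t-j+1}-x_i^{-(t-j)}\big)}$.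
   Formalization: The printed sign is wrong: for λ=(1,1) it gives +so_{(1,1)} at T^1, while the product side gives −so_{(1,1)}. The formal identity multiplies each summand's sign by (−1)^{d_λ}, with d_λ the Durfee square size of λ. *)

theory Defs
  imports
    "HOL-Library.Poly_Mapping"
    "HOL-Computational_Algebra.Computational_Algebra"
    "HOL-Analysis.Infinite_Products"
    "HOL-Analysis.Infinite_Sum"
    "Jordan_Normal_Form.Determinant"
begin

section \<open>Partitions\<close>

text \<open>A partition is the weakly decreasing list of its positive parts. Parts, rows and columns
  are numbered from 1, and \<open>part lam i = 0\<close> beyond the length.\<close>

definition is_partition :: "nat list \<Rightarrow> bool" where
  "is_partition lam \<longleftrightarrow> sorted_wrt (\<ge>) lam \<and> 0 \<notin> set lam"

definition part :: "nat list \<Rightarrow> nat \<Rightarrow> nat" where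
  "part lam i = (if 1 \<le> i \<and> i \<le> length lam then lam ! (i - 1) else 0)"

definition boxes :: "nat list \<Rightarrow> (nat \<times> nat) set" where
  "boxes lam = {(i, j). 1 \<le> i \<and> 1 \<le> j \<and> j \<le> part lam i}"

definition conj_partition :: "nat list \<Rightarrow> nat list" where
  "conj_partition lam = map (\<lambda>j. card {i. (i, j) \<in> boxes lam}) [1..<Suc (part lam 1)]"

definition hook :: "nat list \<Rightarrow> nat \<times> nat \<Rightarrow> nat" where
  "hook lam s = card {(a, b) \<in> boxes lam.
     (a = fst s \<and> snd s \<le> b) \<or> (b = snd s \<and> fst s \<le> a)}"

definition durfee :: "nat list \<Rightarrow> nat" where
  "durfee lam = Max (insert 0 {s. 1 \<le> s \<and> s \<le> part lam s})"

definition main_diagonal :: "nat list \<Rightarrow> (nat \<times> nat) set" where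
  "main_diagonal lam = {(i, j) \<in> boxes lam. i = j}"

text \<open>In the English convention the row index increases downwards, so a box \<open>(i, j)\<close> is strictly
  below the main diagonal iff \<open>j < i\<close>.\<close>

definition eps :: "nat \<times> nat \<Rightarrow> int" where
  "eps s = (if snd s < fst s then - 1 else 1)"

definition hooks_lt_plus :: "nat \<Rightarrow> nat list \<Rightarrow> (nat \<times> nat) set" where
  "hooks_lt_plus g lam = {s \<in> boxes lam. hook lam s < g \<and> eps s = 1}"

definition DD :: "nat list set" where
  "DD = {lam. is_partition lam \<and>
     (\<forall>i. 1 \<le> i \<and> i \<le> durfee lam \<longrightarrow> part lam i = part (conj_partition lam) i + 1)}"

definition DD_conj :: "nat list set" where
  "DD_conj = conj_partition ` DD"

definition rect_partition :: "nat \<Rightarrow> nat \<Rightarrow> nat list" where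
  "rect_partition a b = (if b = 0 then [] else replicate a b)"


section \<open>Words, quotients and codings\<close>

definition word :: "nat list \<Rightarrow> int \<Rightarrow> nat" where
  "word lam k = (if \<exists>i\<ge>1. k = int (part lam i) - int i then 0 else 1)"

text \<open>\<open>g_quotient g lam k\<close> is the \<open>k\<close>-th component of the \<open>g\<close>-quotient. A bi-infinite 0-1 sequence
  that is eventually 0 to the left and eventually 1 to the right is a shift of the word of exactly
  one partition, so the description is definite for \<open>k < g\<close>.\<close>

definition g_quotient :: "nat \<Rightarrow> nat list \<Rightarrow> nat \<Rightarrow> nat list" where
  "g_quotient g lam k = (THE nu. is_partition nu \<and>
     (\<exists>s::int. \<forall>i::int. word nu i = word lam (int g * (i + s) + int k)))"

definition DD_conj_1 :: "nat \<Rightarrow> nat list set" where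
  "DD_conj_1 t = {lam \<in> DD_conj.
     (\<forall>k < 2 * t - 1. k \<noteq> 2 * t - 2 \<longrightarrow> g_quotient (2 * t - 1) lam k = []) \<and>
     (\<exists>m\<ge>1. g_quotient (2 * t - 1) lam (2 * t - 2) = rect_partition m (m - 1))}"

text \<open>The set of integers in the description of \<open>beta\<close> is infinite but bounded above, which is why
  its maximum is taken with \<open>GREATEST\<close> and not with \<open>Max\<close>.\<close>

definition beta :: "nat \<Rightarrow> nat list \<Rightarrow> nat \<Rightarrow> int" where
  "beta g lam i = (GREATEST n. \<exists>k::int. n = (k + 1) * int g + int i \<and>
     word lam (k * int g + int i) = 0)"

definition V_coding :: "nat \<Rightarrow> nat \<Rightarrow> nat list \<Rightarrow> int list" where
  "V_coding g t lam = take t (rev (sorted_list_of_set (beta g lam ` {0..<g})))"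

definition mu_of :: "nat \<Rightarrow> nat list \<Rightarrow> nat \<Rightarrow> int" where
  "mu_of t lam i = V_coding (2 * t - 1) t lam ! (i - 1) + int i - int (2 * t - 1)"


section \<open>Characters and infinite products\<close>

text \<open>Finitely supported exponent vectors \<open>nat \<Rightarrow>\<^sub>0 int\<close> are Laurent monomials, so \<open>laurent\<close> is the
  ring of Laurent polynomials over the integers in countably many variables. It is an integral
  domain, and we work in its field of fractions, where the quotient of determinants that defines
  the odd orthogonal character makes sense literally. Power series over \<open>laurent\<close> embed into power
  series over \<open>laurent fract\<close>, so an identity there is an identity of Laurent polynomials
  coefficient by coefficient.\<close>

type_synonym laurent = "(nat \<Rightarrow>\<^sub>0 int) \<Rightarrow>\<^sub>0 int"

definition X :: "nat \<Rightarrow> laurent fract" where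
  "X i = to_fract (Poly_Mapping.single (Poly_Mapping.single i 1) 1)"

text \<open>Matrices are indexed from 0, hence the successors below; \<open>mu\<close> is indexed from 1.\<close>

definition so_char :: "nat \<Rightarrow> (nat \<Rightarrow> int) \<Rightarrow> laurent fract" where
  "so_char t mu =
     Determinant.det (mat t t (\<lambda>(a, b). let i = Suc a; j = Suc b in
       X i powi (mu j + int t - int j + 1) - X i powi (- (mu j + int t - int j)))) /
     Determinant.det (mat t t (\<lambda>(a, b). let i = Suc a; j = Suc b in
       X i powi (int t - int j + 1) - X i powi (- (int t - int j))))"

abbreviation xv :: "nat \<Rightarrow> laurent fract fps" where
  "xv i \<equiv> fps_const (X i)"

abbreviation xv_inv :: "nat \<Rightarrow> laurent fract fps" where
  "xv_inv i \<equiv> fps_const (inverse (X i))"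

text \<open>\<open>fps_X\<close> is the formal variable \<open>T\<close>. The infinite product is taken in the metric of formal power series, that is, \<open>T\<close>-adically.
  It is only used for \<open>a\<close> divisible by \<open>T\<close>, where it converges.\<close>

definition qpoch :: "laurent fract fps \<Rightarrow> laurent fract fps" where
  "qpoch a = prodinf (\<lambda>j. 1 - a * fps_X ^ j)"

definition K_T :: "nat \<Rightarrow> laurent fract fps" where
  "K_T t = (\<Prod>(i, j) \<in> {(i, j). 1 \<le> i \<and> i < j \<and> j \<le> t}.
     qpoch (fps_X * xv i * xv j) * qpoch (fps_X * xv i * xv_inv j) *
     qpoch (fps_X * xv_inv i * xv j) * qpoch (fps_X * xv_inv i * xv_inv j))"

text \<open>The identity reads \<open>sum over lam in DD_conj_1 t of
  sign(lam) T^(|lam|/2) so_mu(lam) = (T;T)^t K_T prod_i (T x_i;T) (T/x_i;T)\<close>,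
  where every \<open>lam\<close> in \<open>DD_conj_1 t\<close> has even size. The source prints
  \<open>sign(lam) = (-1)^(|H| + |H \<inter> D|)\<close> with \<open>H = hooks_lt_plus g lam\<close> and \<open>D = main_diagonal lam\<close>.
  With these conventions that is a misprint: for \<open>lam = (1, 1)\<close>, the only partition of size 2 in
  \<open>DD_conj_1 t\<close>, both cardinalities are 1 and the character is the adjoint one, \<open>mu = (1, 1, 0, ...)\<close>,
  whereas the coefficient of \<open>T\<close> on the product side is minus the adjoint character. The characters
  that occur are linearly independent, so the identity determines the signs; the correct one is
  the printed one times \<open>(-1)^(durfee lam)\<close>.\<close>

end

theory Submission
  imports Defs
begin

text \<open>Multiplied by the Weyl denominator and a power of \<open>(T;T)\<close>, the product side becomes a product of
  theta functions, one for each positive root of \<open>B\<^sub>t\<close>, and by the Jacobi triple product a sum over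
  exponent vectors in \<open>\<int>\<^sup>t\<close>. Reindexing the summands shows that the coefficients are antisymmetric
  under permutations of the exponents, change sign under \<open>y \<mapsto> g - y\<close> in one exponent, where
  \<open>g = 2t - 1\<close>, and are quasi-periodic under \<open>y \<mapsto> y + g\<close>. Moving every exponent into \<open>0, \<dots>, t - 1\<close>
  reduces all coefficients to a single power series in \<open>T\<close>, which is found by specialising the
  variables to the negatives of \<open>g\<close>-th roots of unity. The product side is thus a sum over charge
  vectors \<open>n\<close> of alternating determinants with exponents \<open>g n\<^sub>c + c\<close>.

  A partition in \<open>DD_conj_1 t\<close> is determined by its set of beads. After a shift by one this set is
  complementary to its mirror image away from \<open>0\<close>, and it meets the residue classes modulo \<open>g\<close>
  in half lines whose ends are the charges. Half the size is the sum of the positive beads, the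
  hooks counted by \<open>hooks_lt_plus\<close> are pairs of beads with sum strictly between \<open>0\<close> and \<open>g\<close>, and the parity of
  their number yields the sign of the permutation that sorts the coding vector.\<close>

section \<open>Formal power series as limits\<close>

text \<open>The modulus g = 2 t - 1 is the dual Coxeter number of B_t: a variable x_l occurs in 2 t
  - 1 theta functions, one for e_l and two for every other index. Translation by g changes a
  coefficient only by a sign and a power of T, and translations and reflections leave exactly the t
  exponents 0, ..., t - 1. By antisymmetry only vectors that meet every class once survive. Hence
  one series is unknown, with integer coefficients that depend neither on the variables nor on the
  field; this is why a single complex specialisation determines it. At the points -zeta^a one has
  x^g = -1, so each column of the determinant becomes a scalar column times one theta series and the
  determinant splits; the minus sign also keeps x_0 away from 1, where the Weyl denominator
  vanishes. The constant term of the unknown series is never evaluated: it occurs on both sides and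
  cancels.

  On the partition side, the hook sign and the sign of reflecting and sorting the coding vector
  multiply to a constant, while the determinant carries the parity of the sum of the charges. Up to
  a fixed sign this parity is (-1)^durfee, the origin of the extra factor.\<close>

lemma tendsto_mult_fps:
  fixes f g :: "'b \<Rightarrow> 'a::comm_ring_1 fps"
  assumes "(f \<longlongrightarrow> a) F" "(g \<longlongrightarrow> b) F"
  shows "((\<lambda>x. f x * g x) \<longlongrightarrow> a * b) F"
proof (rule tendsto_fpsI)
  fix n
  have "\<forall>\<^sub>F x in F. \<forall>k\<in>{..n}. fps_nth (f x) k = fps_nth a k"
    using assms(1) by (subst eventually_ball_finite_distrib) (auto simp: tendsto_fps_iff)
  moreover have "\<forall>\<^sub>F x in F. \<forall>k\<in>{..n}. fps_nth (g x) k = fps_nth b k"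
    using assms(2) by (subst eventually_ball_finite_distrib) (auto simp: tendsto_fps_iff)
  ultimately show "\<forall>\<^sub>F x in F. fps_nth (f x * g x) n = fps_nth (a * b) n"
    by eventually_elim (auto simp: fps_mult_nth intro!: sum.cong)
qed

lemma tendsto_prod_fps:
  fixes f :: "'i \<Rightarrow> 'b \<Rightarrow> 'a::comm_ring_1 fps"
  assumes "\<And>i. i \<in> I \<Longrightarrow> (f i \<longlongrightarrow> a i) F"
  shows "((\<lambda>x. \<Prod>i\<in>I. f i x) \<longlongrightarrow> (\<Prod>i\<in>I. a i)) F"
proof (cases "finite I")
  case True
  then show ?thesis using assms
    by (induction I) (auto intro!: tendsto_mult_fps)
qed auto

lemma tendsto_power_fps:
  fixes f :: "'b \<Rightarrow> 'a::comm_ring_1 fps"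
  assumes "(f \<longlongrightarrow> a) F"
  shows "((\<lambda>x. f x ^ n) \<longlongrightarrow> a ^ n) F"
  by (induction n) (auto intro!: tendsto_mult_fps assms)

lemma fps_X_power_dvdD:
  fixes d :: "'a::comm_ring_1 fps"
  assumes "fps_X ^ n dvd d" "k < n"
  shows "fps_nth d k = 0"
  using assms by (auto simp: dvd_def fps_X_power_mult_nth)

text \<open>All factors from index \<open>n\<close> on are 1 modulo \<open>fps_X ^ n\<close>, so
  they cannot affect the coefficients below \<open>n\<close>.\<close>

lemma fps_prod_stable:
  fixes f :: "nat \<Rightarrow> 'a::comm_ring_1 fps"
  assumes f: "\<And>j. fps_X ^ j dvd f j - 1" and "n \<le> N"
  shows "fps_X ^ n dvd (\<Prod>j<N. f j) - (\<Prod>j<n. f j)"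
  using \<open>n \<le> N\<close>
proof (induction N rule: dec_induct)
  case (step N)
  have eq: "(\<Prod>j<Suc N. f j) - (\<Prod>j<n. f j) =
    (\<Prod>j<N. f j) * (f N - 1) + ((\<Prod>j<N. f j) - (\<Prod>j<n. f j))"
    by (simp add: algebra_simps)
  have "fps_X ^ n dvd f N - 1"
    using f[of N] step.hyps by (meson dvd_trans le_imp_power_dvd)
  then show ?case unfolding eq using step.IH by (intro dvd_add) auto
qed auto

lemma fps_prod_LIMSEQ:
  fixes f :: "nat \<Rightarrow> 'a::comm_ring_1 fps"
  assumes f: "\<And>j. fps_X ^ j dvd f j - 1"
  shows "(\<lambda>N. \<Prod>j<N. f j) \<longlonglongrightarrow> Abs_fps (\<lambda>k. fps_nth (\<Prod>j<Suc k. f j) k)"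
proof (rule tendsto_fpsI)
  fix n
  show "\<forall>\<^sub>F N in sequentially. fps_nth (\<Prod>j<N. f j) n =
      fps_nth (Abs_fps (\<lambda>k. fps_nth (\<Prod>j<Suc k. f j) k)) n"
    using eventually_ge_at_top[of "Suc n"]
  proof eventually_elim
    case (elim N)
    have "fps_nth ((\<Prod>j<N. f j) - (\<Prod>j<Suc n. f j)) n = 0"
      by (rule fps_X_power_dvdD[OF fps_prod_stable[OF f elim]]) auto
    then show ?case by simp
  qed
qed

text \<open>\<open>qpoch\<close> over an arbitrary commutative ring: the constant factor is found
  over the complex numbers and transferred through the integers.\<close>

definition qprod :: "'a::comm_ring_1 fps \<Rightarrow> 'a fps" where
  "qprod a = prodinf (\<lambda>j. 1 - a * fps_X ^ j)"

lemma qprod_LIMSEQ: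
  fixes a :: "'a::comm_ring_1 fps"
  assumes "fps_nth a 0 = 0"
  shows "(\<lambda>N. \<Prod>j<N. 1 - a * fps_X ^ j) \<longlonglongrightarrow> qprod a"
proof -
  define f where "f j = 1 - a * fps_X ^ j" for j
  have "fps_X ^ j dvd f j - 1" for j by (simp add: f_def)
  note lim = fps_prod_LIMSEQ[of f, OF this]
  define p where "p = Abs_fps (\<lambda>k. fps_nth (\<Prod>j<Suc k. f j) k)"
  have f0: "fps_nth (f j) 0 = 1" for j by (simp add: f_def assms)
  have "fps_nth p 0 = 1" by (simp add: p_def f0)
  then have "p \<noteq> 0" by auto
  have "(\<lambda>N. \<Prod>j\<le>N. f j) \<longlonglongrightarrow> p"
    using LIMSEQ_Suc[OF lim] by (simp add: p_def lessThan_Suc_atMost)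
  with \<open>p \<noteq> 0\<close> have hp: "raw_has_prod f 0 p" by (simp add: raw_has_prod_def)
  \<comment> \<open>\<open>has_prod\<close> also admits products with a vanishing factor. Each
    factor has constant term 1, so this case is excluded and the value is unique.\<close>
  have "f i \<noteq> 0" for i using f0[of i] by auto
  then have "prodinf f = p"
    unfolding prodinf_def has_prod_def
    using hp by (intro the_equality) (auto simp: raw_has_prod_def intro: LIMSEQ_unique)
  then show ?thesis using lim by (simp add: qprod_def p_def f_def[abs_def])
qed

lemma qprod_nth_0:
  fixes a :: "'a::comm_ring_1 fps"
  assumes "fps_nth a 0 = 0"
  shows "fps_nth (qprod a) 0 = 1"
proof -
  have "\<forall>\<^sub>F N in sequentially. fps_nth (\<Prod>j<N. 1 - a * fps_X ^ j) 0 = fps_nth (qprod a) 0"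
    using qprod_LIMSEQ[OF assms] by (auto simp: tendsto_fps_iff)
  then obtain N where "fps_nth (\<Prod>j<N. 1 - a * fps_X ^ j) 0 = fps_nth (qprod a) 0"
    by (meson eventually_sequentially order_refl)
  moreover have "fps_nth (\<Prod>j<N. 1 - a * fps_X ^ j) 0 = 1"
    by (induction N) (simp_all add: assms)
  ultimately show ?thesis by simp
qed

section \<open>Sums of monomials over index sets with finite fibres\<close>

definition finite_fibres :: "'i set \<Rightarrow> ('i \<Rightarrow> nat) \<Rightarrow> bool" where
  "finite_fibres I w \<longleftrightarrow> (\<forall>k. finite {i \<in> I. w i = k})"

text \<open>The formal sum of \<open>A i * T ^ w i\<close>. Defining it by coefficients reduces
  every rearrangement to finite sums.\<close>

definition fsum :: "'i set \<Rightarrow> ('i \<Rightarrow> nat) \<Rightarrow> ('i \<Rightarrow> 'a::comm_ring_1) \<Rightarrow> 'a fps" where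
  "fsum I w A = Abs_fps (\<lambda>k. \<Sum>i\<in>{i \<in> I. w i = k}. A i)"

lemma fsum_nth: "fps_nth (fsum I w A) k = (\<Sum>i\<in>{i \<in> I. w i = k}. A i)"
  by (simp add: fsum_def)

lemma finite_fibresD: "finite_fibres I w \<Longrightarrow> finite {i \<in> I. w i = k}"
  by (simp add: finite_fibres_def)

lemma finite_fibres_le:
  assumes "finite_fibres I w"
  shows "finite {i \<in> I. w i \<le> k}"
proof -
  have "{i \<in> I. w i \<le> k} = (\<Union>l\<le>k. {i \<in> I. w i = l})" by auto
  then show ?thesis using assms by (simp add: finite_fibres_def)
qed

lemma finite_fibres_subset: "finite_fibres I w \<Longrightarrow> J \<subseteq> I \<Longrightarrow> finite_fibres J w"
  unfolding finite_fibres_def by (blast intro: finite_subset[of "{i \<in> J. w i = _}" "{i \<in> I. w i = _}"])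

lemma fibre_times:
  fixes w :: "'i \<Rightarrow> nat" and v :: "'j \<Rightarrow> nat"
  shows "{p \<in> I \<times> J. (case p of (i, j) \<Rightarrow> w i + v j) = k} =
    (\<Union>l\<in>{0..k}. {i \<in> I. w i = l} \<times> {j \<in> J. v j = k - l})"
  by auto

lemma finite_fibres_times:
  assumes "finite_fibres I w" "finite_fibres J v"
  shows "finite_fibres (I \<times> J) (\<lambda>(i, j). w i + v j)"
  unfolding finite_fibres_def fibre_times using assms by (auto simp: finite_fibres_def)

lemma fsum_mult:
  fixes A :: "'i \<Rightarrow> 'a::comm_ring_1"
  assumes "finite_fibres I w" "finite_fibres J v"
  shows "fsum I w A * fsum J v B = fsum (I \<times> J) (\<lambda>(i, j). w i + v j) (\<lambda>(i, j). A i * B j)"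
proof (rule fps_ext)
  fix k
  have "fps_nth (fsum I w A * fsum J v B) k =
    (\<Sum>l=0..k. \<Sum>p\<in>{i \<in> I. w i = l} \<times> {j \<in> J. v j = k - l}. case p of (i, j) \<Rightarrow> A i * B j)"
    by (simp add: fps_mult_nth fsum_nth sum_product sum.cartesian_product)
  also have "\<dots> = (\<Sum>p\<in>(\<Union>l\<in>{0..k}. {i \<in> I. w i = l} \<times> {j \<in> J. v j = k - l}).
      case p of (i, j) \<Rightarrow> A i * B j)"
    by (intro sum.UNION_disjoint[symmetric]) (use assms in \<open>auto simp: finite_fibres_def\<close>)
  finally show "fps_nth (fsum I w A * fsum J v B) k =
      fps_nth (fsum (I \<times> J) (\<lambda>(i, j). w i + v j) (\<lambda>(i, j). A i * B j)) k"
    by (simp only: fsum_nth fibre_times)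
qed

lemma fibre_bij_betw:
  assumes "bij_betw h J I" "\<And>j. j \<in> J \<Longrightarrow> w (h j) = v j"
  shows "bij_betw h {j \<in> J. v j = k} {i \<in> I. w i = k}"
proof -
  have "inj_on h {j \<in> J. v j = k}" using assms by (auto simp: bij_betw_def inj_on_def)
  moreover have "h ` {j \<in> J. v j = k} = {i \<in> I. w i = k}"
    using assms by (auto simp: bij_betw_def)
  ultimately show ?thesis by (simp add: bij_betw_def)
qed

lemma finite_fibres_reindex:
  assumes "bij_betw h J I" "\<And>j. j \<in> J \<Longrightarrow> w (h j) = v j"
  shows "finite_fibres I w \<longleftrightarrow> finite_fibres J v"
  unfolding finite_fibres_def using bij_betw_finite[OF fibre_bij_betw[where w = w and v = v, OF assms]] by blast

lemma fsum_reindex: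
  assumes "bij_betw h J I" "\<And>j. j \<in> J \<Longrightarrow> w (h j) = v j" "\<And>j. j \<in> J \<Longrightarrow> A (h j) = B j"
  shows "fsum I w A = fsum J v B"
proof (rule fps_ext)
  fix k
  show "fps_nth (fsum I w A) k = fps_nth (fsum J v B) k"
    unfolding fsum_nth
    by (subst sum.reindex_bij_betw[OF fibre_bij_betw[where w = w and v = v, OF assms(1,2)], symmetric])
       (use assms(3) in \<open>auto intro!: sum.cong\<close>)
qed

lemma fsum_cong:
  assumes "I = J" "\<And>j. j \<in> J \<Longrightarrow> w j = v j" "\<And>j. j \<in> J \<Longrightarrow> A j = B j"
  shows "fsum I w A = fsum J v B"
  using fsum_reindex[of id J I w v A B] assms by auto

lemma bij_betw_PiE_insert:
  assumes "x \<notin> R"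
  shows "bij_betw (\<lambda>(y, g). g(x := y)) (I x \<times> PiE R I) (PiE (insert x R) I)"
  unfolding bij_betw_def PiE_insert_eq using inj_combinator[OF assms, of I] by simp

text \<open>Distributivity: a term of the product is a choice of one index per factor, and
  extensional functions make this choice unique. Finiteness is carried through the same induction
  because the step multiplies two such sums.\<close>

lemma fsum_prod:
  fixes A :: "'r \<Rightarrow> 'i \<Rightarrow> 'a::comm_ring_1"
  assumes "finite R" "\<And>r. r \<in> R \<Longrightarrow> finite_fibres (I r) (w r)"
  shows "finite_fibres (PiE R I) (\<lambda>n. \<Sum>r\<in>R. w r (n r)) \<and>
    (\<Prod>r\<in>R. fsum (I r) (w r) (A r)) =
    fsum (PiE R I) (\<lambda>n. \<Sum>r\<in>R. w r (n r)) (\<lambda>n. \<Prod>r\<in>R. A r (n r))"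
  using assms
proof (induction R)
  case empty
  have "{i. i = (\<lambda>x. undefined) \<and> (0::nat) = k} = (if k = 0 then {\<lambda>x. undefined} else {})"
    for k :: nat by auto
  then show ?case
    by (auto simp: finite_fibres_def fps_eq_iff fsum_nth)
next
  case (insert x R)
  let ?h = "\<lambda>(y, g). g(x := y)"
  have bij: "bij_betw ?h (I x \<times> PiE R I) (PiE (insert x R) I)"
    by (rule bij_betw_PiE_insert) fact
  have 1: "(\<Sum>r\<in>insert x R. w r (?h p r)) =
      (case p of (y, g) \<Rightarrow> w x y + (\<Sum>r\<in>R. w r (g r)))" for p
    using insert.hyps by (cases p) (auto intro!: sum.cong)
  have 2: "(\<Prod>r\<in>insert x R. A r (?h p r)) =
      (case p of (y, g) \<Rightarrow> A x y * (\<Prod>r\<in>R. A r (g r)))" for p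
    using insert.hyps by (cases p) (auto intro!: arg_cong2[of _ _ _ _ times] prod.cong)
  have IH: "finite_fibres (PiE R I) (\<lambda>n. \<Sum>r\<in>R. w r (n r))"
    "(\<Prod>r\<in>R. fsum (I r) (w r) (A r)) =
      fsum (PiE R I) (\<lambda>n. \<Sum>r\<in>R. w r (n r)) (\<lambda>n. \<Prod>r\<in>R. A r (n r))"
    using insert by auto
  have ffx: "finite_fibres (I x) (w x)" using insert by auto
  have "finite_fibres (PiE (insert x R) I) (\<lambda>n. \<Sum>r\<in>insert x R. w r (n r))"
    using finite_fibres_times[OF ffx IH(1)]
    by (subst finite_fibres_reindex[where v = "\<lambda>(y, g). w x y + (\<Sum>r\<in>R. w r (g r))", OF bij]) (use 1 in auto)
  moreover have "(\<Prod>r\<in>insert x R. fsum (I r) (w r) (A r)) =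
      fsum (PiE (insert x R) I) (\<lambda>n. \<Sum>r\<in>insert x R. w r (n r)) (\<lambda>n. \<Prod>r\<in>insert x R. A r (n r))"
    using insert.hyps IH(2) fsum_mult[OF ffx IH(1), of "A x"]
    by (subst fsum_reindex[where v = "\<lambda>(y, g). w x y + (\<Sum>r\<in>R. w r (g r))"
            and B = "\<lambda>(y, g). A x y * (\<Prod>r\<in>R. A r (g r))", OF bij]) (use 1 2 in auto)
  ultimately show ?case by blast
qed

section \<open>The Jacobi triple product\<close>

text \<open>The Gaussian binomial coefficient by the q-Pascal rule, free of division. Where
  \<open>n - k\<close> is truncated, that is for \<open>k > n\<close>, its cofactor
  \<open>gbinom q n k\<close> is 0.\<close>

fun gbinom :: "'a::comm_ring_1 \<Rightarrow> nat \<Rightarrow> nat \<Rightarrow> 'a" where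
  "gbinom q n 0 = 1"
| "gbinom q 0 (Suc k) = 0"
| "gbinom q (Suc n) (Suc k) = gbinom q n (Suc k) + q ^ (n - k) * gbinom q n k"

definition qfact :: "'a::comm_ring_1 \<Rightarrow> nat \<Rightarrow> 'a" where
  "qfact q n = (\<Prod>j<n. 1 - q ^ Suc j)"

lemma qfact_simps [simp]: "qfact q 0 = 1" "qfact q (Suc n) = qfact q n * (1 - q ^ Suc n)"
  by (simp_all add: qfact_def)

lemma gbinom_eq_0: "n < k \<Longrightarrow> gbinom q n k = 0"
  by (induction q n k rule: gbinom.induct) auto

text \<open>The quotient formula in multiplied form. With \<open>n = i + 1 + d\<close> the step is 1
  - q^(n+1) = (1 - q^(d+1)) + q^(d+1) (1 - q^(i+1)).\<close>

lemma gbinom_qfact: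
  "k \<le> n \<Longrightarrow> gbinom q n k * qfact q k * qfact q (n - k) = qfact q n"
proof (induction n arbitrary: k)
  case (Suc n)
  show ?case
  proof (cases k)
    case (Suc i)
    then have "i \<le> n" using Suc.prems by simp
    show ?thesis
    proof (cases "i = n")
      case True
      then show ?thesis using Suc Suc.IH[of n] by (simp add: gbinom_eq_0 flip: mult.assoc)
    next
      case False
      then obtain d where d: "n = Suc i + d" using \<open>i \<le> n\<close> less_iff_Suc_add
        by (metis add_Suc le_neq_implies_less)
      have 1: "gbinom q n (Suc i) * (qfact q i * (1 - q ^ Suc i)) * qfact q d = qfact q n"
        using Suc.IH[of "Suc i"] d by simp
      have 2: "gbinom q n i * qfact q i * (qfact q d * (1 - q ^ Suc d)) = qfact q n"
        using Suc.IH[of i] d by simp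
      have "gbinom q (Suc n) (Suc i) * qfact q (Suc i) * qfact q (Suc n - Suc i) =
        (gbinom q n (Suc i) * (qfact q i * (1 - q ^ Suc i)) * qfact q d) * (1 - q ^ Suc d) +
        (gbinom q n i * qfact q i * (qfact q d * (1 - q ^ Suc d))) * (q ^ Suc d * (1 - q ^ Suc i))"
        using d by (simp add: algebra_simps)
      also have "\<dots> = qfact q n * ((1 - q ^ Suc d) + q ^ Suc d * (1 - q ^ Suc i))"
        unfolding 1 2 by (simp add: algebra_simps)
      also have "(1 - q ^ Suc d) + q ^ Suc d * (1 - q ^ Suc i) = 1 - q ^ Suc n"
        unfolding d by (simp add: algebra_simps power_add)
      finally show ?thesis by (simp add: Suc)
    qed
  qed auto
qed auto

lemma gbinom_sym:
  fixes q :: "'a::idom"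
  assumes "\<And>n. qfact q n \<noteq> 0" "k \<le> n"
  shows "gbinom q n (n - k) = gbinom q n k"
proof -
  have "gbinom q n (n - k) * qfact q (n - k) * qfact q (n - (n - k)) =
    gbinom q n k * qfact q k * qfact q (n - k)"
    using gbinom_qfact[of k n q] gbinom_qfact[of "n - k" n q] assms(2) by simp
  then show ?thesis using assms by auto
qed

text \<open>The binomial coefficient "n choose 2" for every integer n; it is never negative and so
  may serve as a power of T.\<close>

definition triang :: "int \<Rightarrow> nat" where
  "triang n = nat (n * (n - 1) div 2)"

lemma triang_times_2: "2 * int (triang n) = n * (n - 1)"
proof -
  have "n * (n - 1) \<ge> 0" by (cases "n \<ge> 1") (auto intro: mult_nonneg_nonneg mult_nonpos_nonpos)
  moreover have "even (n * (n - 1))" by auto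
  ultimately show ?thesis by (simp add: triang_def)
qed

lemma triang_Suc: "int (triang (n + 1)) = int (triang n) + n"
  using triang_times_2[of n] triang_times_2[of "n + 1"] by (simp add: algebra_simps)

lemma triang_reflect: "triang (1 - n) = triang n"
  using triang_times_2[of n] triang_times_2[of "1 - n"] by (simp add: algebra_simps)

lemma triang_ge: "\<bar>n\<bar> \<le> int (triang n) + 1"
proof -
  have "n * (n - 1) \<ge> 2 * \<bar>n\<bar> - 2"
  proof (cases "n \<ge> 0")
    case True
    have "(n - 1) * (n - 2) \<ge> 0"
      by (cases "n \<ge> 2") (auto intro: mult_nonneg_nonneg mult_nonpos_nonpos)
    then show ?thesis using True by (simp add: algebra_simps)
  next
    case False
    then have "n * (n + 1) \<ge> 0" by (intro mult_nonpos_nonpos) auto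
    then show ?thesis using False by (simp add: algebra_simps)
  qed
  then show ?thesis using triang_times_2[of n] by simp
qed

lemma finite_fibres_if_abs_le:
  assumes "\<And>n. \<bar>n\<bar> \<le> int (w n) + c"
  shows "finite_fibres (UNIV :: int set) w"
  unfolding finite_fibres_def
proof
  fix k
  have "{i \<in> UNIV. w i = k} \<subseteq> {- (int k + c)..int k + c}"
  proof
    fix i assume "i \<in> {i \<in> UNIV. w i = k}"
    then show "i \<in> {- (int k + c)..int k + c}" using assms[of i] by auto
  qed
  then show "finite {i \<in> UNIV. w i = k}" using finite_subset by blast
qed

lemma finite_fibres_triang: "finite_fibres UNIV triang"
  by (rule finite_fibres_if_abs_le[OF triang_ge])

text \<open>Ramanujan's two-variable form of a theta term: both exponents are natural numbers, so no
  inverses are involved, and exchanging \<open>a\<close> and \<open>b\<close> amounts to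
  \<open>m \<mapsto> - m\<close>.\<close>

definition jterm :: "'a::comm_ring_1 \<Rightarrow> 'a \<Rightarrow> int \<Rightarrow> 'a" where
  "jterm a b m = a ^ triang (m + 1) * b ^ triang m"

lemma jterm_swap: "jterm b a m = jterm a b (- m)"
  using triang_reflect[of "m + 1"] triang_reflect[of m] by (simp add: jterm_def mult.commute)

text \<open>Consecutive terms have ratio \<open>a * (a * b) ^ j\<close>; the power of
  \<open>a * b\<close> is split so that no negative exponent arises.\<close>

lemma jterm_step:
  assumes "j \<le> int n"
  shows "(a * b) ^ n * a * jterm a b j = (a * b) ^ nat (int n - j) * jterm a b (j + 1)"
proof -
  have 1: "n + 1 + triang (j + 1) = nat (int n - j) + triang (j + 2)"
    using assms triang_Suc[of "j + 1"] by (simp add: algebra_simps)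
  have 2: "n + triang j = nat (int n - j) + triang (j + 1)"
    using assms triang_Suc[of j] by simp
  have "(a * b) ^ n * a * jterm a b j = a ^ (n + 1 + triang (j + 1)) * b ^ (n + triang j)"
    by (simp add: jterm_def power_add power_mult_distrib mult_ac)
  also have "\<dots> = a ^ (nat (int n - j) + triang (j + 2)) * b ^ (nat (int n - j) + triang (j + 1))"
    by (simp only: 1 2)
  also have "\<dots> = (a * b) ^ nat (int n - j) * jterm a b (j + 1)"
    by (simp add: jterm_def power_add power_mult_distrib mult_ac add.commute[of j 2])
  finally show ?thesis .
qed

text \<open>One more factor containing \<open>a\<close> acts on the coefficients by the q-Pascal
  rule; \<open>i0\<close> is the number of factors containing \<open>b\<close>.\<close>

lemma gbinom_sum_step:
  fixes a b :: "'a::comm_ring_1"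
  defines "q \<equiv> a * b"
  assumes "i0 \<le> N"
  shows "(1 + q ^ (N - i0) * a) * (\<Sum>i\<le>N. gbinom q N i * jterm a b (int i - int i0)) =
    (\<Sum>i\<le>Suc N. gbinom q (Suc N) i * jterm a b (int i - int i0))"
proof -
  have step: "q ^ (N - i0) * a * jterm a b (int i - int i0) = q ^ (N - i) * jterm a b (int (Suc i) - int i0)"
    if "i \<le> N" for i
    using jterm_step[of "int i - int i0" "N - i0" a b] that assms
    by (simp add: q_def algebra_simps of_nat_diff nat_diff_distrib)
  have "(\<Sum>i\<le>Suc N. gbinom q (Suc N) i * jterm a b (int i - int i0)) =
    jterm a b (- int i0) + (\<Sum>i\<le>N. gbinom q N (Suc i) * jterm a b (int (Suc i) - int i0)) +
    (\<Sum>i\<le>N. q ^ (N - i) * gbinom q N i * jterm a b (int (Suc i) - int i0))"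
    by (subst sum.atMost_Suc_shift) (simp add: sum.distrib algebra_simps)
  also have "jterm a b (- int i0) + (\<Sum>i\<le>N. gbinom q N (Suc i) * jterm a b (int (Suc i) - int i0)) =
    (\<Sum>i\<le>Suc N. gbinom q N i * jterm a b (int i - int i0))"
    by (subst sum.atMost_Suc_shift) simp
  also have "\<dots> = (\<Sum>i\<le>N. gbinom q N i * jterm a b (int i - int i0))"
    by (simp add: gbinom_eq_0)
  also have "(\<Sum>i\<le>N. q ^ (N - i) * gbinom q N i * jterm a b (int (Suc i) - int i0)) =
    (\<Sum>i\<le>N. q ^ (N - i0) * a * (gbinom q N i * jterm a b (int i - int i0)))"
    using step by (intro sum.cong refl) (simp add: mult.assoc mult.left_commute[of _ "gbinom q N _"])
  finally show ?thesis by (simp add: algebra_simps sum_distrib_left sum.distrib)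
qed

text \<open>Induction on the factors containing \<open>a\<close>. The base case is the q-binomial
  theorem for \<open>b\<close>, read backwards; this uses the symmetry of the Gaussian binomials and
  hence cancellation of q-factorials.\<close>

lemma finite_triple_product:
  fixes a b :: "'a::idom"
  defines "q \<equiv> a * b"
  assumes "\<And>n. qfact q n \<noteq> 0"
  shows "(\<Prod>k<n. 1 + q ^ k * a) * (\<Prod>k<m. 1 + q ^ k * b) =
    (\<Sum>i\<le>n + m. gbinom q (n + m) i * jterm a b (int i - int m))"
proof -
  have base: "(\<Prod>k<m. 1 + (a * b) ^ k * a) = (\<Sum>i\<le>m. gbinom (a * b) m i * jterm a b (int i))"
    for m and a b :: 'a
  proof (induction m)
    case (Suc m)
    have "(\<Prod>k<Suc m. 1 + (a * b) ^ k * a) =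
        (1 + (a * b) ^ (m - 0) * a) * (\<Sum>i\<le>m. gbinom (a * b) m i * jterm a b (int i - int 0))"
      using Suc by simp
    also have "\<dots> = (\<Sum>i\<le>Suc m. gbinom (a * b) (Suc m) i * jterm a b (int i - int 0))"
      by (rule gbinom_sum_step) simp
    finally show ?case by simp
  qed (simp add: jterm_def triang_def)
  show ?thesis
  proof (induction n)
    case 0
    have "(\<Prod>k<m. 1 + q ^ k * b) = (\<Sum>i\<le>m. gbinom q m i * jterm a b (- int i))"
      using base[of b a m] by (simp add: q_def mult.commute[of a b] jterm_swap[of b a])
    also have "\<dots> = (\<Sum>i\<le>m. gbinom q m (m - i) * jterm a b (- int (m - i)))"
      by (rule sum.reindex_bij_witness[of _ "\<lambda>i. m - i" "\<lambda>i. m - i"]) auto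
    also have "\<dots> = (\<Sum>i\<le>m. gbinom q m i * jterm a b (int i - int m))"
      using assms(2) by (intro sum.cong) (auto simp: gbinom_sym of_nat_diff)
    finally show ?case by simp
  next
    case (Suc n)
    have "(\<Prod>k<Suc n. 1 + q ^ k * a) * (\<Prod>k<m. 1 + q ^ k * b) =
        (1 + q ^ n * a) * (\<Sum>i\<le>n + m. gbinom q (n + m) i * jterm a b (int i - int m))"
      by (simp flip: Suc)
    also have "\<dots> = (\<Sum>i\<le>Suc (n + m). gbinom q (Suc (n + m)) i * jterm a b (int i - int m))"
      using gbinom_sum_step[of m "n + m" a b] by (simp add: q_def)
    finally show ?case by simp
  qed
qed

theorem jacobi_triple_product:
  fixes a b :: "'a::field fps"
  defines "q \<equiv> a * b"
  assumes q: "fps_nth q 0 = 0"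
    and A: "\<And>m. jterm a b m = fps_const (A m) * fps_X ^ w m"
    and fin: "finite_fibres UNIV w"
  shows "(\<lambda>n. \<Prod>k<n. (1 - q ^ Suc k) * (1 + q ^ k * a) * (1 + q ^ k * b)) \<longlonglongrightarrow> fsum UNIV w A"
proof (rule tendsto_fpsI)
  fix k
  have qf0: "fps_nth (qfact q n) 0 = 1" for n
    by (induction n) (simp_all add: q)
  have qf: "qfact q n \<noteq> 0" for n
    using qf0[of n] by auto
  have "fps_X dvd q" 
    using q by (intro dvdI[of _ _ "fps_shift 1 q"] fps_ext) auto
  have stable: "fps_X ^ Suc k dvd qfact q N - qfact q (Suc k)" if "Suc k \<le> N" for N
    unfolding qfact_def
  proof (rule fps_prod_stable[OF _ that])
    fix j
    have "fps_X ^ j dvd q ^ Suc j"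
      using \<open>fps_X dvd q\<close> by (simp add: dvd_power_same dvd_mult)
    then show "fps_X ^ j dvd 1 - q ^ Suc j - 1" by simp
  qed
  have stable2: "fps_X ^ Suc k dvd qfact q N - qfact q N'" if "Suc k \<le> N" "Suc k \<le> N'" for N N'
    using dvd_diff[OF stable[OF that(1)] stable[OF that(2)]] by simp
  have "finite {m. w m \<le> k}" using finite_fibres_le[OF fin] by simp
  then have fin': "finite ((\<lambda>m. nat \<bar>m\<bar>) ` {m. w m \<le> k})" by simp
  \<comment> \<open>A term with index beyond \<open>M\<close> in absolute value is divisible by a
    power of T above \<open>k\<close>, so coefficient \<open>k\<close> sees only indices between
    \<open>- M\<close> and \<open>M\<close>.\<close>
  define M where "M = Max (insert 0 ((\<lambda>m. nat \<bar>m\<bar>) ` {m. w m \<le> k}))"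
  have M: "\<bar>m\<bar> \<le> int M" if "w m \<le> k" for m
  proof -
    have "nat \<bar>m\<bar> \<le> M" unfolding M_def using fin' that by (intro Max_ge) auto
    then show ?thesis by simp
  qed
  show "\<forall>\<^sub>F n in sequentially. fps_nth (\<Prod>k<n. (1 - q ^ Suc k) * (1 + q ^ k * a) * (1 + q ^ k * b)) k =
      fps_nth (fsum UNIV w A) k"
    \<comment> \<open>For the relevant \<open>i\<close> this makes \<open>i\<close>,
      \<open>2 n - i\<close> and \<open>n\<close> all exceed \<open>k\<close>, so the three
      q-factorials agree modulo T^(k+1).\<close>
    using eventually_ge_at_top[of "M + k + 1"]
  proof eventually_elim
    case (elim n)
    have summand: "fps_nth (qfact q n * gbinom q (n + n) i * jterm a b (int i - int n)) k =
        fps_nth (jterm a b (int i - int n)) k" if "i \<le> n + n" for i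
    proof (cases "w (int i - int n) \<le> k")
      case False
      then have "k < w (int i - int n)" by simp
      moreover have "fps_X ^ w (int i - int n) dvd jterm a b (int i - int n)"
        unfolding A by simp
      ultimately show ?thesis
        using fps_X_power_dvdD[of _ _ k] dvd_mult by metis
    next
      case True
      then have "\<bar>int i - int n\<bar> \<le> int M" by (rule M)
      then have i: "Suc k \<le> i" "Suc k \<le> n + n - i" "Suc k \<le> n" "Suc k \<le> n + n"
        using elim that by linarith+
      let ?Q = "qfact q n" and ?g = "gbinom q (n + n) i"
      have g: "?g * qfact q i * qfact q (n + n - i) = qfact q (n + n)"
        by (rule gbinom_qfact[OF that])
      \<comment> \<open>\<open>?Q * ?g\<close> tends to 1: after multiplication by the unit
        \<open>?Q\<close>, its distance from 1 is a combination of differences of q-factorials, each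
        divisible by T^(k+1).\<close>
      have "?Q * (?Q * ?g - 1) = ?g * (?Q * (?Q - qfact q i) + qfact q i * (?Q - qfact q (n + n - i))) +
          (qfact q (n + n) - ?Q)"
        unfolding g[symmetric] by (simp add: algebra_simps)
      moreover have "fps_X ^ Suc k dvd \<dots>"
        by (intro dvd_add dvd_mult stable2 i)
      ultimately have "fps_X ^ Suc k dvd ?Q * (?Q * ?g - 1)" by simp
      then have "fps_X ^ Suc k dvd inverse ?Q * (?Q * (?Q * ?g - 1))" by (rule dvd_mult)
      moreover have "inverse ?Q * ?Q = 1" by (rule inverse_mult_eq_1) (simp add: qf0)
      ultimately have "fps_X ^ Suc k dvd ?Q * ?g - 1" by (simp flip: mult.assoc)
      then have "fps_X ^ Suc k dvd (?Q * ?g - 1) * jterm a b (int i - int n)" by (rule dvd_mult2)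
      from fps_X_power_dvdD[OF this, of k] show ?thesis by (simp add: algebra_simps)
    qed
    have prod_eq: "(\<Prod>k<n. (1 - q ^ Suc k) * (1 + q ^ k * a) * (1 + q ^ k * b)) =
      (\<Sum>i\<le>n + n. qfact q n * gbinom q (n + n) i * jterm a b (int i - int n))"
      using finite_triple_product[of a b n n] qf
      by (simp add: prod.distrib qfact_def q_def sum_distrib_left mult.assoc)
    have "fps_nth (\<Prod>k<n. (1 - q ^ Suc k) * (1 + q ^ k * a) * (1 + q ^ k * b)) k =
      (\<Sum>i\<le>n + n. fps_nth (jterm a b (int i - int n)) k)"
      unfolding prod_eq fps_sum_nth by (intro sum.cong refl summand) auto
    also have "\<dots> = (\<Sum>m\<in>{-int n..int n}. fps_nth (jterm a b m) k)"
      by (rule sum.reindex_bij_witness[of _ "\<lambda>m. nat (m + int n)" "\<lambda>i. int i - int n"]) auto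
    also have "\<dots> = (\<Sum>m\<in>{-int n..int n}. if w m = k then A m else 0)"
      by (intro sum.cong) (auto simp: A)
    also have "\<dots> = (\<Sum>m\<in>{m. w m = k}. A m)"
      using M elim by (intro sum.mono_neutral_cong_right) (auto simp: finite_fibresD[OF fin, simplified] abs_le_iff, force+)
    finally show ?case by (simp add: fsum_nth)
  qed
qed

section \<open>Products over pairs of indices\<close>

definition lt_pairs :: "nat \<Rightarrow> (nat \<times> nat) set" where
  "lt_pairs t = {(i, j). i < j \<and> j < t}"

lemma finite_lt_pairs [simp]: "finite (lt_pairs t)"
  by (rule finite_subset[of _ "{..<t} \<times> {..<t}"]) (auto simp: lt_pairs_def)

text \<open>The entries (i, j) and (j, i) are kept together because they carry the roots e_i - e_j
  and e_i + e_j. Working in \<open>comm_monoid_set\<close> yields sums and products at once.\<close>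

lemma (in comm_monoid_set) square_split:
  "F \<phi> ({..<t} \<times> {..<t}) =
    F (\<lambda>i. \<phi> (i, i)) {..<t} \<^bold>* F (\<lambda>(i, j). \<phi> (i, j) \<^bold>* \<phi> (j, i)) (lt_pairs t)"
proof -
  let ?D = "(\<lambda>i. (i, i)) ` {..<t}" and ?S = "prod.swap ` lt_pairs t"
  have eq: "{..<t} \<times> {..<t} = ?D \<union> (lt_pairs t \<union> ?S)"
    by (auto simp: lt_pairs_def image_iff)
  have "F \<phi> (?D \<union> (lt_pairs t \<union> ?S)) = F \<phi> ?D \<^bold>* (F \<phi> (lt_pairs t) \<^bold>* F \<phi> ?S)"
    by (subst union_disjoint, simp, simp, force simp: lt_pairs_def,
        subst union_disjoint, simp, simp, force simp: lt_pairs_def, rule refl)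
  also have "F \<phi> ?D = F (\<lambda>i. \<phi> (i, i)) {..<t}"
    by (subst reindex) (auto simp: inj_on_def o_def)
  also have "F \<phi> ?S = F (\<lambda>(i, j). \<phi> (j, i)) (lt_pairs t)"
    by (subst reindex) (auto simp: inj_on_def o_def case_prod_unfold prod.swap_def)
  also have "F \<phi> (lt_pairs t) \<^bold>* F (\<lambda>(i, j). \<phi> (j, i)) (lt_pairs t) =
      F (\<lambda>(i, j). \<phi> (i, j) \<^bold>* \<phi> (j, i)) (lt_pairs t)"
    by (subst distrib[symmetric]) (simp add: case_prod_unfold)
  finally show ?thesis unfolding eq .
qed

lemma (in comm_monoid_set) offdiagonal_split:
  "F (\<lambda>i. F (\<phi> i) ({..<t} - {i})) {..<t} = F (\<lambda>(i, j). \<phi> i j \<^bold>* \<phi> j i) (lt_pairs t)"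
proof -
  have "F (\<lambda>i. F (\<phi> i) ({..<t} - {i})) {..<t} =
      F (\<lambda>i. F (\<lambda>j. if i = j then \<^bold>1 else \<phi> i j) {..<t}) {..<t}"
    by (intro cong refl mono_neutral_cong_left) auto
  also have "\<dots> = F (\<lambda>(i, j). if i = j then \<^bold>1 else \<phi> i j) ({..<t} \<times> {..<t})"
    by (rule cartesian_product)
  also have "\<dots> = F (\<lambda>(i, j). \<phi> i j \<^bold>* \<phi> j i) (lt_pairs t)"
    unfolding square_split by (auto intro!: cong simp: lt_pairs_def)
  finally show ?thesis .
qed

text \<open>A permutation acts on two-element subsets; increasing pairs represent these, hence the
  sorting by \<open>min\<close> and \<open>max\<close>.\<close>

lemma bij_betw_sort_pair:
  assumes "\<sigma> permutes {..<t}"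
  shows "bij_betw (\<lambda>(i, j). (min (\<sigma> i) (\<sigma> j), max (\<sigma> i) (\<sigma> j))) (lt_pairs t) (lt_pairs t)"
proof -
  let ?h = "\<lambda>(i, j). (min (\<sigma> i) (\<sigma> j), max (\<sigma> i) (\<sigma> j))"
  have inj: "\<sigma> i = \<sigma> j \<longleftrightarrow> i = j" for i j using permutes_inj[OF assms] by (auto dest: injD)
  have lt: "\<sigma> i < t" if "i < t" for i using permutes_in_image[OF assms, of i] that by simp
  have "inj_on ?h (lt_pairs t)"
    by (rule inj_onI) (auto simp: lt_pairs_def min_def max_def inj split: if_splits)
  moreover have "?h ` lt_pairs t \<subseteq> lt_pairs t"
  proof
    fix p assume "p \<in> ?h ` lt_pairs t"
    then obtain i j where ij: "i < j" "j < t" "p = (min (\<sigma> i) (\<sigma> j), max (\<sigma> i) (\<sigma> j))"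
      by (auto simp: lt_pairs_def)
    with inj[of i j] lt[of i] lt[of j] show "p \<in> lt_pairs t" by (auto simp: lt_pairs_def)
  qed
  ultimately show ?thesis
    by (simp add: bij_betw_def endo_inj_surj)
qed

lemma (in comm_monoid_set) symmetric_permute:
  assumes "\<sigma> permutes {..<t}" and sym: "\<And>i j. i < t \<Longrightarrow> j < t \<Longrightarrow> i \<noteq> j \<Longrightarrow> s i j = s j i"
  shows "F (\<lambda>(i, j). s (\<sigma> i) (\<sigma> j)) (lt_pairs t) = F (\<lambda>(i, j). s i j) (lt_pairs t)"
proof -
  have inj: "\<sigma> i = \<sigma> j \<longleftrightarrow> i = j" for i j using permutes_inj[OF assms(1)] by (auto dest: injD)
  have lt: "\<sigma> i < t" if "i < t" for i using permutes_in_image[OF assms(1), of i] that by simp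
  show ?thesis
    by (subst reindex_bij_betw[OF bij_betw_sort_pair[OF assms(1)], symmetric])
       (auto simp: lt_pairs_def min_def max_def inj lt intro!: cong sym)
qed

section \<open>The sign of a permutation as the parity of its inversions\<close>

definition inv_sign :: "nat \<Rightarrow> (nat \<Rightarrow> nat) \<Rightarrow> int" where
  "inv_sign t \<sigma> = (\<Prod>(i, j)\<in>lt_pairs t. if \<sigma> i < \<sigma> j then 1 else - 1)"

lemma antisymmetric_permute_inv_sign:
  fixes s :: "nat \<Rightarrow> nat \<Rightarrow> 'a::comm_ring_1"
  assumes "\<sigma> permutes {..<t}"
    and anti: "\<And>i j. i < t \<Longrightarrow> j < t \<Longrightarrow> i \<noteq> j \<Longrightarrow> s j i = - s i j"
  shows "(\<Prod>(i, j)\<in>lt_pairs t. s (\<sigma> i) (\<sigma> j)) =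
    of_int (inv_sign t \<sigma>) * (\<Prod>(i, j)\<in>lt_pairs t. s i j)"
proof -
  have inj: "\<sigma> i = \<sigma> j \<longleftrightarrow> i = j" for i j using permutes_inj[OF assms(1)] by (auto dest: injD)
  have lt: "\<sigma> i < t" if "i < t" for i using permutes_in_image[OF assms(1), of i] that by simp
  have "(\<Prod>(i, j)\<in>lt_pairs t. s i j) = (\<Prod>(i, j)\<in>lt_pairs t. s (min (\<sigma> i) (\<sigma> j)) (max (\<sigma> i) (\<sigma> j)))"
    by (subst prod.reindex_bij_betw[OF bij_betw_sort_pair[OF assms(1)], symmetric])
       (simp add: case_prod_unfold)
  also have "of_int (inv_sign t \<sigma>) * \<dots> =
    (\<Prod>(i, j)\<in>lt_pairs t. (if \<sigma> i < \<sigma> j then 1 else - 1) * s (min (\<sigma> i) (\<sigma> j)) (max (\<sigma> i) (\<sigma> j)))"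
    unfolding inv_sign_def of_int_prod by (subst prod.distrib[symmetric]) (auto intro!: prod.cong)
  also have "\<dots> = (\<Prod>(i, j)\<in>lt_pairs t. s (\<sigma> i) (\<sigma> j))"
  proof (intro prod.cong refl, clarify)
    fix i j assume "(i, j) \<in> lt_pairs t"
    then have ij: "i < j" "i < t" "j < t" by (auto simp: lt_pairs_def)
    then have "\<sigma> i \<noteq> \<sigma> j" using inj[of i j] by auto
    then show "(if \<sigma> i < \<sigma> j then 1 else - 1) * s (min (\<sigma> i) (\<sigma> j)) (max (\<sigma> i) (\<sigma> j)) =
        s (\<sigma> i) (\<sigma> j)"
      using anti[of "\<sigma> i" "\<sigma> j"] lt ij by (auto simp: min_def max_def)
  qed
  finally show ?thesis by simp
qed

text \<open>The comparison sign of \<open>\<sigma> i\<close> and \<open>\<sigma> j\<close> is itself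
  antisymmetric in i and j, so the previous lemma, applied to it, gives multiplicativity.\<close>

lemma inv_sign_compose:
  assumes "\<sigma> permutes {..<t}" "\<tau> permutes {..<t}"
  shows "inv_sign t (\<sigma> \<circ> \<tau>) = inv_sign t \<sigma> * inv_sign t \<tau>"
proof -
  have inj: "\<sigma> i = \<sigma> j \<longleftrightarrow> i = j" for i j using permutes_inj[OF assms(1)] by (auto dest: injD)
  define s :: "nat \<Rightarrow> nat \<Rightarrow> int" where "s i j = (if \<sigma> i < \<sigma> j then 1 else - 1)" for i j
  have "(\<Prod>(i, j)\<in>lt_pairs t. s (\<tau> i) (\<tau> j)) =
      of_int (inv_sign t \<tau>) * (\<Prod>(i, j)\<in>lt_pairs t. s i j)"
    by (rule antisymmetric_permute_inv_sign[OF assms(2)]) (use inj in \<open>auto simp: s_def\<close>)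
  then show ?thesis by (simp add: inv_sign_def s_def)
qed

lemma inv_sign_id: "inv_sign t id = 1"
  by (simp add: inv_sign_def) (auto intro!: prod.neutral simp: lt_pairs_def)

lemma inv_sign_transpose:
  assumes "a < t" "b < t" "a \<noteq> b"
  shows "inv_sign t (Transposition.transpose a b) = - 1"
proof -
  have t: "1 < t" using assms by auto
  let ?\<tau> = "Transposition.transpose 0 (1::nat)"
  \<comment> \<open>A permutation with 0 mapped to a and 1 to b. It conjugates the given
    transposition into that of 0 and 1, whose only inversion is (0, 1).\<close>
  define \<pi> where "\<pi> = Transposition.transpose 0 a \<circ> Transposition.transpose 1 (Transposition.transpose 0 a b)"
  have \<pi>: "\<pi> permutes {..<t}" unfolding \<pi>_def
    using assms t by (intro permutes_compose permutes_swap_id) (auto simp: Transposition.transpose_def)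
  have \<pi>01: "\<pi> 0 = a" "\<pi> 1 = b"
    using assms by (auto simp: \<pi>_def Transposition.transpose_def)
  have b\<pi>: "bij \<pi>" by (rule permutes_bij[OF \<pi>])
  have eq: "Transposition.transpose a b \<circ> \<pi> = \<pi> \<circ> ?\<tau>"
    using \<pi>01 permutes_inj[OF \<pi>] by (auto simp: fun_eq_iff Transposition.transpose_def inj_eq)
  have \<tau>: "?\<tau> permutes {..<t}" using t by (intro permutes_swap_id) auto
  have ab: "Transposition.transpose a b permutes {..<t}" using assms by (intro permutes_swap_id) auto
  have "inv_sign t (Transposition.transpose a b) * inv_sign t \<pi> = inv_sign t \<pi> * inv_sign t ?\<tau>"
    using inv_sign_compose[OF ab \<pi>] inv_sign_compose[OF \<pi> \<tau>] eq by simp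
  moreover have "inv_sign t \<pi> \<noteq> 0" by (auto simp: inv_sign_def split: if_splits)
  ultimately have "inv_sign t (Transposition.transpose a b) = inv_sign t ?\<tau>" by simp
  also have "\<dots> = (\<Prod>p\<in>lt_pairs t. if p = (0, 1) then - 1 else 1)"
    unfolding inv_sign_def
    by (intro prod.cong refl) (auto simp: lt_pairs_def Transposition.transpose_def split: if_splits)
  also have "\<dots> = - 1"
    using t by (subst prod.delta, simp) (auto simp: lt_pairs_def)
  finally show ?thesis .
qed

lemma inv_sign_eq_sign:
  assumes "\<sigma> permutes {..<t}"
  shows "inv_sign t \<sigma> = sign \<sigma>"
  using assms finite_lessThan
proof (induction rule: permutes_induct)
  case id
  then show ?case using inv_sign_id by (simp add: id_def)
next
  case (swap a b p)
  then have "inv_sign t (Transposition.transpose a b \<circ> p) = - sign p"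
    using inv_sign_compose[OF permutes_swap_id[of a "{..<t}" b] \<open>p permutes _\<close>]
    by (simp add: inv_sign_transpose)
  moreover have "sign (Transposition.transpose a b \<circ> p) = - sign p"
    using swap by (subst sign_compose)
      (auto simp: sign_swap_id permutation_swap_id intro: permutation_permutes[THEN iffD2])
  ultimately show ?case by (simp only:)
qed

lemma prod_antisymmetric_permute:
  fixes s :: "nat \<Rightarrow> nat \<Rightarrow> 'a::comm_ring_1"
  assumes "\<sigma> permutes {..<t}"
    and "\<And>i j. i < t \<Longrightarrow> j < t \<Longrightarrow> i \<noteq> j \<Longrightarrow> s j i = - s i j"
  shows "(\<Prod>(i, j)\<in>lt_pairs t. s (\<sigma> i) (\<sigma> j)) = of_int (sign \<sigma>) * (\<Prod>(i, j)\<in>lt_pairs t. s i j)"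
  unfolding inv_sign_eq_sign[OF assms(1), symmetric]
  by (rule antisymmetric_permute_inv_sign[OF assms(1)]) (rule assms(2))

section \<open>The coefficients of the theta product\<close>

definition msgn :: "int \<Rightarrow> 'a::comm_ring_1" where
  "msgn n = (if even n then 1 else - 1)"

lemma msgn_simps [simp]: "msgn 0 = 1" "msgn 1 = - 1" "msgn (- n) = msgn n" "msgn n * msgn n = 1"
  by (simp_all add: msgn_def)

lemma msgn_add: "msgn (m + n) = msgn m * msgn n"
  by (simp add: msgn_def)

lemma msgn_diff: "msgn (m - n) = msgn m * msgn n"
  by (simp add: msgn_def)

lemma of_int_msgn [simp]: "of_int (msgn n) = msgn n"
  by (simp add: msgn_def)

lemma msgn_sum: "finite A \<Longrightarrow> msgn (\<Sum>i\<in>A. f i) = (\<Prod>i\<in>A. msgn (f i))"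
  by (induction A rule: finite_induct) (simp_all add: msgn_add)

context
  fixes t :: nat
begin

abbreviation (input) sq :: "(nat \<times> nat) set" where "sq \<equiv> {..<t} \<times> {..<t}"

text \<open>A term of the expanded product of theta functions is a choice of an integer for every
  positive root: \<open>n (i, i)\<close> for \<open>e\<^sub>i\<close>, and for \<open>i < j\<close> the entries \<open>n (i, j)\<close> and \<open>n (j, i)\<close>
  for \<open>e\<^sub>i - e\<^sub>j\<close> and \<open>e\<^sub>i + e\<^sub>j\<close>. The convention \<open>dexp n j i = 1 - dexp n i j\<close> makes the Weyl group
  act by permuting indices; the shift it causes in the exponent is absorbed by \<open>\<Prod>x\<^sub>a\<^sup>a\<close>.\<close>

definition configs :: "(nat \<times> nat \<Rightarrow> int) set" where
  "configs = PiE sq (\<lambda>_. UNIV)"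

definition dexp :: "(nat \<times> nat \<Rightarrow> int) \<Rightarrow> nat \<Rightarrow> nat \<Rightarrow> int" where
  "dexp n i j = (if i < j then n (i, j) else 1 - n (j, i))"

definition pexp :: "(nat \<times> nat \<Rightarrow> int) \<Rightarrow> nat \<Rightarrow> nat \<Rightarrow> int" where
  "pexp n i j = n (max i j, min i j)"

definition expo :: "(nat \<times> nat \<Rightarrow> int) \<Rightarrow> nat \<Rightarrow> int" where
  "expo n i = n (i, i) + (\<Sum>j\<in>{..<t} - {i}. dexp n i j + pexp n i j)"

definition energy :: "(nat \<times> nat \<Rightarrow> int) \<Rightarrow> nat" where
  "energy n = (\<Sum>r\<in>sq. triang (n r))"

definition csign :: "(nat \<times> nat \<Rightarrow> int) \<Rightarrow> int" where
  "csign n = (\<Prod>r\<in>sq. msgn (n r))"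

text \<open>The level is an integer, so that it can be shifted by exponents of either sign; fibres
  of negative level are empty.\<close>

definition cfibre :: "int \<Rightarrow> (nat \<Rightarrow> int) \<Rightarrow> (nat \<times> nat \<Rightarrow> int) set" where
  "cfibre k y = {n \<in> configs. int (energy n) = k \<and> (\<forall>i<t. expo n i = y i)}"

definition ccoeff :: "int \<Rightarrow> (nat \<Rightarrow> int) \<Rightarrow> int" where
  "ccoeff k y = (\<Sum>n\<in>cfibre k y. csign n)"

lemma dexp_swap: "i \<noteq> j \<Longrightarrow> dexp n j i = 1 - dexp n i j"
  by (auto simp: dexp_def)

lemma pexp_swap: "pexp n j i = pexp n i j"
  by (simp add: pexp_def max.commute min.commute)

lemma energy_split:
  "energy n = (\<Sum>i<t. triang (n (i, i))) + (\<Sum>(i, j)\<in>lt_pairs t. triang (dexp n i j) + triang (pexp n i j))"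
  unfolding energy_def sum.square_split
  by (intro arg_cong2[of _ _ _ _ "(+)"] sum.cong) (auto simp: lt_pairs_def dexp_def pexp_def)

lemma csign_split:
  "csign n = (\<Prod>i<t. msgn (n (i, i))) *
    ((\<Prod>(i, j)\<in>lt_pairs t. msgn (dexp n i j)) * (\<Prod>(i, j)\<in>lt_pairs t. msgn (pexp n i j)))"
proof -
  have "(\<Prod>(i, j)\<in>lt_pairs t. msgn (n (i, j)) * msgn (n (j, i))) =
      (\<Prod>(i, j)\<in>lt_pairs t. msgn (dexp n i j) * msgn (pexp n i j) :: int)"
    by (intro prod.cong) (auto simp: lt_pairs_def dexp_def pexp_def)
  then show ?thesis
    unfolding csign_def prod.square_split by (simp add: case_prod_unfold prod.distrib)
qed

lemma ccoeff_cong: "(\<And>i. i < t \<Longrightarrow> y i = z i) \<Longrightarrow> ccoeff k y = ccoeff k z"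
  by (simp add: ccoeff_def cfibre_def cong: conj_cong)

text \<open>Common scheme of the permutation, translation and reflection symmetries. The energy
  shift is required only on the fibre over \<open>y\<close>, since under translation it depends on
  the exponents.\<close>

lemma ccoeff_bij:
  assumes h: "h \<in> configs \<rightarrow> configs" and h': "h' \<in> configs \<rightarrow> configs"
    and inv: "\<And>n. n \<in> configs \<Longrightarrow> h' (h n) = n" "\<And>n. n \<in> configs \<Longrightarrow> h (h' n) = n"
    and ex: "\<And>n. n \<in> configs \<Longrightarrow> (\<forall>i<t. expo (h n) i = y' i) \<longleftrightarrow> (\<forall>i<t. expo n i = y i)"
    and en: "\<And>n. n \<in> configs \<Longrightarrow> (\<forall>i<t. expo n i = y i) \<Longrightarrow> int (energy (h n)) = int (energy n) + d"
    and sg: "\<And>n. n \<in> configs \<Longrightarrow> csign (h n) = c * csign n"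
  shows "ccoeff (k + d) y' = c * ccoeff k y"
proof -
  have "ccoeff (k + d) y' = (\<Sum>n\<in>cfibre k y. c * csign n)"
    unfolding ccoeff_def
  proof (rule sum.reindex_bij_witness[of _ h h'])
    fix n assume n: "n \<in> cfibre (k + d) y'"
    then have nc: "n \<in> configs" and n': "h' n \<in> configs" using h' by (auto simp: cfibre_def)
    show "h (h' n) = n" using inv(2)[OF nc] .
    have "\<forall>i<t. expo (h' n) i = y i" using n ex[OF n'] inv(2)[OF nc] by (simp add: cfibre_def)
    then show "h' n \<in> cfibre k y" using n n' en[OF n'] inv(2)[OF nc] by (simp add: cfibre_def)
    show "c * csign (h' n) = csign n" using sg[OF n'] inv(2)[OF nc] by simp
  next
    fix n assume n: "n \<in> cfibre k y"
    then have nc: "n \<in> configs" and n': "h n \<in> configs" using h by (auto simp: cfibre_def)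
    show "h' (h n) = n" using inv(1)[OF nc] .
    show "h n \<in> cfibre (k + d) y'" using n n' en[OF nc] ex[OF nc] by (simp add: cfibre_def)
  qed
  then show ?thesis by (simp add: ccoeff_def sum_distrib_left)
qed

section \<open>Antisymmetry of the coefficients under permutations of the exponents\<close>

definition cperm :: "(nat \<Rightarrow> nat) \<Rightarrow> (nat \<times> nat \<Rightarrow> int) \<Rightarrow> nat \<times> nat \<Rightarrow> int" where
  "cperm \<sigma> n = restrict (\<lambda>(i, j). if i = j then n (\<sigma> i, \<sigma> i)
     else if i < j then dexp n (\<sigma> i) (\<sigma> j) else pexp n (\<sigma> i) (\<sigma> j)) sq"

lemma cperm_exps:
  assumes "i < t" "j < t" "\<sigma> permutes {..<t}"
  shows "cperm \<sigma> n (i, i) = n (\<sigma> i, \<sigma> i)"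
    "i \<noteq> j \<Longrightarrow> dexp (cperm \<sigma> n) i j = dexp n (\<sigma> i) (\<sigma> j)"
    "i \<noteq> j \<Longrightarrow> pexp (cperm \<sigma> n) i j = pexp n (\<sigma> i) (\<sigma> j)"
proof -
  have inj: "\<sigma> i = \<sigma> j \<longleftrightarrow> i = j" for i j using permutes_inj[OF assms(3)] by (auto dest: injD)
  show "cperm \<sigma> n (i, i) = n (\<sigma> i, \<sigma> i)" using assms by (simp add: cperm_def)
  show "dexp (cperm \<sigma> n) i j = dexp n (\<sigma> i) (\<sigma> j)" if "i \<noteq> j"
    using assms that dexp_swap[of "\<sigma> i" "\<sigma> j" n] inj[of i j]
    unfolding dexp_def[of "cperm \<sigma> n"] by (auto simp: cperm_def)
  show "pexp (cperm \<sigma> n) i j = pexp n (\<sigma> i) (\<sigma> j)" if "i \<noteq> j"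
    using assms that pexp_swap[of n "\<sigma> i" "\<sigma> j"]
    unfolding pexp_def[of "cperm \<sigma> n"] by (auto simp: cperm_def max_def min_def)
qed

lemma config_eqI:
  assumes "n \<in> configs" "m \<in> configs" "\<And>i. i < t \<Longrightarrow> n (i, i) = m (i, i)"
    "\<And>i j. i < t \<Longrightarrow> j < t \<Longrightarrow> i \<noteq> j \<Longrightarrow> dexp n i j = dexp m i j"
    "\<And>i j. i < t \<Longrightarrow> j < t \<Longrightarrow> i \<noteq> j \<Longrightarrow> pexp n i j = pexp m i j"
  shows "n = m"
proof (rule PiE_ext[of n sq "\<lambda>_. UNIV" m])
  fix r assume "r \<in> sq"
  then obtain i j where r: "r = (i, j)" "i < t" "j < t" by auto
  consider "i = j" | "i < j" | "j < i" by linarith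
  then show "n r = m r"
    using assms(3)[of i] assms(4)[of i j] assms(5)[of i j] r
    by cases (auto simp: dexp_def pexp_def)
qed (use assms in \<open>auto simp: configs_def\<close>)

text \<open>Each inversion of \<open>\<sigma>\<close> replaces a \<open>dexp\<close> value d by 1 -
  d. This preserves \<open>triang\<close> d but flips the parity of d, so the energy is invariant
  and the total sign change is \<open>sign \<sigma>\<close>.\<close>

lemma ccoeff_permute:
  assumes \<sigma>: "\<sigma> permutes {..<t}"
  shows "ccoeff k (y \<circ> \<sigma>) = sign \<sigma> * ccoeff k y"
proof -
  have lt: "\<sigma> i < t" if "i < t" for i using permutes_in_image[OF \<sigma>, of i] that by simp
  have lt': "inv_into UNIV \<sigma> i < t" if "i < t" for i using permutes_in_image[OF permutes_inv[OF \<sigma>], of i] that by simp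
  have inj: "\<sigma> i = \<sigma> j \<longleftrightarrow> i = j" for i j using permutes_inj[OF \<sigma>] by (auto dest: injD)
  have inj': "inv_into UNIV \<sigma> i = inv_into UNIV \<sigma> j \<longleftrightarrow> i = j" for i j
    using permutes_inj[OF permutes_inv[OF \<sigma>]] by (auto dest: injD)
  have conf: "cperm \<tau> n \<in> configs" for \<tau> n by (auto simp: cperm_def configs_def)
  note \<sigma>' = permutes_inv[OF \<sigma>] and invs = permutes_inverses[OF \<sigma>]
  have expo: "expo (cperm \<sigma> n) i = expo n (\<sigma> i)" if "i < t" for n i
  proof -
    have "bij_betw \<sigma> ({..<t} - {i}) ({..<t} - {\<sigma> i})"
      using permutes_imp_bij[OF \<sigma>] that by (intro bij_betw_DiffI) (auto simp: bij_betw_def lt)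
    then show ?thesis using that
      unfolding expo_def
      by (subst sum.reindex_bij_betw[symmetric]) (auto simp: cperm_exps \<sigma> intro!: sum.cong)
  qed
  have "ccoeff (k + 0) (y \<circ> \<sigma>) = sign \<sigma> * ccoeff k y"
  proof (rule ccoeff_bij[of "cperm \<sigma>" "cperm (inv_into UNIV \<sigma>)"])
    fix n assume n: "n \<in> configs"
    show "cperm (inv_into UNIV \<sigma>) (cperm \<sigma> n) = n"
      by (rule config_eqI[OF conf n]) (simp_all add: cperm_exps \<sigma> \<sigma>' lt' inj' invs)
    show "cperm \<sigma> (cperm (inv_into UNIV \<sigma>) n) = n"
      by (rule config_eqI[OF conf n]) (simp_all add: cperm_exps \<sigma> \<sigma>' lt inj invs)
    show "(\<forall>i<t. expo (cperm \<sigma> n) i = (y \<circ> \<sigma>) i) = (\<forall>i<t. expo n i = y i)"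
      using expo lt lt' invs by (metis comp_apply)
    have "(\<Sum>i<t. triang (cperm \<sigma> n (i, i))) = (\<Sum>i<t. triang (n (i, i)))"
      by (subst sum.reindex_bij_betw[OF permutes_imp_bij[OF \<sigma>], symmetric])
         (auto intro!: sum.cong simp: cperm_exps \<sigma>)
    moreover have "(\<Sum>(i, j)\<in>lt_pairs t. triang (dexp (cperm \<sigma> n) i j) + triang (pexp (cperm \<sigma> n) i j)) =
       (\<Sum>(i, j)\<in>lt_pairs t. triang (dexp n i j) + triang (pexp n i j))"
    proof -
      define s where "s i j = triang (dexp n i j) + triang (pexp n i j)" for i j
      have "s i j = s j i" if "i \<noteq> j" for i j
        using that by (simp add: s_def dexp_swap[of i j] triang_reflect pexp_swap[of n i j])
      then have "(\<Sum>(i, j)\<in>lt_pairs t. s (\<sigma> i) (\<sigma> j)) = (\<Sum>(i, j)\<in>lt_pairs t. s i j)"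
        by (intro sum.symmetric_permute[OF \<sigma>])
      moreover have "(\<Sum>(i, j)\<in>lt_pairs t. triang (dexp (cperm \<sigma> n) i j) + triang (pexp (cperm \<sigma> n) i j)) =
          (\<Sum>(i, j)\<in>lt_pairs t. s (\<sigma> i) (\<sigma> j))"
        by (auto intro!: sum.cong simp: cperm_exps \<sigma> lt_pairs_def s_def)
      ultimately show ?thesis by (simp add: s_def)
    qed
    ultimately show "int (energy (cperm \<sigma> n)) = int (energy n) + 0"
      unfolding energy_split by simp
    have 1: "(\<Prod>i<t. msgn (cperm \<sigma> n (i, i)) :: int) = (\<Prod>i<t. msgn (n (i, i)))"
      by (subst prod.reindex_bij_betw[OF permutes_imp_bij[OF \<sigma>], symmetric])
         (auto intro!: prod.cong simp: cperm_exps \<sigma>)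
    have "(\<Prod>(i, j)\<in>lt_pairs t. msgn (pexp (cperm \<sigma> n) i j) :: int) =
       (\<Prod>(i, j)\<in>lt_pairs t. msgn (pexp n (\<sigma> i) (\<sigma> j)))"
      by (auto intro!: prod.cong simp: cperm_exps \<sigma> lt_pairs_def)
    also have "\<dots> = (\<Prod>(i, j)\<in>lt_pairs t. msgn (pexp n i j))"
      by (rule prod.symmetric_permute[OF \<sigma>, of "\<lambda>i j. msgn (pexp n i j)"]) (simp only: pexp_swap)
    finally have 2: "(\<Prod>(i, j)\<in>lt_pairs t. msgn (pexp (cperm \<sigma> n) i j) :: int) =
       (\<Prod>(i, j)\<in>lt_pairs t. msgn (pexp n i j))" .
    have "(\<Prod>(i, j)\<in>lt_pairs t. msgn (dexp (cperm \<sigma> n) i j) :: int) =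
        (\<Prod>(i, j)\<in>lt_pairs t. msgn (dexp n (\<sigma> i) (\<sigma> j)))"
      by (auto intro!: prod.cong simp: cperm_exps \<sigma> lt_pairs_def)
    also have "\<dots> = of_int (sign \<sigma>) * (\<Prod>(i, j)\<in>lt_pairs t. msgn (dexp n i j))"
    proof (rule prod_antisymmetric_permute[OF \<sigma>, of "\<lambda>i j. msgn (dexp n i j)"])
      fix i j :: nat assume "i \<noteq> j"
      then show "msgn (dexp n j i) = (- msgn (dexp n i j) :: int)"
        using dexp_swap[of i j n] by (simp add: msgn_diff)
    qed
    finally show "csign (cperm \<sigma> n) = sign \<sigma> * csign n"
      unfolding csign_split 1 2 by simp
  qed (use conf in auto)
  then show ?thesis by simp
qed

section \<open>Translation and reflection of a single exponent\<close>

lemma config_sum_split: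
  fixes f :: "nat \<times> nat \<Rightarrow> 'a::comm_monoid_add"
  assumes "0 < t"
  defines "l \<equiv> t - 1"
  shows "(\<Sum>r\<in>sq. f r) = (\<Sum>r\<in>{..<l} \<times> {..<l}. f r) + (f (l, l) + (\<Sum>j<l. f (l, j) + f (j, l)))"
proof -
  have t: "t = Suc l" using assms by simp
  have "(\<Sum>r\<in>sq. f r) = (\<Sum>i<Suc l. \<Sum>j<Suc l. f (i, j))"
    by (simp add: t sum.cartesian_product del: sum.lessThan_Suc)
  also have "\<dots> = (\<Sum>i<l. \<Sum>j<l. f (i, j)) + (\<Sum>i<l. f (i, l)) + ((\<Sum>j<l. f (l, j)) + f (l, l))"
    by (simp add: sum.distrib add_ac)
  also have "(\<Sum>i<l. \<Sum>j<l. f (i, j)) = (\<Sum>r\<in>{..<l} \<times> {..<l}. f r)"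
    by (simp add: sum.cartesian_product)
  finally show ?thesis by (simp add: sum.distrib add_ac)
qed

lemma expo_last:
  assumes "0 < t"
  shows "expo n (t - 1) = n (t - 1, t - 1) + (\<Sum>j<t - 1. 1 - n (j, t - 1) + n (t - 1, j))"
proof -
  have "{..<t} - {t - 1} = {..<t - 1}" using assms by auto
  then show ?thesis by (auto simp: expo_def dexp_def pexp_def intro!: sum.cong)
qed

text \<open>Quasi-periodicity of theta functions, \<open>x\<^sub>l \<mapsto> T x\<^sub>l\<close>, as a shift of summation indices.\<close>

lemma ccoeff_translate_last:
  assumes "0 < t"
  defines "l \<equiv> t - 1" and "g \<equiv> int (2 * t - 1)"
  shows "ccoeff (k + y l) (y(l := y l + g)) = - ccoeff k y"
proof -
  \<comment> \<open>The index of \<open>e_l\<close> and of each \<open>e_j + e_l\<close> goes up.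
    That of \<open>e_j - e_l\<close> goes down, since x_l is in the denominator there. All t + (t -
    1) changes raise the exponent of x_l, by g in total.\<close>
  define \<delta> :: "nat \<times> nat \<Rightarrow> int" where
    "\<delta> = (\<lambda>(a, b). if a = l then 1 else if b = l then - 1 else 0)"
  have l: "l < t" "int t = int l + 1" "g = 2 * int l + 1" using assms by auto
  define h where "h c n = restrict (\<lambda>r. n r + c * \<delta> r) sq" for c :: int and n
  have h: "h c \<in> configs \<rightarrow> configs" for c by (auto simp: h_def configs_def)
  have inv: "h c (h (- c) n) = n" if "n \<in> configs" for c n
    using that by (auto simp: h_def configs_def PiE_def extensional_def fun_eq_iff)
  have hr: "h 1 n (i, j) = n (i, j) + \<delta> (i, j)" if "i < t" "j < t" for n i j
    using that by (simp add: h_def)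
  have expo: "expo (h 1 n) i = expo n i + (if i = l then g else 0)" if i: "i < t" for n i
  proof (cases "i = l")
    case True
    have "expo (h 1 n) l = (n (l, l) + 1) + (\<Sum>j<l. (1 - n (j, l) + n (l, j)) + 2)"
      using assms(1) l unfolding expo_last[OF assms(1), folded l_def]
      by (auto simp: hr \<delta>_def intro!: sum.cong)
    then show ?thesis
      using True l by (simp add: sum.distrib sum_subtractf expo_last[OF assms(1), folded l_def])
  next
    case False
    have "dexp (h 1 n) i j + pexp (h 1 n) i j = dexp n i j + pexp n i j" if "j < t" for j
      using False i that l(1,2) by (auto simp: dexp_def pexp_def hr \<delta>_def max_def min_def)
    then show ?thesis using False i by (simp add: expo_def hr \<delta>_def)
  qed
  \<comment> \<open>The increments of \<open>triang\<close> are n for a raised entry and 1 - n for a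
    lowered one; they add up to precisely the exponent of x_l.\<close>
  have en: "int (energy (h 1 n)) = int (energy n) + expo n l" for n
  proof -
    have tm: "int (triang (m - 1)) = int (triang m) - m + 1" for m
      using triang_Suc[of "m - 1"] by simp
    have "energy (h 1 n) = (\<Sum>r\<in>{..<l} \<times> {..<l}. triang (n r)) +
      (triang (n (l, l) + 1) + (\<Sum>j<l. triang (n (l, j) + 1) + triang (n (j, l) - 1)))"
      unfolding energy_def config_sum_split[OF assms(1), folded l_def]
      using l(1) by (intro arg_cong2[of _ _ _ _ "(+)"] sum.cong refl) (auto simp: hr \<delta>_def)
    then show ?thesis
      unfolding energy_def config_sum_split[OF assms(1), folded l_def] expo_last[OF assms(1), folded l_def]
      by (simp add: triang_Suc tm sum.distrib sum_subtractf)
  qed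
  have sg: "csign (h 1 n) = - 1 * csign n" for n
  proof -
    have "csign (h 1 n) = msgn (\<Sum>r\<in>sq. n r + \<delta> r)"
      unfolding csign_def by (subst msgn_sum) (auto simp: h_def intro!: prod.cong)
    also have "(\<Sum>r\<in>sq. n r + \<delta> r) = (\<Sum>r\<in>sq. n r) + (\<Sum>r\<in>sq. \<delta> r)" by (rule sum.distrib)
    \<comment> \<open>The entries at (l, j) and (j, l) cancel and the one at (l, l) remains, which
      is the source of the minus sign.\<close>
    also have "(\<Sum>r\<in>sq. \<delta> r) = 1"
      unfolding config_sum_split[OF assms(1), folded l_def]
      by (auto simp: \<delta>_def intro!: sum.neutral)
    finally show ?thesis by (simp add: msgn_add csign_def msgn_sum)
  qed
  have "ccoeff (k + y l) (y(l := y l + g)) = - 1 * ccoeff k y"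
  proof (rule ccoeff_bij[of "h 1" "h (- 1)"])
    show "(\<forall>i<t. expo (h 1 n) i = (y(l := y l + g)) i) = (\<forall>i<t. expo n i = y i)" for n
      using expo[of _ n] by auto
    show "h (- 1) (h 1 n) = n" if "n \<in> configs" for n using inv[OF that, of "- 1"] by simp
  qed (use h inv en sg l in auto)
  then show ?thesis by simp
qed

text \<open>The reflection in the short root \<open>e_l\<close> exchanges the theta functions of
  \<open>e_j - e_l\<close> and \<open>e_j + e_l\<close>, and theta(z) = -z theta(1/z) accounts for
  \<open>e_l\<close> itself and for the sign. The constants 1 in \<open>dexp\<close> turn y -> -y
  into y -> g - y.\<close>

lemma ccoeff_flip_last:
  assumes "0 < t"
  defines "l \<equiv> t - 1" and "g \<equiv> int (2 * t - 1)"
  shows "ccoeff k (y(l := g - y l)) = - ccoeff k y"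
proof -
  have l: "l < t" "int t = int l + 1" "g = 2 * int l + 1" using assms by auto
  define h where "h n = restrict (\<lambda>(a, b). if a = l \<and> b = l then 1 - n (l, l)
      else if a = l \<or> b = l then n (b, a) else n (a, b)) sq" for n :: "nat \<times> nat \<Rightarrow> int"
  have h: "h \<in> configs \<rightarrow> configs" by (auto simp: h_def configs_def)
  have hr: "h n (i, j) = (if i = l \<and> j = l then 1 - n (l, l)
      else if i = l \<or> j = l then n (j, i) else n (i, j))" if "i < t" "j < t" for n i j
    using that by (simp add: h_def)
  have inv: "h (h n) = n" if "n \<in> configs" for n
    using that by (auto simp: h_def configs_def PiE_def extensional_def fun_eq_iff l)
  have expo: "expo (h n) i = (if i = l then g - expo n l else expo n i)" if i: "i < t" for n i
  proof (cases "i = l")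
    case True
    have "expo (h n) l = (1 - n (l, l)) + (\<Sum>j<l. 2 - (1 - n (j, l) + n (l, j)))"
      using assms(1) l unfolding expo_last[OF assms(1), folded l_def]
      by (auto simp: hr intro!: sum.cong)
    then show ?thesis
      using True l by (simp add: sum.distrib sum_subtractf expo_last[OF assms(1), folded l_def])
  next
    case False
    have "dexp (h n) i j + pexp (h n) i j = dexp n i j + pexp n i j" if "j < t" for j
      using False i that l(1,2) by (auto simp: dexp_def pexp_def hr max_def min_def)
    then show ?thesis using False i by (simp add: expo_def hr)
  qed
  have en: "energy (h n) = energy n" for n
  proof -
    have "(\<Sum>j<l. triang (h n (l, j)) + triang (h n (j, l))) = (\<Sum>j<l. triang (n (l, j)) + triang (n (j, l)))"
      using l(1) by (intro sum.cong refl) (auto simp: hr)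
    moreover have "(\<Sum>r\<in>{..<l} \<times> {..<l}. triang (h n r)) = (\<Sum>r\<in>{..<l} \<times> {..<l}. triang (n r))"
      using l(1) by (intro sum.cong refl) (auto simp: hr)
    ultimately show ?thesis
      unfolding energy_def config_sum_split[OF assms(1), folded l_def]
      using l(1) by (simp add: hr triang_reflect)
  qed
  have sg: "csign (h n) = - 1 * csign n" for n
  proof -
    have "csign (h n) = msgn (\<Sum>r\<in>sq. h n r)"
      unfolding csign_def by (subst msgn_sum) auto
    also have "(\<Sum>r\<in>sq. h n r) = (\<Sum>r\<in>{..<l} \<times> {..<l}. n r) + (1 - n (l, l) + (\<Sum>j<l. n (j, l) + n (l, j)))"
      unfolding config_sum_split[OF assms(1), folded l_def]
      using l(1) by (intro arg_cong2[of _ _ _ _ "(+)"] sum.cong refl) (auto simp: hr)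
    also have "\<dots> = (\<Sum>r\<in>sq. n r) + (1 - 2 * n (l, l))"
      unfolding config_sum_split[OF assms(1), folded l_def] by (simp add: sum.distrib)
    finally show ?thesis by (simp add: msgn_add msgn_diff csign_def msgn_sum) (simp add: msgn_def)
  qed
  have "ccoeff (k + 0) (y(l := g - y l)) = - 1 * ccoeff k y"
  proof (rule ccoeff_bij[of h h])
    show "(\<forall>i<t. expo (h n) i = (y(l := g - y l)) i) = (\<forall>i<t. expo n i = y i)" for n
      using expo[of _ n] by auto
  qed (use h inv en sg l in auto)
  then show ?thesis by simp
qed

text \<open>Conjugation by the transposition of \<open>i\<close> and the last index carries a
  symmetry of the last exponent to any other; the two signs of the transposition cancel.\<close>

lemma ccoeff_conjugate:
  assumes last: "\<And>k y. ccoeff (k + d (y (t - 1))) (y(t - 1 := u (y (t - 1)))) = - ccoeff k y"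
    and i: "i < t"
  shows "ccoeff (k + d (y i)) (y(i := u (y i))) = - ccoeff k y"
proof -
  define l where "l = t - 1"
  define \<tau> where "\<tau> = Transposition.transpose i l"
  have \<tau>: "\<tau> permutes {..<t}" unfolding \<tau>_def using i by (intro permutes_swap_id) (auto simp: l_def)
  have "(y \<circ> \<tau>)(l := u ((y \<circ> \<tau>) l)) = (y(i := u (y i))) \<circ> \<tau>" "(y \<circ> \<tau>) l = y i"
    by (auto simp: fun_eq_iff \<tau>_def Transposition.transpose_def)
  then have "sign \<tau> * ccoeff (k + d (y i)) (y(i := u (y i))) = sign \<tau> * (- ccoeff k y)"
    using last[folded l_def, of k "y \<circ> \<tau>"] ccoeff_permute[OF \<tau>, of k y]
      ccoeff_permute[OF \<tau>, of "k + d (y i)" "y(i := u (y i))"] by simp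
  then show ?thesis by (simp del: mult_minus_right)
qed

lemma ccoeff_translate:
  assumes "i < t"
  shows "ccoeff (k + y i) (y(i := y i + int (2 * t - 1))) = - ccoeff k y"
proof (rule ccoeff_conjugate[of "\<lambda>v. v" "\<lambda>v. v + int (2 * t - 1)", OF _ assms])
  show "ccoeff (k + y (t - 1)) (y(t - 1 := y (t - 1) + int (2 * t - 1))) = - ccoeff k y" for k y
    using assms by (intro ccoeff_translate_last) auto
qed

lemma ccoeff_flip:
  assumes "i < t"
  shows "ccoeff k (y(i := int (2 * t - 1) - y i)) = - ccoeff k y"
proof -
  have "ccoeff (k + 0) (y(i := int (2 * t - 1) - y i)) = - ccoeff k y"
  proof (rule ccoeff_conjugate[of "\<lambda>v. 0" "\<lambda>v. int (2 * t - 1) - v", OF _ assms])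
    show "ccoeff (k + 0) (y(t - 1 := int (2 * t - 1) - y (t - 1))) = - ccoeff k y" for k y
      using assms ccoeff_flip_last[of k y] by simp
  qed
  then show ?thesis by simp
qed

text \<open>Iteration of single translations: the shifts \<open>g * k + v\<close> over
  \<open>n\<close> steps add up to \<open>n * v + g * triang n\<close>, also for negative
  \<open>n\<close>.\<close>

lemma ccoeff_translate_multiple:
  assumes "i < t"
  defines "g \<equiv> int (2 * t - 1)"
  shows "ccoeff k (y(i := g * n + v)) = msgn n * ccoeff (k - (n * v + g * int (triang n))) (y(i := v))"
proof -
  have step: "ccoeff (k + (g * n + v)) (y(i := g * (n + 1) + v)) = - ccoeff k (y(i := g * n + v))" for k n
    using ccoeff_translate[OF assms(1), of k "y(i := g * n + v)"] by (simp add: g_def algebra_simps)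
  have tr: "int (triang (n + 1)) = int (triang n) + n" for n by (rule triang_Suc)
  show ?thesis
  proof (induction n arbitrary: k rule: int_induct[of _ 0])
    case base
    then show ?case by (simp add: triang_def)
  next
    case (step1 n)
    have "ccoeff k (y(i := g * (n + 1) + v)) = - ccoeff (k - (g * n + v)) (y(i := g * n + v))"
      using step[of "k - (g * n + v)" n] by simp
    also have "\<dots> = msgn (n + 1) * ccoeff (k - (g * n + v) - (n * v + g * int (triang n))) (y(i := v))"
      unfolding step1.IH by (simp add: msgn_add)
    also have "k - (g * n + v) - (n * v + g * int (triang n)) = k - ((n + 1) * v + g * int (triang (n + 1)))"
      unfolding tr by (simp add: algebra_simps)
    finally show ?case .
  next
    case (step2 n)
    have tr': "int (triang (n - 1)) = int (triang n) - (n - 1)" using tr[of "n - 1"] by simp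
    have "ccoeff k (y(i := g * (n - 1) + v)) = - ccoeff (k + (g * (n - 1) + v)) (y(i := g * n + v))"
      using step[of k "n - 1"] by simp
    also have "\<dots> = msgn (n - 1) * ccoeff (k + (g * (n - 1) + v) - (n * v + g * int (triang n))) (y(i := v))"
      unfolding step2.IH by (simp add: msgn_diff)
    also have "k + (g * (n - 1) + v) - (n * v + g * int (triang n)) = k - ((n - 1) * v + g * int (triang (n - 1)))"
      unfolding tr' by (simp add: algebra_simps)
    finally show ?case .
  qed
qed

end

section \<open>Reduction to the fundamental alcove\<close>

context
  fixes t :: nat
begin

abbreviation (input) lev :: int where "lev \<equiv> int (2 * t - 1)"

text \<open>The representative in 0, ..., t - 1 of the orbit of \<open>y\<close> under translation
  by g and reflection: the residues c and g - c are identified. \<open>eps1\<close> and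
  \<open>en1\<close> are the sign and the energy collected on the way.\<close>

definition cls :: "int \<Rightarrow> nat" where
  "cls y = nat (if y mod lev < int t then y mod lev else lev - y mod lev)"

definition eps1 :: "int \<Rightarrow> int" where
  "eps1 y = (if y mod lev < int t then msgn (y div lev) else - msgn (y div lev))"

definition en1 :: "int \<Rightarrow> nat" where
  "en1 y = nat ((y div lev) * (y mod lev) + lev * int (triang (y div lev)))"

lemma mod_lev:
  assumes "0 < t"
  shows "0 \<le> y mod lev" "y mod lev < lev"
  by (rule pos_mod_sign, use assms in simp) (rule pos_mod_bound, use assms in simp)

text \<open>For negative n the term n b is compensated through g \<open>triang\<close> n + g n = g
  \<open>triang\<close> (n + 1). The second bound is the source of finite fibres.\<close>

lemma en1_bounds:
  assumes "0 < t"
  shows "(y div lev) * (y mod lev) + lev * int (triang (y div lev)) \<ge> 0"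
    and "\<bar>y div lev\<bar> \<le> (y div lev) * (y mod lev) + lev * int (triang (y div lev)) + 1"
proof -
  define n b where "n = y div lev" and "b = y mod lev"
  have g: "lev \<ge> 1" using assms by simp
  have b: "0 \<le> b" "b \<le> lev - 1" 
    using mod_lev[OF assms, of y] unfolding b_def by linarith+
  have "n * b + lev * int (triang n) \<ge> 0 \<and> \<bar>n\<bar> \<le> n * b + lev * int (triang n) + 1"
  proof (cases "n \<ge> 0")
    case True
    have "1 * int (triang n) \<le> lev * int (triang n)" using g by (intro mult_right_mono) auto
    moreover have "n * b \<ge> 0" using True b by simp
    ultimately show ?thesis using triang_ge[of n] by simp
  next
    case False
    have "n * b \<ge> n * (lev - 1)" using False b by (intro mult_left_mono_neg) auto
    moreover have "lev * int (triang (n + 1)) \<ge> 0" using g by simp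
    moreover have "lev * int (triang (n + 1)) = lev * int (triang n) + lev * n"
      unfolding triang_Suc by (simp add: algebra_simps)
    moreover have "n * (lev - 1) = lev * n - n" by (simp add: algebra_simps)
    ultimately show ?thesis using False by linarith
  qed
  then show "(y div lev) * (y mod lev) + lev * int (triang (y div lev)) \<ge> 0"
    "\<bar>y div lev\<bar> \<le> (y div lev) * (y mod lev) + lev * int (triang (y div lev)) + 1"
    by (simp_all add: n_def b_def)
qed

lemma int_en1:
  "0 < t \<Longrightarrow> int (en1 y) = (y div lev) * (y mod lev) + lev * int (triang (y div lev))"
  unfolding en1_def using en1_bounds(1)[of y] by simp

lemma finite_fibres_en1:
  assumes "0 < t"
  shows "finite_fibres UNIV en1"
  unfolding finite_fibres_def
proof
  fix k
  have "{y \<in> UNIV. en1 y = k} \<subseteq> {- (lev * (int k + 2))..lev * (int k + 2)}"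
  proof
    fix y assume "y \<in> {y \<in> UNIV. en1 y = k}"
    then have n: "\<bar>y div lev\<bar> \<le> int k + 1"
      using en1_bounds(2)[OF assms, of y] int_en1[OF assms, of y] by simp
    have g: "lev \<ge> 1" using assms by simp
    have y: "y = lev * (y div lev) + y mod lev" by simp
    note m = mod_lev[OF assms, of y]
    have "lev * (y div lev) \<le> lev * (int k + 1)" using n g by (intro mult_left_mono) auto
    moreover have "lev * (- (int k + 1)) \<le> lev * (y div lev)" using n g by (intro mult_left_mono) auto
    moreover have "lev * (int k + 2) = lev * (int k + 1) + lev" by (simp only: algebra_simps)
    moreover have "lev * (- (int k + 1)) = - (lev * (int k + 1))" by (rule mult_minus_right)
    ultimately have "- (lev * (int k + 2)) \<le> y \<and> y \<le> lev * (int k + 2)"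
      using y m by linarith
    then show "y \<in> {- (lev * (int k + 2))..lev * (int k + 2)}"
      by (simp only: atLeastAtMost_iff)
  qed
  then show "finite {y \<in> UNIV. en1 y = k}" using finite_subset by blast
qed

lemma residue_cases:
  assumes "0 < t" "0 \<le> b" "b < lev"
  shows "(lev * n + b) div lev = n" "(lev * n + b) mod lev = b"
  using assms by (auto simp: div_add1_eq)

lemma reflect_residue:
  assumes "0 < t" "\<not> y mod lev < int t"
  shows "(lev - y) div lev = - (y div lev)" "(lev - y) mod lev = lev - y mod lev"
proof -
  note m = mod_lev[OF assms(1), of y]
  have eq: "lev - y = lev * (- (y div lev)) + (lev - y mod lev)"
    by (simp add: algebra_simps minus_div_mult_eq_mod [symmetric])
  have "0 \<le> lev - y mod lev" "lev - y mod lev < lev" using m assms by linarith+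
  from residue_cases[OF assms(1) this, of "- (y div lev)", folded eq]
  show "(lev - y) div lev = - (y div lev)" "(lev - y) mod lev = lev - y mod lev" .
qed

lemma cls_less: "0 < t \<Longrightarrow> cls y < t"
proof -
  assume t: "0 < t"
  then show ?thesis using mod_lev[of y] by (auto simp: cls_def nat_less_iff)
qed

lemma alcove_shift:
  assumes "c < t"
  shows "cls (lev * n + int c) = c" "eps1 (lev * n + int c) = msgn n"
    "int (en1 (lev * n + int c)) = n * int c + lev * int (triang n)"
proof -
  have t: "0 < t" and c: "0 \<le> int c" "int c < lev" using assms by auto
  show "cls (lev * n + int c) = c" "eps1 (lev * n + int c) = msgn n"
    "int (en1 (lev * n + int c)) = n * int c + lev * int (triang n)"
    using assms unfolding cls_def eps1_def int_en1[OF t] residue_cases[OF t c] by auto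
qed

lemma alcove_reflect:
  assumes "0 < t" "\<not> y mod lev < int t"
  shows "cls (lev - y) = cls y" "eps1 (lev - y) = - eps1 y" "en1 (lev - y) = en1 y"
proof -
  note m = mod_lev[OF assms(1), of y]
  show "cls (lev - y) = cls y" "eps1 (lev - y) = - eps1 y"
    using assms m unfolding cls_def eps1_def reflect_residue[OF assms] by auto
  have "int (triang (- (y div lev))) = int (triang (y div lev)) + y div lev"
    using triang_Suc[of "y div lev"] triang_reflect[of "- (y div lev)"] by (simp add: add.commute)
  then have "int (en1 (lev - y)) = int (en1 y)"
    unfolding int_en1[OF assms(1)] reflect_residue[OF assms] by (simp add: algebra_simps)
  then show "en1 (lev - y) = en1 y" by simp
qed

text \<open>Residues below \<open>t\<close> are reached by translation alone; the others are
  reflected first, at the cost of a sign and of no energy.\<close>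

lemma ccoeff_reduce1:
  assumes "i < t"
  shows "ccoeff t k (y(i := z)) = eps1 z * ccoeff t (k - int (en1 z)) (y(i := int (cls z)))"
proof -
  have t: "0 < t" using assms by simp
  have small: "ccoeff t k (y(i := z)) = eps1 z * ccoeff t (k - int (en1 z)) (y(i := int (cls z)))"
    if "z mod lev < int t" for k z y
  proof -
    have c: "int (cls z) = z mod lev"
      using mod_lev(1)[OF t, of z] that by (simp only: cls_def if_True nat_0_le)
    have e: "eps1 z = msgn (z div lev)"
      using that by (simp only: eps1_def if_True)
    show ?thesis
      unfolding int_en1[OF t] c e
      using ccoeff_translate_multiple[OF assms, of k y "z div lev" "z mod lev"]
      by (simp only: mult_div_mod_eq)
  qed
  show ?thesis
  proof (cases "z mod lev < int t")
    case False
    have "(lev - z) mod lev < int t" using False t unfolding reflect_residue[OF t False] by auto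
    note s = small[OF this, of k y, unfolded alcove_reflect[OF t False]]
    have "ccoeff t k (y(i := z)) = - ccoeff t k (y(i := lev - z))"
      using ccoeff_flip[OF assms, of k "y(i := z)"] by simp
    then show ?thesis unfolding s by simp
  qed (rule small)
qed

lemma ccoeff_reduce:
  "ccoeff t k y = (\<Prod>i<t. eps1 (y i)) * ccoeff t (k - int (\<Sum>i<t. en1 (y i))) (\<lambda>i. int (cls (y i)))"
proof -
  have "ccoeff t k y = (\<Prod>i<m. eps1 (y i)) *
      ccoeff t (k - int (\<Sum>i<m. en1 (y i))) (\<lambda>i. if i < m then int (cls (y i)) else y i)"
    if "m \<le> t" for m
    using that
  proof (induction m)
    case (Suc m)
    define z where "z = (\<lambda>i. if i < m then int (cls (y i)) else y i)"
    have 1: "z = z(m := y m)" by (auto simp: z_def)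
    have 2: "z(m := int (cls (y m))) = (\<lambda>i. if i < Suc m then int (cls (y i)) else y i)"
      by (auto simp: z_def fun_eq_iff less_Suc_eq)
    have "ccoeff t k y = (\<Prod>i<m. eps1 (y i)) * ccoeff t (k - int (\<Sum>i<m. en1 (y i))) (z(m := y m))"
      using Suc 1 by (simp add: z_def)
    also have "\<dots> = (\<Prod>i<m. eps1 (y i)) * (eps1 (y m) *
        ccoeff t (k - int (\<Sum>i<m. en1 (y i)) - int (en1 (y m))) (z(m := int (cls (y m)))))"
      using ccoeff_reduce1[of m "k - int (\<Sum>i<m. en1 (y i))" z "y m"] Suc.prems by simp
    finally show ?case unfolding 2 by (simp add: algebra_simps)
  qed simp
  from this[of t] show ?thesis
    by (simp cong: ccoeff_cong)
qed

lemma ccoeff_neg: "k < 0 \<Longrightarrow> ccoeff t k y = 0"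
proof -
  assume "k < 0"
  then have "cfibre t k y = {}" by (auto simp: cfibre_def)
  then show ?thesis by (simp add: ccoeff_def)
qed

text \<open>Transposing two equal exponents leaves \<open>y\<close> fixed, so the integer
  coefficient equals its own negative.\<close>

lemma ccoeff_not_inj:
  assumes "i < t" "j < t" "i \<noteq> j" "y i = y j"
  shows "ccoeff t k y = 0"
proof -
  let ?\<tau> = "Transposition.transpose i j"
  have "y \<circ> ?\<tau> = y" using assms by (auto simp: fun_eq_iff Transposition.transpose_def)
  then have "ccoeff t k y = sign ?\<tau> * ccoeff t k y"
    using ccoeff_permute[OF permutes_swap_id[of i "{..<t}" j], of k y] assms by simp
  then show ?thesis using assms by (simp add: sign_swap_id)
qed

definition cls_perm :: "(nat \<Rightarrow> int) \<Rightarrow> nat \<Rightarrow> nat" where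
  "cls_perm y = (\<lambda>i. if i < t then cls (y i) else i)"

lemma cls_perm_permutes:
  assumes "inj_on (\<lambda>i. cls (y i)) {..<t}"
  shows "cls_perm y permutes {..<t}"
proof (rule bij_imp_permutes)
  have "inj_on (cls_perm y) {..<t}" using assms by (auto simp: inj_on_def cls_perm_def)
  moreover have "cls_perm y ` {..<t} \<subseteq> {..<t}" using cls_less by (auto simp: cls_perm_def)
  ultimately show "bij_betw (cls_perm y) {..<t} {..<t}" by (simp add: bij_betw_def endo_inj_surj)
qed (auto simp: cls_perm_def)

lemma ccoeff_eq_base:
  assumes "inj_on (\<lambda>i. cls (y i)) {..<t}"
  shows "ccoeff t k y = sign (cls_perm y) * (\<Prod>i<t. eps1 (y i)) *
    ccoeff t (k - int (\<Sum>i<t. en1 (y i))) int"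
proof -
  have "ccoeff t k' (\<lambda>i. int (cls (y i))) = ccoeff t k' (int \<circ> cls_perm y)" for k'
    by (rule ccoeff_cong) (simp add: cls_perm_def)
  then show ?thesis
    by (subst ccoeff_reduce) (simp add: ccoeff_permute[OF cls_perm_permutes[OF assms]])
qed

lemma ccoeff_eq_0:
  assumes "\<not> (inj_on (\<lambda>i. cls (y i)) {..<t} \<and> int (\<Sum>i<t. en1 (y i)) \<le> k)"
  shows "ccoeff t k y = 0"
proof (cases "inj_on (\<lambda>i. cls (y i)) {..<t}")
  case True
  then show ?thesis using assms by (subst ccoeff_reduce) (simp add: ccoeff_neg)
next
  case False
  then obtain i j where "i < t" "j < t" "i \<noteq> j" "cls (y i) = cls (y j)" by (auto simp: inj_on_def)
  then show ?thesis
    by (subst ccoeff_reduce) (simp add: ccoeff_not_inj[of i j])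
qed

section \<open>The theta product as a determinant\<close>

definition theta :: "'a::field \<Rightarrow> 'a fps" where
  "theta z = fsum UNIV triang (\<lambda>n. msgn n * z powi n)"

definition posroot :: "(nat \<Rightarrow> 'a::field) \<Rightarrow> nat \<times> nat \<Rightarrow> 'a" where
  "posroot x = (\<lambda>(i, j). if i < j then x i / x j else if j < i then x i * x j else x i)"

definition theta_prod :: "(nat \<Rightarrow> 'a::field) \<Rightarrow> 'a fps" where
  "theta_prod x = fps_const (\<Prod>a<t. x a ^ a) * (\<Prod>r\<in>{..<t} \<times> {..<t}. theta (posroot x r))"

text \<open>The orbit sum of one variable over class \<open>c\<close>, weighted with the sign and
  energy of the reduction.\<close>

definition column :: "nat \<Rightarrow> 'a::field \<Rightarrow> 'a fps" where
  "column c z = fsum {y. cls y = c} en1 (\<lambda>y. of_int (eps1 y) * z powi y)"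

text \<open>The one unknown series, formed by the coefficients at the exponent vector 0, 1, ..., t -
  1. These integers are the same for all \<open>x\<close> and all fields.\<close>

definition base_series :: "'a::field fps" where
  "base_series = Abs_fps (\<lambda>k. of_int (ccoeff t (int k) int))"

lemma fsum_const_mult: "fps_const c * fsum I w A = fsum I w (\<lambda>i. c * A i)"
  by (simp add: fps_eq_iff fsum_nth sum_distrib_left)

lemma fsum_partition:
  assumes "finite P" "h ` I \<subseteq> P" "finite_fibres I w"
  shows "(\<Sum>p\<in>P. fsum {i \<in> I. h i = p} w A) = fsum I w A"
proof (rule fps_ext)
  fix k
  have "(\<Sum>p\<in>P. \<Sum>i\<in>{i \<in> {i \<in> I. w i = k}. h i = p}. A i) = (\<Sum>i\<in>{i \<in> I. w i = k}. A i)"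
    using assms by (intro sum.group) (auto simp: finite_fibres_def)
  moreover have "{i \<in> {i \<in> I. h i = p}. w i = k} = {i \<in> {i \<in> I. w i = k}. h i = p}" for p by auto
  ultimately show "fps_nth (\<Sum>p\<in>P. fsum {i \<in> I. h i = p} w A) k = fps_nth (fsum I w A) k"
    by (simp add: fps_sum_nth fsum_nth)
qed

lemma prod_self_powers: "(\<Prod>a<t. x a ^ a) = (\<Prod>(i, j)\<in>lt_pairs t. x j :: 'a::field)"
proof -
  have "(\<Prod>(i, j)\<in>lt_pairs t. x j) =
      (\<Prod>(i, j)\<in>lt_pairs t. (if j < i then x i else 1) * (if i < j then x j else 1))"
    by (intro prod.cong) (auto simp: lt_pairs_def)
  also have "\<dots> = (\<Prod>i<t. \<Prod>j\<in>{..<t} - {i}. if j < i then x i else 1)"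
    by (rule prod.offdiagonal_split[symmetric])
  also have "\<dots> = (\<Prod>i<t. \<Prod>j<i. x i)"
    by (intro prod.cong refl prod.mono_neutral_cong_right) auto
  finally show ?thesis by simp
qed

lemma power_int_sum:
  assumes "z \<noteq> (0 :: 'a::field)"
  shows "z powi (\<Sum>i\<in>A. f i) = (\<Prod>i\<in>A. z powi f i)"
  by (induction A rule: infinite_finite_induct) (simp_all add: power_int_add assms)

text \<open>Every pair i < j takes one x_j from the product of the powers x_a^a; it is the 1 in
  \<open>dexp n j i = 1 - n (i, j)\<close>.\<close>

lemma config_monomial:
  fixes x :: "nat \<Rightarrow> 'a::field"
  assumes x: "\<And>a. a < t \<Longrightarrow> x a \<noteq> 0"
  shows "(\<Prod>a<t. x a ^ a) * (\<Prod>r\<in>{..<t} \<times> {..<t}. posroot x r powi n r) = (\<Prod>a<t. x a powi expo t n a)"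
proof -
  have "(\<Prod>a<t. x a powi expo t n a) = (\<Prod>a<t. x a powi n (a, a)) *
      (\<Prod>a<t. \<Prod>j\<in>{..<t} - {a}. x a powi (dexp n a j + pexp n a j))"
    unfolding prod.distrib[symmetric]
    by (intro prod.cong refl) (simp add: expo_def power_int_add x power_int_sum)
  also have "(\<Prod>a<t. \<Prod>j\<in>{..<t} - {a}. x a powi (dexp n a j + pexp n a j)) =
     (\<Prod>(i, j)\<in>lt_pairs t. x i powi (dexp n i j + pexp n i j) * x j powi (dexp n j i + pexp n j i))"
    by (rule prod.offdiagonal_split)
  also have "\<dots> = (\<Prod>(i, j)\<in>lt_pairs t. x j * (posroot x (i, j) powi n (i, j) * posroot x (j, i) powi n (j, i)))"
  proof (intro prod.cong refl, clarify)
    fix i j assume "(i, j) \<in> lt_pairs t"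
    then have ij: "i < j" "i < t" "j < t" by (auto simp: lt_pairs_def)
    have "x i powi (dexp n i j + pexp n i j) * x j powi (dexp n j i + pexp n j i) =
        x i powi (n (i, j) + n (j, i)) * x j powi (1 - n (i, j) + n (j, i))"
      using ij by (simp add: dexp_def pexp_def)
    also have "\<dots> = x j * ((x i / x j) powi n (i, j) * (x j * x i) powi n (j, i))"
      using ij x by (simp add: power_int_add power_int_diff power_int_mult_distrib power_int_divide_distrib)
    finally show "x i powi (dexp n i j + pexp n i j) * x j powi (dexp n j i + pexp n j i) =
        x j * (posroot x (i, j) powi n (i, j) * posroot x (j, i) powi n (j, i))"
      using ij by (simp add: posroot_def)
  qed
  also have "\<dots> = (\<Prod>(i, j)\<in>lt_pairs t. x j) *
      (\<Prod>(i, j)\<in>lt_pairs t. posroot x (i, j) powi n (i, j) * posroot x (j, i) powi n (j, i))"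
    by (simp add: case_prod_unfold prod.distrib)
  also have "(\<Prod>(i, j)\<in>lt_pairs t. x j) = (\<Prod>a<t. x a ^ a)" by (rule prod_self_powers[symmetric])
  finally show ?thesis
    unfolding prod.square_split by (simp add: posroot_def mult_ac)
qed

lemma theta_prod_eq_fsum:
  fixes x :: "nat \<Rightarrow> 'a::field"
  assumes x: "\<And>a. a < t \<Longrightarrow> x a \<noteq> 0"
  shows "theta_prod x = fsum (configs t) (energy t) (\<lambda>n. of_int (csign t n) * (\<Prod>a<t. x a powi expo t n a))"
    and "finite_fibres (configs t) (energy t)"
proof -
  let ?S = "{..<t} \<times> {..<t}"
  have *: "finite_fibres (PiE ?S (\<lambda>_. UNIV)) (\<lambda>n. \<Sum>r\<in>?S. triang (n r)) \<and>
    (\<Prod>r\<in>?S. theta (posroot x r)) = fsum (PiE ?S (\<lambda>_. UNIV)) (\<lambda>n. \<Sum>r\<in>?S. triang (n r))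
      (\<lambda>n. \<Prod>r\<in>?S. msgn (n r) * posroot x r powi n r)"
    unfolding theta_def by (rule fsum_prod) (auto simp: finite_fibres_triang)
  then show "finite_fibres (configs t) (energy t)"
    by (simp add: configs_def energy_def[abs_def])
  have "(\<Prod>a<t. x a ^ a) * (\<Prod>r\<in>?S. msgn (n r) * posroot x r powi n r) =
      of_int (csign t n) * (\<Prod>a<t. x a powi expo t n a)" for n
  proof -
    have "(\<Prod>a<t. x a ^ a) * (\<Prod>r\<in>?S. msgn (n r) * posroot x r powi n r) =
      (\<Prod>r\<in>?S. msgn (n r)) * ((\<Prod>a<t. x a ^ a) * (\<Prod>r\<in>?S. posroot x r powi n r))"
      by (simp only: prod.distrib mult_ac)
    then show ?thesis
      by (simp only: config_monomial[OF x] csign_def of_int_prod of_int_msgn)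
  qed
  then show "theta_prod x = fsum (configs t) (energy t) (\<lambda>n. of_int (csign t n) * (\<Prod>a<t. x a powi expo t n a))"
    unfolding theta_prod_def conjunct2[OF *] fsum_const_mult
    by (simp add: configs_def energy_def[abs_def])
qed

definition regular :: "(nat \<Rightarrow> int) set" where
  "regular = {y \<in> PiE {..<t} (\<lambda>_. UNIV). inj_on (\<lambda>i. cls (y i)) {..<t}}"

lemma finite_fibres_regular:
  assumes "0 < t"
  shows "finite_fibres regular (\<lambda>y. \<Sum>a<t. en1 (y a))"
proof -
  have "finite_fibres (PiE {..<t} (\<lambda>_. UNIV)) (\<lambda>y. \<Sum>a<t. en1 (y a))"
    by (rule conjunct1[OF fsum_prod[of _ "\<lambda>_. UNIV" "\<lambda>_. en1" "\<lambda>_ _. 0 :: int"]])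
      (simp_all add: finite_fibres_en1[OF assms])
  then show ?thesis by (rule finite_fibres_subset) (auto simp: regular_def)
qed

text \<open>In the Leibniz expansion the permutation \<open>p\<close> collects the vectors with
  class \<open>p a\<close> at position \<open>a\<close>; over all \<open>p\<close> these partition
  the vectors with distinct classes.\<close>

lemma det_columns:
  fixes x :: "nat \<Rightarrow> 'a::field"
  assumes "0 < t"
  shows "Determinant.det (mat t t (\<lambda>(a, c). column c (x a))) =
    fsum regular (\<lambda>y. \<Sum>a<t. en1 (y a))
      (\<lambda>y. of_int (sign (cls_perm y)) * (\<Prod>a<t. of_int (eps1 (y a)) * x a powi y a))"
proof -
  let ?E = "\<lambda>y. \<Sum>a<t. en1 (y a)" and ?M = "\<lambda>y. \<Prod>a<t. of_int (eps1 (y a)) * x a powi y a"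
  have "Determinant.det (mat t t (\<lambda>(a, c). column c (x a))) =
    (\<Sum>p\<in>{p. p permutes {..<t}}. of_int (sign p) * (\<Prod>a<t. column (p a) (x a)))"
    by (subst det_def'[of _ t])
       (auto simp: atLeast0LessThan intro!: sum.cong prod.cong dest: permutes_in_image)
  also have "\<dots> = (\<Sum>p\<in>{p. p permutes {..<t}}. fsum {y \<in> regular. cls_perm y = p} ?E
      (\<lambda>y. of_int (sign (cls_perm y)) * ?M y))"
  proof (intro sum.cong refl)
    fix p assume "p \<in> {p. p permutes {..<t}}"
    then have p: "p permutes {..<t}" by simp
    have set: "{y \<in> regular. cls_perm y = p} = PiE {..<t} (\<lambda>a. {y. cls y = p a})"
    proof (intro equalityI subsetI)
      fix y assume "y \<in> PiE {..<t} (\<lambda>a. {y. cls y = p a})"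
      then have y: "y \<in> PiE {..<t} (\<lambda>_. UNIV)" "\<And>a. a < t \<Longrightarrow> cls (y a) = p a" by auto
      have "cls_perm y = p" using y(2) permutes_not_in[OF p] by (auto simp: cls_perm_def fun_eq_iff)
      moreover have "inj_on (\<lambda>i. cls (y i)) {..<t}"
        using y(2) permutes_inj_on[OF p, of "{..<t}"] by (auto simp: inj_on_def)
      ultimately show "y \<in> {y \<in> regular. cls_perm y = p}" using y by (auto simp: regular_def)
    qed (auto simp: regular_def cls_perm_def PiE_def Pi_def extensional_def)
    have "(\<Prod>a<t. column (p a) (x a)) = fsum (PiE {..<t} (\<lambda>a. {y. cls y = p a})) ?E ?M"
      unfolding column_def
      using fsum_prod[of "{..<t}" "\<lambda>a. {y. cls y = p a}" "\<lambda>_. en1"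
          "\<lambda>a y. of_int (eps1 y) * x a powi y"]
        finite_fibres_subset[OF finite_fibres_en1[OF assms], of "{y. cls y = _}"] by auto
    then have "of_int (sign p) * (\<Prod>a<t. column (p a) (x a)) =
        fsum (PiE {..<t} (\<lambda>a. {y. cls y = p a})) ?E (\<lambda>y. of_int (sign p) * ?M y)"
      by (simp add: fsum_const_mult fps_of_int flip: fsum_const_mult)
    also have "\<dots> = fsum {y \<in> regular. cls_perm y = p} ?E (\<lambda>y. of_int (sign (cls_perm y)) * ?M y)"
      unfolding set[symmetric] by (rule fsum_cong) auto
    finally show "of_int (sign p) * (\<Prod>a<t. column (p a) (x a)) =
        fsum {y \<in> regular. cls_perm y = p} ?E (\<lambda>y. of_int (sign (cls_perm y)) * ?M y)" .
  qed
  also have "\<dots> = fsum regular ?E (\<lambda>y. of_int (sign (cls_perm y)) * ?M y)"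
    by (rule fsum_partition)
       (auto simp: finite_permutations regular_def intro: cls_perm_permutes finite_fibres_regular[OF assms, unfolded regular_def])
  finally show ?thesis .
qed

theorem theta_prod_eq_det:
  fixes x :: "nat \<Rightarrow> 'a::field"
  assumes t: "0 < t" and x: "\<And>a. a < t \<Longrightarrow> x a \<noteq> 0"
  shows "theta_prod x = base_series * Determinant.det (mat t t (\<lambda>(a, c). column c (x a)))"
proof (rule fps_ext)
  fix k
  let ?E = "\<lambda>y. \<Sum>a<t. en1 (y a)"
  let ?A = "{n \<in> configs t. energy t n = k}" and ?S = "{y \<in> regular. ?E y \<le> k}"
  let ?Y = "\<lambda>n. restrict (expo t n) {..<t}"
  have Yin: "?Y n \<in> PiE {..<t} (\<lambda>_. UNIV)" for n by (simp add: PiE_def)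
  have finA: "finite ?A" by (rule finite_fibresD[OF theta_prod_eq_fsum(2)[OF x]])
  have finS: "finite ?S" by (rule finite_fibres_le[OF finite_fibres_regular[OF t]])
  have "fps_nth (theta_prod x) k = (\<Sum>n\<in>?A. of_int (csign t n) * (\<Prod>a<t. x a powi expo t n a))"
    by (simp add: theta_prod_eq_fsum(1)[OF x] fsum_nth)
  \<comment> \<open>The configurations are grouped by exponent vector. The union contains both the
    vectors that occur and the regular ones of small energy that the determinant needs; off
    \<open>?S\<close> the coefficients vanish.\<close>
  also have "\<dots> = (\<Sum>y\<in>?Y ` ?A \<union> ?S. \<Sum>n\<in>{n \<in> ?A. ?Y n = y}. of_int (csign t n) * (\<Prod>a<t. x a powi expo t n a))"
    using finA finS by (intro sum.group[symmetric]) auto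
  also have "\<dots> = (\<Sum>y\<in>?Y ` ?A \<union> ?S. of_int (ccoeff t (int k) y) * (\<Prod>a<t. x a powi y a))"
  proof (intro sum.cong refl)
    fix y assume "y \<in> ?Y ` ?A \<union> ?S"
    then have "y \<in> PiE {..<t} (\<lambda>_. UNIV)" using Yin unfolding regular_def by blast
    then have "restrict y {..<t} = y" by (rule PiE_restrict)
    then have "?Y n = y \<longleftrightarrow> (\<forall>i<t. expo t n i = y i)" for n
      by (metis (no_types, lifting) lessThan_iff restrict_apply restrict_ext)
    then have "{n \<in> ?A. ?Y n = y} = cfibre t (int k) y"
      by (auto simp: cfibre_def)
    then show "(\<Sum>n\<in>{n \<in> ?A. ?Y n = y}. of_int (csign t n) * (\<Prod>a<t. x a powi expo t n a)) =
        of_int (ccoeff t (int k) y) * (\<Prod>a<t. x a powi y a)"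
      by (simp add: ccoeff_def sum_distrib_right) (auto simp: cfibre_def intro!: sum.cong)
  qed
  also have "\<dots> = (\<Sum>y\<in>?S. of_int (ccoeff t (int k) y) * (\<Prod>a<t. x a powi y a))"
  proof (intro sum.mono_neutral_right ballI)
    fix y assume y: "y \<in> ?Y ` ?A \<union> ?S - ?S"
    then have "y \<in> PiE {..<t} (\<lambda>_. UNIV)" using Yin unfolding regular_def by blast
    with y have "\<not> (inj_on (\<lambda>i. cls (y i)) {..<t} \<and> int (?E y) \<le> int k)"
      unfolding of_nat_le_iff by (auto simp: regular_def)
    from ccoeff_eq_0[OF this]
    show "of_int (ccoeff t (int k) y) * (\<Prod>a<t. x a powi y a) = 0"
      by (simp only: of_int_0 mult_zero_left)
  qed (use finA finS in auto)
  also have "\<dots> = (\<Sum>y\<in>?S. fps_nth base_series (k - ?E y) *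
      (of_int (sign (cls_perm y)) * (\<Prod>a<t. of_int (eps1 (y a)) * x a powi y a)))"
  proof (intro sum.cong refl)
    fix y assume "y \<in> ?S"
    then have "inj_on (\<lambda>i. cls (y i)) {..<t}" "int k - int (?E y) = int (k - ?E y)"
      by (auto simp: regular_def)
    then show "of_int (ccoeff t (int k) y) * (\<Prod>a<t. x a powi y a) =
      fps_nth base_series (k - ?E y) *
      (of_int (sign (cls_perm y)) * (\<Prod>a<t. of_int (eps1 (y a)) * x a powi y a))"
      by (simp only: ccoeff_eq_base base_series_def fps_nth_Abs_fps prod.distrib of_int_mult of_int_prod mult_ac)
  qed
  also have "\<dots> = (\<Sum>l\<in>{0..k}. \<Sum>y\<in>{y \<in> ?S. ?E y = l}. fps_nth base_series (k - ?E y) *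
      (of_int (sign (cls_perm y)) * (\<Prod>a<t. of_int (eps1 (y a)) * x a powi y a)))"
    using finS by (intro sum.group[symmetric]) auto
  also have "\<dots> = (\<Sum>l\<in>{0..k}. fps_nth base_series (k - l) *
     (\<Sum>y\<in>{y \<in> regular. ?E y = l}. of_int (sign (cls_perm y)) * (\<Prod>a<t. of_int (eps1 (y a)) * x a powi y a)))"
    unfolding sum_distrib_left by (intro sum.cong refl) auto
  also have "\<dots> = fps_nth (Determinant.det (mat t t (\<lambda>(a, c). column c (x a))) * base_series) k"
    unfolding det_columns[OF t] fps_mult_nth fsum_nth by (simp add: mult.commute)
  finally show "fps_nth (theta_prod x) k =
      fps_nth (base_series * Determinant.det (mat t t (\<lambda>(a, c). column c (x a)))) k"
    by (simp add: mult.commute)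
qed

end

section \<open>Product form of the theta functions\<close>

text \<open>The factor with \<open>k = 0\<close> has no T in it and is split off, because
  \<open>qprod\<close> is taken only at arguments divisible by T. It supplies the factors of the
  Weyl denominator.\<close>

lemma qprod_LIMSEQ_Suc:
  fixes z :: "'a::comm_ring_1"
  shows "(\<lambda>n. \<Prod>k<Suc n. 1 - fps_X ^ k * fps_const z) \<longlonglongrightarrow> fps_const (1 - z) * qprod (fps_X * fps_const z)"
proof -
  have "(\<Prod>k<Suc n. 1 - fps_X ^ k * fps_const z) =
      fps_const (1 - z) * (\<Prod>k<n. 1 - fps_X * fps_const z * fps_X ^ k)" for n
    by (subst prod.lessThan_Suc_shift) (simp add: mult_ac flip: fps_const_sub)
  then show ?thesis
    by (simp only:) (intro tendsto_mult_fps tendsto_const qprod_LIMSEQ, simp)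
qed

lemma theta_eq_qprod:
  fixes z :: "'a::field"
  assumes "z \<noteq> 0"
  shows "theta z = fps_const (1 - z) *
    (qprod fps_X * (qprod (fps_X * fps_const z) * qprod (fps_X * fps_const (inverse z))))"
proof -
  \<comment> \<open>Assigning all of T to \<open>b\<close> gives \<open>a * b = fps_X\<close> and
    makes the general term (-1)^m z^m T^(triang m).\<close>
  define a b where "a = - fps_const z" and "b = - (fps_X * fps_const (inverse z))"
  have q: "a * b = fps_X"
    using assms by (simp add: a_def b_def mult_ac flip: fps_const_mult)
  have "jterm a b m = fps_const (msgn m * z powi m) * fps_X ^ triang m" for m
  proof -
    have tr: "int (triang (m + 1)) = int (triang m) + m" by (rule triang_Suc)
    have pow: "z ^ triang (m + 1) * inverse z ^ triang m = z powi m"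
    proof -
      have "z ^ triang (m + 1) * inverse z ^ triang m = z powi int (triang (m + 1)) * z powi (- int (triang m))"
        by (simp add: power_int_minus power_inverse)
      also have "\<dots> = z powi m" using assms by (simp add: tr flip: power_int_add)
      finally show ?thesis .
    qed
    have sgn: "(- 1) ^ triang (m + 1) * (- 1) ^ triang m = (msgn m :: 'a)"
    proof -
      have "even (triang (m + 1) + triang m) \<longleftrightarrow> even m"
        using tr by (metis even_add even_of_nat add.commute)
      then show ?thesis by (simp add: msgn_def flip: power_add)
    qed
    have "jterm a b m = fps_const ((- z) ^ triang (m + 1) * (- inverse z) ^ triang m) * fps_X ^ triang m"
      by (simp add: jterm_def a_def b_def power_mult_distrib mult_ac flip: fps_const_power fps_const_mult
          mult_minus_right fps_const_neg)
    also have "(- z) ^ triang (m + 1) * (- inverse z) ^ triang m =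
        ((- 1) ^ triang (m + 1) * (- 1) ^ triang m) * (z ^ triang (m + 1) * inverse z ^ triang m)"
      by (subst (1 2) power_minus) (simp only: mult_ac)
    finally show ?thesis by (simp only: pow sgn)
  qed
  from jacobi_triple_product[of a b, OF _ this finite_fibres_triang]
  have "(\<lambda>n. \<Prod>k<n. (1 - fps_X ^ Suc k) * (1 + fps_X ^ k * a) * (1 + fps_X ^ k * b)) \<longlonglongrightarrow> theta z"
    by (simp add: q theta_def)
  then have lim: "(\<lambda>n. \<Prod>k<Suc n. (1 - fps_X ^ Suc k) * (1 + fps_X ^ k * a) * (1 + fps_X ^ k * b)) \<longlonglongrightarrow> theta z"
    by (rule LIMSEQ_Suc)
  have "(\<lambda>n. (\<Prod>k<Suc n. 1 - fps_X ^ k * fps_const z) * ((\<Prod>k<Suc n. 1 - fps_X * fps_X ^ k) *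
      (\<Prod>k<Suc n. 1 - fps_X * fps_const (inverse z) * fps_X ^ k))) \<longlonglongrightarrow>
    (fps_const (1 - z) * qprod (fps_X * fps_const z)) *
    (qprod fps_X * qprod (fps_X * fps_const (inverse z)))"
    by (intro tendsto_mult_fps qprod_LIMSEQ_Suc LIMSEQ_Suc[OF qprod_LIMSEQ]) auto
  also have "(\<lambda>n. (\<Prod>k<Suc n. 1 - fps_X ^ k * fps_const z) * ((\<Prod>k<Suc n. 1 - fps_X * fps_X ^ k) *
      (\<Prod>k<Suc n. 1 - fps_X * fps_const (inverse z) * fps_X ^ k))) =
    (\<lambda>n. \<Prod>k<Suc n. (1 - fps_X ^ Suc k) * (1 + fps_X ^ k * a) * (1 + fps_X ^ k * b))"
    unfolding prod.distrib[symmetric]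
    by (intro ext prod.cong refl) (simp add: a_def b_def mult_ac)
  finally show ?thesis
    using LIMSEQ_unique[OF lim] by (simp add: mult_ac)
qed

definition root_prod :: "nat \<Rightarrow> (nat \<Rightarrow> 'a::field) \<Rightarrow> 'a fps" where
  "root_prod t x = (\<Prod>r\<in>{..<t} \<times> {..<t}.
     qprod (fps_X * fps_const (posroot x r)) * qprod (fps_X * fps_const (inverse (posroot x r))))"

text \<open>The Weyl denominator of type B_t in product form, up to sign and a monomial.\<close>

definition weyl_const :: "nat \<Rightarrow> (nat \<Rightarrow> 'a::field) \<Rightarrow> 'a" where
  "weyl_const t x = (\<Prod>a<t. x a ^ a) * (\<Prod>r\<in>{..<t} \<times> {..<t}. 1 - posroot x r)"

lemma fps_const_prod: "fps_const (\<Prod>i\<in>I. f i) = (\<Prod>i\<in>I. fps_const (f i :: 'a::comm_ring_1))"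
  by (induction I rule: infinite_finite_induct) (simp_all flip: fps_const_mult)

lemma theta_prod_eq_qprod:
  fixes x :: "nat \<Rightarrow> 'a::field"
  assumes "\<And>a. a < t \<Longrightarrow> x a \<noteq> 0"
  shows "theta_prod t x = fps_const (weyl_const t x) * (qprod fps_X ^ (t * t) * root_prod t x)"
proof -
  have "theta (posroot x r) = fps_const (1 - posroot x r) * (qprod fps_X *
      (qprod (fps_X * fps_const (posroot x r)) * qprod (fps_X * fps_const (inverse (posroot x r)))))"
    if "r \<in> {..<t} \<times> {..<t}" for r
    using assms that by (intro theta_eq_qprod) (auto simp: posroot_def split: if_splits)
  then have "(\<Prod>r\<in>{..<t} \<times> {..<t}. theta (posroot x r)) =
      (\<Prod>r\<in>{..<t} \<times> {..<t}. fps_const (1 - posroot x r)) * (qprod fps_X ^ (t * t) * root_prod t x)"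
    by (simp add: prod.distrib root_prod_def)
  then show ?thesis
    by (simp add: theta_prod_def weyl_const_def fps_const_prod mult.assoc flip: fps_const_mult)
qed

lemma root_prod_nth_0: "fps_nth (root_prod t x) 0 = 1"
proof -
  have "fps_nth (\<Prod>r\<in>S. qprod (fps_X * fps_const (posroot x r)) *
      qprod (fps_X * fps_const (inverse (posroot x r)))) 0 = 1" for S
    by (induction S rule: infinite_finite_induct) (simp_all add: qprod_nth_0)
  then show ?thesis by (simp add: root_prod_def)
qed

section \<open>The columns as sums over one residue class\<close>

lemma fsum_Un:
  assumes "finite_fibres (I \<union> J) w" "I \<inter> J = {}"
  shows "fsum (I \<union> J) w A = fsum I w A + fsum J w A"
proof (rule fps_ext)
  fix k
  have eq: "{i \<in> I \<union> J. w i = k} = {i \<in> I. w i = k} \<union> {i \<in> J. w i = k}" by auto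
  have "finite ({i \<in> I. w i = k} \<union> {i \<in> J. w i = k})"
    using assms(1) unfolding eq[symmetric] by (rule finite_fibresD)
  then show "fps_nth (fsum (I \<union> J) w A) k = fps_nth (fsum I w A + fsum J w A) k"
    unfolding fps_add_nth fsum_nth eq using assms(2) by (subst sum.union_disjoint) auto
qed

lemma fsum_add: "fsum I w A + fsum I w B = fsum I w (\<lambda>i. A i + B i)"
  by (simp add: fps_eq_iff fsum_nth sum.distrib)

text \<open>For \<open>c > 0\<close> the class consists of the two distinct residues c and g - c.
  Reflecting the second onto the first turns the sum into one over differences.\<close>

lemma column_pos:
  fixes z :: "'a::field"
  assumes "0 < c" "c < t"
  defines "g \<equiv> int (2 * t - 1)"
  shows "column t c z = fsum UNIV (\<lambda>n. en1 t (g * n + int c))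
    (\<lambda>n. msgn n * (z powi (g * n + int c) - z powi (g - (g * n + int c))))"
    and "finite_fibres UNIV (\<lambda>n. en1 t (g * n + int c))"
proof -
  have t: "0 < t" using assms by simp
  have g: "g = 2 * int t - 1" using assms by simp
  let ?I = "{y. y mod g = int c}" and ?J = "{y. y mod g = g - int c}"
  let ?f = "\<lambda>n. g * n + int c"
  have cls_cases: "{y. cls t y = c} = ?I \<union> ?J"
    using mod_lev[OF t] assms unfolding cls_def g_def[symmetric]
    by (auto split: if_splits simp: g nat_eq_iff)
  have fmod: "?f n mod g = int c" "(g - ?f n) mod g = g - int c" for n
  proof -
    show "?f n mod g = int c" using assms by (simp add: g)
    have eq: "g - ?f n = g * (- n) + (g - int c)" by (simp add: algebra_simps)
    show "(g - ?f n) mod g = g - int c"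
      unfolding eq unfolding g_def by (rule residue_cases(2)[OF t]) (use assms in auto)
  qed
  have bij1: "bij_betw ?f UNIV ?I"
  proof (rule bij_betwI')
    show "\<exists>n\<in>UNIV. y = ?f n" if "y \<in> ?I" for y
      using that by (intro bexI[of _ "y div g"]) (auto simp: minus_mod_eq_mult_div [symmetric])
  qed (use fmod g t in auto)
  have bij2: "bij_betw (\<lambda>n. g - ?f n) UNIV ?J"
  proof (rule bij_betwI')
    show "\<exists>n\<in>UNIV. y = g - ?f n" if "y \<in> ?J" for y
    proof (intro bexI[of _ "- (y div g)"])
      show "y = g - ?f (- (y div g))"
        using that mult_div_mod_eq[of g y] by simp
    qed simp
  qed (use fmod g t in auto)
  have ff: "finite_fibres S (en1 t)" for S
    by (rule finite_fibres_subset[OF finite_fibres_en1[OF t]]) simp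
  have sh: "eps1 t (?f n) = msgn n" for n using alcove_shift(2)[of c t n] assms by (simp add: g_def)
  have refl: "eps1 t (g - ?f n) = - msgn n" "en1 t (g - ?f n) = en1 t (?f n)" for n
  proof -
    have "\<not> (g - ?f n) mod g < int t" unfolding fmod using assms by (simp add: g)
    from alcove_reflect(2,3)[OF t this[unfolded g_def], folded g_def]
    show "eps1 t (g - ?f n) = - msgn n" "en1 t (g - ?f n) = en1 t (?f n)" using sh[of n] by auto
  qed
  show fin: "finite_fibres UNIV (\<lambda>n. en1 t (?f n))"
    using finite_fibres_reindex[OF bij1, of "en1 t" "\<lambda>n. en1 t (?f n)"] ff by simp
  have "column t c z = fsum ?I (en1 t) (\<lambda>y. of_int (eps1 t y) * z powi y) +
      fsum ?J (en1 t) (\<lambda>y. of_int (eps1 t y) * z powi y)"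
    unfolding column_def cls_cases 
  proof (intro fsum_Un ff)
    have "g - int c \<noteq> int c" unfolding g by presburger
    then show "?I \<inter> ?J = {}" by auto
  qed
  also have "fsum ?I (en1 t) (\<lambda>y. of_int (eps1 t y) * z powi y) =
      fsum UNIV (\<lambda>n. en1 t (?f n)) (\<lambda>n. msgn n * z powi (?f n))"
    by (rule fsum_reindex[OF bij1]) (simp_all add: sh)
  also have "fsum ?J (en1 t) (\<lambda>y. of_int (eps1 t y) * z powi y) =
      fsum UNIV (\<lambda>n. en1 t (?f n)) (\<lambda>n. - (msgn n * z powi (g - ?f n)))"
    by (rule fsum_reindex[OF bij2]) (simp_all add: refl)
  finally show "column t c z = fsum UNIV (\<lambda>n. en1 t (?f n)) (\<lambda>n. msgn n * (z powi (?f n) - z powi (g - ?f n)))"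
    by (simp add: fsum_add algebra_simps)
qed

text \<open>Class 0 is a single residue, on which reflection acts by n -> 1 - n. Pairing n >= 1 with
  1 - n gives the third form, of the same shape as the other columns.\<close>

lemma column_0:
  fixes z :: "'a::field"
  assumes t: "0 < t"
  defines "g \<equiv> int (2 * t - 1)"
  shows "column t 0 z = fsum UNIV (\<lambda>n. en1 t (g * n)) (\<lambda>n. msgn n * z powi (g * n))"
    and "finite_fibres UNIV (\<lambda>n. en1 t (g * n))"
    and "column t 0 z = fsum {1..} (\<lambda>n. en1 t (g * n)) (\<lambda>n. msgn n * (z powi (g * n) - z powi (g - g * n)))"
proof -
  have g: "g = 2 * int t - 1" using assms by simp
  let ?f = "\<lambda>n. g * n"
  have "cls t y = 0 \<longleftrightarrow> y mod g = 0" for y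
    using mod_lev[OF t, of y] t unfolding cls_def g_def[symmetric] by auto
  then have cls_0: "{y. cls t y = 0} = {y. y mod g = 0}" by simp
  have bij1: "bij_betw ?f UNIV {y. y mod g = 0}"
    by (rule bij_betwI') (use g t in \<open>auto simp: mod_eq_0_iff_dvd\<close>)
  have ff: "finite_fibres S (en1 t)" for S
    by (rule finite_fibres_subset[OF finite_fibres_en1[OF t]]) simp
  have sh: "eps1 t (?f n) = msgn n" for n using alcove_shift(2)[of 0 t n] t by (simp add: g_def)
  have en: "int (en1 t (?f n)) = g * int (triang n)" for n
    using alcove_shift(3)[of 0 t n] t by (simp add: g_def)
  show fin: "finite_fibres UNIV (\<lambda>n. en1 t (?f n))"
    using finite_fibres_reindex[OF bij1, of "en1 t" "\<lambda>n. en1 t (?f n)"] ff by simp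
  show eq: "column t 0 z = fsum UNIV (\<lambda>n. en1 t (?f n)) (\<lambda>n. msgn n * z powi (?f n))"
    unfolding column_def cls_0 by (rule fsum_reindex[OF bij1]) (simp_all add: sh)
  have U: "(UNIV :: int set) = {1..} \<union> {..0}" by auto
  have bij2: "bij_betw (\<lambda>n::int. 1 - n) {1..} {..0}"
    by (rule bij_betwI[of _ _ _ "\<lambda>n. 1 - n"]) auto
  have "column t 0 z = fsum {1..} (\<lambda>n. en1 t (?f n)) (\<lambda>n. msgn n * z powi (?f n)) +
      fsum {..0} (\<lambda>n. en1 t (?f n)) (\<lambda>n. msgn n * z powi (?f n))"
    unfolding eq U by (intro fsum_Un) (use fin in \<open>auto simp: U[symmetric]\<close>)
  also have "fsum {..0} (\<lambda>n. en1 t (?f n)) (\<lambda>n. msgn n * z powi (?f n)) =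
     fsum {1..} (\<lambda>n. en1 t (?f n)) (\<lambda>n. - (msgn n * z powi (g - ?f n)))"
  proof (rule fsum_reindex[OF bij2])
    fix n :: int
    have "int (en1 t (?f (1 - n))) = int (en1 t (?f n))" unfolding en triang_reflect ..
    then show "en1 t (?f (1 - n)) = en1 t (?f n)" by simp
    show "msgn (1 - n) * z powi (?f (1 - n)) = - (msgn n * z powi (g - ?f n))"
      by (simp add: msgn_diff algebra_simps)
  qed
  finally show "column t 0 z = fsum {1..} (\<lambda>n. en1 t (?f n)) (\<lambda>n. msgn n * (z powi (?f n) - z powi (g - ?f n)))"
    by (simp add: fsum_add algebra_simps)
qed

text \<open>For \<open>c = 0\<close> the integers n and 1 - n label the same difference, so only n
  >= 1 is kept; on partitions this becomes the condition \<open>m_1 >= 1\<close> on the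
  rectangle.\<close>

definition class_range :: "nat \<Rightarrow> int set" where
  "class_range c = (if c = 0 then {1..} else UNIV)"

lemma column_eq:
  fixes z :: "'a::field"
  assumes "c < t"
  defines "g \<equiv> int (2 * t - 1)"
  shows "column t c z = fsum (class_range c) (\<lambda>n. en1 t (g * n + int c))
    (\<lambda>n. msgn n * (z powi (g * n + int c) - z powi (g - (g * n + int c))))"
    and "finite_fibres (class_range c) (\<lambda>n. en1 t (g * n + int c))"
proof -
  show "column t c z = fsum (class_range c) (\<lambda>n. en1 t (g * n + int c))
      (\<lambda>n. msgn n * (z powi (g * n + int c) - z powi (g - (g * n + int c))))"
    using column_pos(1)[of c t z] column_0(3)[of t z] assms by (cases "c = 0") (auto simp: class_range_def)
  have "finite_fibres UNIV (\<lambda>n. en1 t (g * n + int c))"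
    using column_pos(2)[of c t] column_0(2)[of t] assms by (cases "c = 0") auto
  then show "finite_fibres (class_range c) (\<lambda>n. en1 t (g * n + int c))"
    by (rule finite_fibres_subset) simp
qed

lemma column_nth_0:
  fixes z :: "'a::field"
  assumes "c < t"
  shows "fps_nth (column t c z) 0 = z powi int c - z powi (int (2 * t - 1) - int c)"
proof -
  let ?g = "int (2 * t - 1)"
  \<comment> \<open>The only index of energy 0. For \<open>c = 0\<close> it is 1, and the sign
    \<open>msgn 1 = - 1\<close> turns \<open>z powi g - 1\<close> into the stated
    difference.\<close>
  define n0 :: int where "n0 = (if c = 0 then 1 else 0)"
  have t: "0 < t" and c: "int c < ?g" using assms by auto
  have "{n \<in> class_range c. en1 t (?g * n + int c) = 0} = {n0}"
  proof -
    have iff: "en1 t (?g * n + int c) = 0 \<longleftrightarrow> n = n0" if n: "n \<in> class_range c" for n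
    proof -
      have en: "int (en1 t (?g * n + int c)) = n * int c + ?g * int (triang n)"
        by (rule alcove_shift(3)[OF assms])
      have n1: "n \<ge> 1" if "c = 0" using n that by (simp add: class_range_def)
      show ?thesis
      proof (cases "n \<ge> 1")
        case True
        have "int (triang n) = 0 \<longleftrightarrow> n = 1"
          using True triang_times_2[of n] by auto
        moreover have "n * int c + ?g * int (triang n) = 0 \<longleftrightarrow> n * int c = 0 \<and> ?g * int (triang n) = 0"
          using True by (intro add_nonneg_eq_0_iff) auto
        ultimately show ?thesis using en True t by (auto simp: n0_def)
      next
        case False
        then have c0: "c \<noteq> 0" using n1 by auto
        show ?thesis
        proof (cases "n = 0")
          case True
          then show ?thesis using en c0 by (simp add: triang_def n0_def)
        next
          case nz: False
          then have neg: "n \<le> - 1" using False by simp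
          have "int (triang (n + 1)) \<ge> 0" by simp
          then have "?g * (- n) \<le> ?g * int (triang n)"
            unfolding triang_Suc using t by (intro mult_left_mono) auto
          moreover have "(- n) * int c < (- n) * ?g" using neg c by (intro mult_strict_left_mono) auto
          ultimately have "n * int c + ?g * int (triang n) > 0" by (simp only: mult.commute[of ?g] mult_minus_left)
          then show ?thesis using en c0 nz by (auto simp: n0_def)
        qed
      qed
    qed
    have mem: "n0 \<in> class_range c" by (simp add: class_range_def n0_def)
    show ?thesis
    proof (intro equalityI subsetI)
      fix n assume "n \<in> {n \<in> class_range c. en1 t (?g * n + int c) = 0}"
      then show "n \<in> {n0}" using iff[of n] by simp
    next
      fix n assume "n \<in> {n0}"
      then show "n \<in> {n \<in> class_range c. en1 t (?g * n + int c) = 0}" using iff[of n] mem by simp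
    qed
  qed
  then show ?thesis
    unfolding column_eq(1)[OF assms] fsum_nth by (simp add: n0_def)
qed

text \<open>The Weyl denominator as an alternating sum, that is, the constant term in T of the
  determinant of columns.\<close>

definition weyl_det :: "nat \<Rightarrow> (nat \<Rightarrow> 'a::field) \<Rightarrow> 'a" where
  "weyl_det t x = Determinant.det (mat t t (\<lambda>(a, c). x a powi int c - x a powi (int (2 * t - 1) - int c)))"

lemma comm_ring_hom_fps_nth_0: "comm_ring_hom (\<lambda>f :: 'a::comm_ring_1 fps. fps_nth f 0)"
  by unfold_locales auto

lemma det_columns_nth_0:
  "fps_nth (Determinant.det (mat t t (\<lambda>(a, c). column t c (x a)))) 0 = weyl_det t x"
  unfolding weyl_det_def comm_ring_hom.hom_det[OF comm_ring_hom_fps_nth_0, symmetric]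
  by (intro arg_cong[of _ _ Determinant.det]) (auto simp: column_nth_0)

text \<open>The Weyl denominator formula up to an integer factor, obtained as the constant term of
  \<open>theta_prod_eq_det\<close>.\<close>

lemma weyl_const_eq:
  fixes x :: "nat \<Rightarrow> 'a::field"
  assumes t: "0 < t" and x: "\<And>a. a < t \<Longrightarrow> x a \<noteq> 0"
  shows "weyl_const t x = of_int (ccoeff t 0 int) * weyl_det t x"
proof -
  have "weyl_const t x = fps_nth (theta_prod t x) 0"
    using x by (subst theta_prod_eq_qprod) (simp_all add: fps_nth_power_0 qprod_nth_0 root_prod_nth_0)
  also have "\<dots> = of_int (ccoeff t 0 int) * weyl_det t x"
    using x by (subst theta_prod_eq_det[OF t]) (simp_all add: base_series_def det_columns_nth_0)
  finally show ?thesis .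
qed

section \<open>Specialisation at roots of unity\<close>

text \<open>As polynomials in \<open>y\<close> both sides have degree at most \<open>g\<close> and
  agree at 0 and at the \<open>g\<close> powers of \<open>w\<close>. In a general integral domain
  \<open>y\<close> may be a power series.\<close>

lemma prod_one_minus_powers:
  fixes w :: "'a::idom"
  assumes inj: "inj_on (\<lambda>i. w ^ i) {..<g}" and w: "w ^ g = 1" and g: "0 < g"
  shows "(\<Prod>i<g. 1 - w ^ i * y) = 1 - y ^ g"
proof -
  define p where "p = (\<Prod>i<g. [:1, - (w ^ i):]) - (1 - monom 1 g)"
  have w0: "w \<noteq> 0" using w g by (metis power_0_left not_gr_zero zero_neq_one)
  have val: "poly p z = (\<Prod>i<g. 1 - w ^ i * z) - (1 - z ^ g)" for z
    by (simp add: p_def poly_prod poly_monom algebra_simps)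
  have "p = 0"
  proof (rule ccontr)
    assume "p \<noteq> 0"
    have "degree (\<Prod>i<g. [:1, - (w ^ i):]) \<le> (\<Sum>i<g. degree [:1, - (w ^ i):])"
      using degree_prod_sum_le[of "{..<g}" "\<lambda>i. [:1, - (w ^ i):]"] by (simp add: o_def)
    also have "\<dots> \<le> (\<Sum>i<g. 1)" by (intro sum_mono) simp
    finally have d1: "degree (\<Prod>i<g. [:1, - (w ^ i):]) \<le> g" by simp
    have d2: "degree (1 - monom (1::'a) g) \<le> g"
      by (intro degree_diff_le) (auto simp: degree_monom_le)
    have deg: "degree p \<le> g" unfolding p_def by (rule degree_diff_le[OF d1 d2])
    have "poly p z = 0" if z: "z \<in> insert 0 ((\<lambda>i. w ^ i) ` {..<g})" for z
    proof (cases "z = 0")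
      case True
      then show ?thesis using g by (simp add: val power_0_left)
    next
      case False
      then obtain j where j: "j < g" "z = w ^ j" using z by auto
      have zg: "z ^ g = 1" unfolding j using w by (metis power_mult mult.commute power_one)
      have "\<exists>i\<in>{..<g}. 1 - w ^ i * z = 0"
      proof (cases "j = 0")
        case True
        then show ?thesis using j g by (intro bexI[of _ 0]) auto
      next
        case False
        have "w ^ (g - j) * w ^ j = 1" using j w by (simp flip: power_add)
        then show ?thesis using j False by (intro bexI[of _ "g - j"]) auto
      qed
      then show ?thesis by (subst val) (simp add: zg prod_zero_iff)
    qed
    then have "card (insert 0 ((\<lambda>i. w ^ i) ` {..<g})) \<le> card {z. poly p z = 0}"
      by (intro card_mono poly_roots_finite[OF \<open>p \<noteq> 0\<close>]) blast
    moreover have "card (insert 0 ((\<lambda>i. w ^ i) ` {..<g})) = Suc g"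
      using w0 inj by (subst card_insert_disjoint) (auto simp: card_image)
    ultimately show False using card_poly_roots_bound[OF \<open>p \<noteq> 0\<close>] deg by simp
  qed
  then show ?thesis using val[of y] by simp
qed

context
  fixes t g :: nat
  assumes t: "0 < t" and g: "g = 2 * t - 1"
begin

lemma g_pos: "0 < g" and odd_g: "odd g" and t_le_g: "t \<le> g"
  using t by (auto simp: g)

definition zeta :: complex where "zeta = cis (2 * pi / real g)"

lemma zeta_power: "zeta ^ i = cis (2 * pi * real i / real g)"
  unfolding zeta_def Complex.DeMoivre by (intro arg_cong[of _ _ cis]) (simp add: mult_ac)

lemma zeta_inj: "inj_on (\<lambda>i. zeta ^ i) {..<g}"
  using Complex.bij_betw_roots_unity[OF g_pos] by (simp add: zeta_power bij_betw_def)

lemma zeta_order: "zeta ^ g = 1"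
  unfolding zeta_power using g_pos by simp

lemma zeta_neq_0: "zeta \<noteq> 0"
  by (simp add: zeta_def)

lemma zeta_powi_period: "zeta powi (i + int g * k) = zeta powi i"
  by (simp add: power_int_add zeta_neq_0 power_int_mult power_int_of_nat zeta_order del: of_nat_diff)

lemma zeta_powi_neq_1:
  assumes "0 < i" "i < int g"
  shows "zeta powi i \<noteq> 1"
proof
  assume "zeta powi i = 1"
  moreover have "zeta powi i = zeta ^ nat i" using assms by (simp add: power_int_def)
  ultimately have "zeta ^ nat i = zeta ^ 0" by simp
  moreover have "nat i < g" using assms by linarith
  ultimately have "nat i = 0" using inj_onD[OF zeta_inj, of "nat i" 0] g_pos by auto
  then show False using assms by simp
qed

definition ufac :: "complex fps \<Rightarrow> int \<Rightarrow> complex fps" where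
  "ufac Y i = 1 - fps_const (zeta powi i) * Y"

lemma ufac_period: "ufac Y (i + int g * k) = ufac Y i"
  unfolding ufac_def zeta_powi_period ..

lemma prod_ufac: "(\<Prod>j<g. ufac Y (s + int j)) = 1 - Y ^ g"
proof -
  let ?w = "fps_const zeta"
  have inj: "inj_on (\<lambda>i. ?w ^ i) {..<g}"
    using zeta_inj by (auto simp: inj_on_def fps_const_power)
  have w: "?w ^ g = 1" by (simp add: fps_const_power zeta_order)
  have "(zeta powi s) ^ g = 1"
    using zeta_powi_period[of 0 s] by (simp add: power_int_mult power_int_power mult.commute del: of_nat_diff)
  then have "(fps_const (zeta powi s) * Y) ^ g = Y ^ g"
    by (simp add: power_mult_distrib fps_const_power)
  moreover have "(\<Prod>j<g. ufac Y (s + int j)) = (\<Prod>j<g. 1 - ?w ^ j * (fps_const (zeta powi s) * Y))"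
    by (intro prod.cong refl)
       (simp add: ufac_def power_int_add zeta_neq_0 fps_const_power mult_ac flip: fps_const_mult)
  ultimately show ?thesis using prod_one_minus_powers[OF inj w g_pos] by simp
qed

text \<open>The numbers a - (t - 1), ..., a + (t - 1) are g consecutive integers and meet every
  residue once.\<close>

lemma prod_ufac_split:
  "(\<Prod>b<t. ufac Y (a - int b)) * (\<Prod>b\<in>{1..<t}. ufac Y (a + int b)) = 1 - Y ^ g"
proof -
  have set: "{..<g} = {..<t} \<union> {t..<g}" using t_le_g by auto
  have "(\<Prod>j<g. ufac Y (a - int (t - 1) + int j)) =
      (\<Prod>j<t. ufac Y (a - int (t - 1) + int j)) * (\<Prod>j\<in>{t..<g}. ufac Y (a - int (t - 1) + int j))"
    unfolding set by (rule prod.union_disjoint) auto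
  also have "(\<Prod>j<t. ufac Y (a - int (t - 1) + int j)) = (\<Prod>b<t. ufac Y (a - int b))"
    by (rule prod.reindex_bij_witness[of _ "\<lambda>b. t - 1 - b" "\<lambda>b. t - 1 - b"])
       (auto intro!: arg_cong[of _ _ "ufac Y"])
  also have "(\<Prod>j\<in>{t..<g}. ufac Y (a - int (t - 1) + int j)) = (\<Prod>b\<in>{1..<t}. ufac Y (a + int b))"
    by (rule prod.reindex_bij_witness[of _ "\<lambda>b. b + (t - 1)" "\<lambda>j. j - (t - 1)"])
       (use g in \<open>auto simp: algebra_simps\<close>)
  finally show ?thesis using prod_ufac[of Y "a - int (t - 1)"] by simp
qed

text \<open>The weights of the adjoint representation, specialised: every residue modulo \<open>2 t - 1\<close>
  occurs \<open>t\<close> times among the differences, sums and negated sums.\<close>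

lemma prod_ufac_pairs:
  "ufac Y 0 ^ t * (\<Prod>(i, j)\<in>lt_pairs t. ufac Y (int i - int j) * ufac Y (int j - int i) *
     (ufac Y (int i + int j) * ufac Y (- (int i + int j)))) = (1 - Y ^ g) ^ t"
proof -
  \<comment> \<open>This map takes the pairs i < j to the other triangle a >= b >= 1, and i + j to g
    - (i + j). The sums over that triangle are thus the negated sums modulo g.\<close>
  let ?L = "(\<lambda>(i, j). (t - 1 - i, t - j)) ` lt_pairs t"
  have S: "{..<t} \<times> {1..<t} = lt_pairs t \<union> ?L"
  proof (intro equalityI subsetI)
    fix p assume "p \<in> {..<t} \<times> {1..<t}"
    then obtain a b where p: "p = (a, b)" "a < t" "1 \<le> b" "b < t" by auto
    show "p \<in> lt_pairs t \<union> ?L"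
    proof (cases "a < b")
      case False
      then have "(t - 1 - a, t - b) \<in> lt_pairs t" "p = (t - 1 - (t - 1 - a), t - (t - b))"
        using p by (auto simp: lt_pairs_def)
      then show ?thesis by force
    qed (use p in \<open>auto simp: lt_pairs_def\<close>)
  qed (auto simp: lt_pairs_def)
  have inj: "inj_on (\<lambda>(i, j). (t - 1 - i, t - j)) (lt_pairs t)"
    by (auto simp: inj_on_def lt_pairs_def)
  have "(\<Prod>a<t. \<Prod>b\<in>{1..<t}. ufac Y (int a + int b)) = (\<Prod>(a, b)\<in>lt_pairs t \<union> ?L. ufac Y (int a + int b))"
    unfolding S[symmetric] by (rule prod.cartesian_product)
  also have "\<dots> = (\<Prod>(a, b)\<in>lt_pairs t. ufac Y (int a + int b)) * (\<Prod>(a, b)\<in>?L. ufac Y (int a + int b))"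
    by (rule prod.union_disjoint, simp, simp) (auto simp: lt_pairs_def)
  also have "(\<Prod>(a, b)\<in>?L. ufac Y (int a + int b)) = (\<Prod>(i, j)\<in>lt_pairs t. ufac Y (- (int i + int j)))"
  proof (subst prod.reindex[OF inj], intro prod.cong refl, clarify)
    fix i j assume "(i, j) \<in> lt_pairs t"
    then have "int (t - 1 - i) + int (t - j) = - (int i + int j) + int g * 1"
      using g by (auto simp: lt_pairs_def)
    then have "ufac Y (int (t - 1 - i) + int (t - j)) = ufac Y (- (int i + int j))"
      by (simp only: ufac_period)
    then show "((\<lambda>(a, b). ufac Y (int a + int b)) \<circ> (\<lambda>(i, j). (t - 1 - i, t - j))) (i, j) =
        ufac Y (- (int i + int j))" by simp
  qed
  finally have 1: "(\<Prod>a<t. \<Prod>b\<in>{1..<t}. ufac Y (int a + int b)) =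
    (\<Prod>(a, b)\<in>lt_pairs t. ufac Y (int a + int b)) * (\<Prod>(i, j)\<in>lt_pairs t. ufac Y (- (int i + int j)))" .
  have "(\<Prod>a<t. \<Prod>b<t. ufac Y (int a - int b)) = (\<Prod>(a, b)\<in>{..<t} \<times> {..<t}. ufac Y (int a - int b))"
    by (rule prod.cartesian_product)
  also have "\<dots> = ufac Y 0 ^ t * (\<Prod>(i, j)\<in>lt_pairs t. ufac Y (int i - int j) * ufac Y (int j - int i))"
    unfolding prod.square_split by simp
  finally have 2: "(\<Prod>a<t. \<Prod>b<t. ufac Y (int a - int b)) =
    ufac Y 0 ^ t * (\<Prod>(i, j)\<in>lt_pairs t. ufac Y (int i - int j) * ufac Y (int j - int i))" .
  have "(1 - Y ^ g) ^ t = (\<Prod>a<t. (\<Prod>b<t. ufac Y (int a - int b)) * (\<Prod>b\<in>{1..<t}. ufac Y (int a + int b)))"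
    unfolding prod_ufac_split by simp
  also have "\<dots> = (\<Prod>a<t. \<Prod>b<t. ufac Y (int a - int b)) * (\<Prod>a<t. \<Prod>b\<in>{1..<t}. ufac Y (int a + int b))"
    by (rule prod.distrib)
  finally show ?thesis unfolding 1 2 by (simp add: case_prod_unfold prod.distrib mult_ac)
qed

text \<open>As g is odd, the minus sign gives x^g = -1, which cancels the signs
  \<open>msgn n\<close> of the columns. It also keeps the short roots different from 1, in
  particular at a = 0.\<close>

definition xpt :: "nat \<Rightarrow> complex" where "xpt a = - (zeta ^ a)"

lemma xpt_neq_0: "xpt a \<noteq> 0" by (simp add: xpt_def zeta_neq_0)

lemma xpt_root:
  "i < j \<Longrightarrow> posroot xpt (i, j) = zeta powi (int i - int j)"
  "i < j \<Longrightarrow> posroot xpt (j, i) = zeta powi (int i + int j)"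
  "posroot xpt (i, i) = - (zeta powi int i)"
  by (simp_all add: posroot_def xpt_def power_int_diff power_int_add zeta_neq_0)

lemma xpt_level: "xpt a powi int g = - 1"
proof -
  have "(zeta ^ a) ^ g = 1" by (metis power_mult mult.commute power_one zeta_order)
  then show ?thesis by (simp only: xpt_def power_int_of_nat power_minus_odd[OF odd_g])
qed

text \<open>The point is regular: for i < j both j - i and i + j lie strictly between 0 and g, and a
  short root has g-th power -1.\<close>

lemma weyl_const_xpt: "weyl_const t xpt \<noteq> 0"
proof -
  have "posroot xpt r \<noteq> 1" if r: "r \<in> {..<t} \<times> {..<t}" for r
  proof -
    obtain i j where ij: "r = (i, j)" "i < t" "j < t" using r by auto
    consider "i < j" | "j < i" | "i = j" by linarith
    then show ?thesis
    proof cases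
      case 1
      then have "zeta powi (int j - int i) \<noteq> 1" using ij t_le_g g by (intro zeta_powi_neq_1) auto
      moreover have "zeta powi (int i - int j) = inverse (zeta powi (int j - int i))"
        by (simp flip: power_int_minus)
      ultimately show ?thesis using 1 by (simp add: ij xpt_root)
    next
      case 2
      then have "zeta powi (int j + int i) \<noteq> 1" using ij t_le_g g by (intro zeta_powi_neq_1) auto
      then show ?thesis using 2 by (simp add: ij xpt_root)
    next
      case 3
      show ?thesis
      proof
        assume "posroot xpt r = 1"
        then have "xpt i = 1" using 3 ij by (simp add: posroot_def)
        then show False using xpt_level[of i] by simp
      qed
    qed
  qed
  then show ?thesis by (auto simp: weyl_const_def xpt_neq_0)
qed

text \<open>On the short roots the exponents i and -i meet residue 0 twice and all others once,
  giving (1 + Y) (1 + Y^g). The long roots together with (1 - Y)^t are covered by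
  \<open>prod_ufac_pairs\<close>.\<close>

lemma root_factors_xpt:
  fixes Y :: "complex fps"
  shows "(1 - Y) ^ t * (\<Prod>r\<in>{..<t} \<times> {..<t}. (1 - fps_const (posroot xpt r) * Y) *
      (1 - fps_const (inverse (posroot xpt r)) * Y)) = (1 + Y) * (1 + Y ^ g) * (1 - Y ^ g) ^ t"
proof -
  let ?F = "\<lambda>r. (1 - fps_const (posroot xpt r) * Y) * (1 - fps_const (inverse (posroot xpt r)) * Y)"
  have "(\<Prod>i<t. ?F (i, i)) = (\<Prod>i<t. ufac (- Y) (0 - int i) * ufac (- Y) (0 + int i))"
    by (intro prod.cong refl) (simp add: xpt_root ufac_def power_int_minus mult.commute flip: fps_const_neg)
  also have "\<dots> = (\<Prod>i<t. ufac (- Y) (0 - int i)) * (\<Prod>i<t. ufac (- Y) (0 + int i))"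
    by (rule prod.distrib)
  also have "(\<Prod>i<t. ufac (- Y) (0 + int i)) = ufac (- Y) 0 * (\<Prod>i\<in>{1..<t}. ufac (- Y) (0 + int i))"
  proof -
    have "{..<t} = insert 0 {1..<t}" using t by auto
    then show ?thesis by simp
  qed
  finally have "(\<Prod>i<t. ?F (i, i)) = ufac (- Y) 0 * (1 - (- Y) ^ g)"
    unfolding prod_ufac_split[symmetric, of "- Y" 0] by (simp only: mult_ac)
  then have diag: "(\<Prod>i<t. ?F (i, i)) = (1 + Y) * (1 + Y ^ g)"
    using odd_g by (simp add: ufac_def del: even_mult_iff)
  have off: "(\<Prod>(i, j)\<in>lt_pairs t. ?F (i, j) * ?F (j, i)) =
    (\<Prod>(i, j)\<in>lt_pairs t. ufac Y (int i - int j) * ufac Y (int j - int i) *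
     (ufac Y (int i + int j) * ufac Y (- (int i + int j))))"
  proof (intro prod.cong refl, clarify)
    fix i j assume "(i, j) \<in> lt_pairs t"
    then have ij: "i < j" by (auto simp: lt_pairs_def)
    have "inverse (zeta powi (int i - int j)) = zeta powi (int j - int i)"
      "inverse (zeta powi (int i + int j)) = zeta powi (- (int i + int j))"
      by (simp_all only: power_int_minus[symmetric] minus_diff_eq)
    then show "?F (i, j) * ?F (j, i) = ufac Y (int i - int j) * ufac Y (int j - int i) *
     (ufac Y (int i + int j) * ufac Y (- (int i + int j)))"
      by (simp only: xpt_root(1,2)[OF ij] ufac_def)
  qed
  have u0: "ufac Y 0 = 1 - Y" by (simp add: ufac_def)
  show ?thesis
    unfolding prod.square_split diag off prod_ufac_pairs[of Y, unfolded u0, symmetric] by (simp only: mult_ac)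
qed

section \<open>The constant factor\<close>

text \<open>What remains of column \<open>c\<close> at \<open>xpt\<close> once its scalar factor is
  removed.\<close>

definition theta_class :: "nat \<Rightarrow> complex fps" where
  "theta_class c = fsum UNIV (\<lambda>n. en1 t (int g * n + int c)) (\<lambda>_. 1)"

lemma theta_class_LIMSEQ:
  assumes "c < t"
  defines "q \<equiv> fps_X ^ g :: complex fps"
  shows "(\<lambda>n. \<Prod>k<n. (1 - q ^ Suc k) * (1 + q ^ k * fps_X ^ c) * (1 + q ^ k * fps_X ^ (g - c)))
    \<longlonglongrightarrow> theta_class c"
proof -
  have q: "fps_X ^ c * fps_X ^ (g - c) = q" using assms t_le_g by (simp add: q_def flip: power_add)
  have w: "jterm (fps_X ^ c) (fps_X ^ (g - c)) m = fps_const (1::complex) * fps_X ^ en1 t (int g * m + int c)" for m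
  proof -
    have "int (c * triang (m + 1) + (g - c) * triang m) =
        int c * int (triang (m + 1)) + (int g - int c) * int (triang m)"
      using assms(1) t_le_g by (simp add: of_nat_diff)
    also have "\<dots> = m * int c + int g * int (triang m)"
      unfolding triang_Suc by (simp add: algebra_simps)
    also have "\<dots> = int (en1 t (int g * m + int c))"
      using alcove_shift(3)[OF assms(1), of m] by (simp only: g)
    finally have "int (c * triang (m + 1) + (g - c) * triang m) = int (en1 t (int g * m + int c))" .
    then have "c * triang (m + 1) + (g - c) * triang m = en1 t (int g * m + int c)" by (simp only: of_nat_eq_iff)
    then show ?thesis by (simp add: jterm_def flip: power_mult power_add)
  qed
  have fin: "finite_fibres UNIV (\<lambda>n. en1 t (int g * n + int c))"
    using column_pos(2)[of c t, folded g] column_0(2)[OF t, folded g] assms(1) by (cases "c = 0") auto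
  have "fps_nth q 0 = 0" using g_pos by (simp add: q_def)
  with jacobi_triple_product[of "fps_X ^ c" "fps_X ^ (g - c)", OF _ w fin, unfolded q]
  show ?thesis by (simp only: theta_class_def)
qed

text \<open>For \<open>c < t\<close> the exponents c and g - c together run through 0, ..., g, each
  once.\<close>

lemma class_factors:
  fixes q :: "complex fps"
  shows "(\<Prod>c<t. (1 + q * fps_X ^ c) * (1 + q * fps_X ^ (g - c))) = (1 + q) * (\<Prod>i<g. 1 + q * fps_X ^ Suc i)"
proof -
  have 1: "(\<Prod>c<t. 1 + q * fps_X ^ c) = (1 + q) * (\<Prod>c<t - 1. 1 + q * fps_X ^ Suc c)"
    using t by (cases t) (simp_all add: prod.lessThan_Suc_shift del: prod.lessThan_Suc)
  have 2: "(\<Prod>c<t. 1 + q * fps_X ^ (g - c)) = (\<Prod>i\<in>{t - 1..<g}. 1 + q * fps_X ^ Suc i)"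
    by (rule prod.reindex_bij_witness[of _ "\<lambda>i. g - 1 - i" "\<lambda>c. g - 1 - c"])
       (use t t_le_g g in \<open>auto simp: Suc_diff_Suc simp flip: power_Suc\<close>)
  have set: "{..<g} = {..<t - 1} \<union> {t - 1..<g}" using t_le_g by auto
  have "(\<Prod>i<g. 1 + q * fps_X ^ Suc i) =
      (\<Prod>i<t - 1. 1 + q * fps_X ^ Suc i) * (\<Prod>i\<in>{t - 1..<g}. 1 + q * fps_X ^ Suc i)"
    unfolding set by (rule prod.union_disjoint) auto
  then show ?thesis by (simp only: prod.distrib 1 2 mult_ac)
qed

text \<open>With q = T^g, both sides are limits of the same partial products \<open>a\<close>,
  \<open>b\<close> and \<open>e\<close> of (q;q), (-q;q) and (-T;T).\<close>

lemma root_prod_xpt: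
  "(\<Prod>c<t. theta_class c) = 2 * (qprod fps_X ^ t * root_prod t xpt)"
proof -
  define q :: "complex fps" where "q = fps_X ^ g"
  define a where "a = (\<lambda>N. \<Prod>k<N. 1 - q ^ Suc k)"
  define b where "b = (\<lambda>N. \<Prod>k<N. 1 + q ^ Suc k)"
  define e :: "nat \<Rightarrow> complex fps" where "e = (\<lambda>N. \<Prod>k<N. 1 + fps_X ^ Suc k)"
  have dvd: "fps_X ^ j dvd q ^ Suc j" for j
  proof -
    have "j \<le> g * Suc j" using g_pos by (cases g) auto
    then show ?thesis unfolding q_def power_mult[symmetric] by (rule le_imp_power_dvd)
  qed
  have "\<exists>A. a \<longlonglongrightarrow> A" unfolding a_def
    by (rule exI, rule fps_prod_LIMSEQ) (use dvd in simp)
  then obtain A where A: "a \<longlonglongrightarrow> A" ..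
  have "\<exists>B. b \<longlonglongrightarrow> B" unfolding b_def
    by (rule exI, rule fps_prod_LIMSEQ) (use dvd in simp)
  then obtain B where B: "b \<longlonglongrightarrow> B" ..
  have "\<exists>E. e \<longlonglongrightarrow> E" unfolding e_def
    by (rule exI, rule fps_prod_LIMSEQ) simp
  then obtain E where E: "e \<longlonglongrightarrow> E" ..
  \<comment> \<open>The theta classes produce \<open>e\<close> in blocks of g factors, hence along
    the multiples of g.\<close>
  have "strict_mono (\<lambda>N. Suc N * g)"
    using g_pos by (simp add: strict_mono_def)
  from LIMSEQ_subseq_LIMSEQ[OF E this] have E': "(\<lambda>N. e (Suc N * g)) \<longlonglongrightarrow> E" by (simp add: o_def)
  have "(\<lambda>N. \<Prod>c<t. \<Prod>k<N. (1 - q ^ Suc k) * (1 + q ^ k * fps_X ^ c) * (1 + q ^ k * fps_X ^ (g - c)))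
      \<longlonglongrightarrow> (\<Prod>c<t. theta_class c)"
    using theta_class_LIMSEQ by (intro tendsto_prod_fps) (simp add: q_def)
  from LIMSEQ_Suc[OF this]
  have lim1: "(\<lambda>N. \<Prod>c<t. \<Prod>k<Suc N. (1 - q ^ Suc k) * (1 + q ^ k * fps_X ^ c) * (1 + q ^ k * fps_X ^ (g - c)))
      \<longlonglongrightarrow> (\<Prod>c<t. theta_class c)" .
  have "(\<Prod>c<t. \<Prod>k<Suc N. (1 - q ^ Suc k) * (1 + q ^ k * fps_X ^ c) * (1 + q ^ k * fps_X ^ (g - c))) =
      2 * (a (Suc N) ^ t * (b N * e (Suc N * g)))" for N
  proof -
    have "(\<Prod>c<t. \<Prod>k<Suc N. (1 - q ^ Suc k) * (1 + q ^ k * fps_X ^ c) * (1 + q ^ k * fps_X ^ (g - c))) =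
      (\<Prod>k<Suc N. \<Prod>c<t. (1 - q ^ Suc k) * ((1 + q ^ k * fps_X ^ c) * (1 + q ^ k * fps_X ^ (g - c))))"
      unfolding mult.assoc by (rule prod.swap)
    also have "\<dots> = (\<Prod>k<Suc N. (1 - q ^ Suc k) ^ t * ((1 + q ^ k) * (\<Prod>i<g. 1 + q ^ k * fps_X ^ Suc i)))"
      by (simp only: prod.distrib[where A = "{..<t}"] prod_constant card_lessThan class_factors[unfolded prod.distrib])
    also have "\<dots> = a (Suc N) ^ t * ((\<Prod>k<Suc N. 1 + q ^ k) * (\<Prod>k<Suc N. \<Prod>i<g. 1 + q ^ k * fps_X ^ Suc i))"
      by (simp only: prod.distrib prod_power_distrib a_def)
    \<comment> \<open>The factor 2 is 1 + q^0, from class 0.\<close>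
    also have "(\<Prod>k<Suc N. 1 + q ^ k) = 2 * b N"
      by (subst prod.lessThan_Suc_shift) (simp add: b_def)
    also have "(\<Prod>k<Suc N. \<Prod>i<g. 1 + q ^ k * fps_X ^ Suc i) =
        (\<Prod>k<Suc N. \<Prod>i\<in>{k * g..<k * g + g}. 1 + fps_X ^ Suc i)"
    proof (rule prod.cong[OF refl])
      fix k
      have "(\<Prod>i<g. 1 + q ^ k * fps_X ^ Suc i) = (\<Prod>i<g. 1 + fps_X ^ Suc (k * g + i))"
        by (intro prod.cong refl) (simp only: q_def power_mult[symmetric] power_add[symmetric] mult.commute[of g] add_Suc_right)
      also have "\<dots> = (\<Prod>i\<in>{k * g..<k * g + g}. 1 + fps_X ^ Suc i)"
        by (rule prod.reindex_bij_witness[of _ "\<lambda>i. i - k * g" "\<lambda>i. k * g + i"]) auto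
      finally show "(\<Prod>i<g. 1 + q ^ k * fps_X ^ Suc i) = (\<Prod>i\<in>{k * g..<k * g + g}. 1 + fps_X ^ Suc i)" .
    qed
    also have "\<dots> = e (Suc N * g)" unfolding e_def by (rule prod.nat_group)
    finally show ?thesis by (simp only: mult_ac)
  qed
  with lim1 have "(\<lambda>N. 2 * (a (Suc N) ^ t * (b N * e (Suc N * g)))) \<longlonglongrightarrow> (\<Prod>c<t. theta_class c)"
    by (simp only:)
  moreover have "(\<lambda>N. 2 * (a (Suc N) ^ t * (b N * e (Suc N * g)))) \<longlonglongrightarrow> 2 * (A ^ t * (B * E))"
    by (intro tendsto_mult_fps tendsto_power_fps tendsto_const LIMSEQ_Suc[OF A] B E')
  ultimately have th: "(\<Prod>c<t. theta_class c) = 2 * (A ^ t * (B * E))" by (rule LIMSEQ_unique)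
  have "(\<lambda>N. (\<Prod>k<N. 1 - fps_X * fps_X ^ k) ^ t * (\<Prod>r\<in>{..<t} \<times> {..<t}.
      (\<Prod>k<N. 1 - fps_X * fps_const (posroot xpt r) * fps_X ^ k) *
      (\<Prod>k<N. 1 - fps_X * fps_const (inverse (posroot xpt r)) * fps_X ^ k)))
    \<longlonglongrightarrow> qprod fps_X ^ t * root_prod t xpt"
    unfolding root_prod_def
    by (intro tendsto_mult_fps tendsto_power_fps tendsto_prod_fps qprod_LIMSEQ) auto
  moreover have "(\<Prod>k<N. 1 - fps_X * fps_X ^ k) ^ t * (\<Prod>r\<in>{..<t} \<times> {..<t}.
      (\<Prod>k<N. 1 - fps_X * fps_const (posroot xpt r) * fps_X ^ k) *
      (\<Prod>k<N. 1 - fps_X * fps_const (inverse (posroot xpt r)) * fps_X ^ k)) = a N ^ t * (b N * e N)" for N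
  proof -
    have "(\<Prod>r\<in>{..<t} \<times> {..<t}.
      (\<Prod>k<N. 1 - fps_X * fps_const (posroot xpt r) * fps_X ^ k) *
      (\<Prod>k<N. 1 - fps_X * fps_const (inverse (posroot xpt r)) * fps_X ^ k)) =
      (\<Prod>k<N. \<Prod>r\<in>{..<t} \<times> {..<t}. (1 - fps_const (posroot xpt r) * fps_X ^ Suc k) *
        (1 - fps_const (inverse (posroot xpt r)) * fps_X ^ Suc k))"
      unfolding prod.distrib[symmetric] by (subst prod.swap) (simp add: mult_ac)
    then have "(\<Prod>k<N. 1 - fps_X * fps_X ^ k) ^ t * (\<Prod>r\<in>{..<t} \<times> {..<t}.
      (\<Prod>k<N. 1 - fps_X * fps_const (posroot xpt r) * fps_X ^ k) *
      (\<Prod>k<N. 1 - fps_X * fps_const (inverse (posroot xpt r)) * fps_X ^ k)) =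
      (\<Prod>k<N. (1 - fps_X ^ Suc k) ^ t * (\<Prod>r\<in>{..<t} \<times> {..<t}. (1 - fps_const (posroot xpt r) * fps_X ^ Suc k) *
        (1 - fps_const (inverse (posroot xpt r)) * fps_X ^ Suc k)))"
      by (simp only: prod.distrib[where A = "{..<N}"] prod_power_distrib power_Suc)
    also have "\<dots> = (\<Prod>k<N. (1 + fps_X ^ Suc k) * (1 + q ^ Suc k) * (1 - q ^ Suc k) ^ t)"
      unfolding root_factors_xpt by (simp only: q_def power_mult[symmetric] mult.commute[of g])
    finally show ?thesis by (simp only: prod.distrib prod_power_distrib a_def b_def e_def mult_ac)
  qed
  ultimately have "(\<lambda>N. a N ^ t * (b N * e N)) \<longlonglongrightarrow> qprod fps_X ^ t * root_prod t xpt" by (simp only:)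
  moreover have "(\<lambda>N. a N ^ t * (b N * e N)) \<longlonglongrightarrow> A ^ t * (B * E)"
    by (intro tendsto_mult_fps tendsto_power_fps A B E)
  ultimately have "qprod fps_X ^ t * root_prod t xpt = A ^ t * (B * E)" by (rule LIMSEQ_unique)
  with th show ?thesis by simp
qed

lemma column_xpt:
  assumes "c < t"
  shows "column t c (xpt a) = fps_const (if c = 0 then 1 else xpt a powi int c + xpt a powi (- int c)) * theta_class c"
proof -
  have pw: "xpt a powi (int g * n + k) = msgn n * xpt a powi k" for n k
    by (simp only: power_int_add[OF disjI1[OF xpt_neq_0]] power_int_mult xpt_level)
       (simp add: msgn_def power_int_minus_left)
  show ?thesis
  proof (cases "c = 0")
    case True
    then show ?thesis
      using pw[of _ 0] by (simp add: column_0(1)[OF t, folded g] theta_class_def)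
  next
    case False
    have "xpt a powi (int g - (int g * n + int c)) = - (msgn n * xpt a powi (- int c))" for n
      using pw[of "1 - n" "- int c"] by (simp add: algebra_simps msgn_diff)
    then have "msgn n * (xpt a powi (int g * n + int c) - xpt a powi (int g - (int g * n + int c))) =
        (xpt a powi int c + xpt a powi (- int c)) * 1" for n
      unfolding pw by (simp add: algebra_simps flip: mult.assoc)
    then show ?thesis
      using False assms by (simp only: column_pos(1)[of c t, folded g] theta_class_def fsum_const_mult if_False)
  qed
qed

text \<open>At \<open>xpt\<close> the determinant is a scalar determinant times the product of all
  theta classes, a multiple of (T;T)^t \<open>root_prod\<close>. The product form of
  \<open>theta_prod\<close> has (T;T)^(t*t) instead, so the quotient is the power t * t - t.\<close>

lemma base_series_complex:
  "base_series t = fps_const (of_int (ccoeff t 0 int)) * (qprod fps_X ^ (t * t - t) :: complex fps)"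
proof -
  define D where "D = Determinant.det (mat t t (\<lambda>(a, c).
    if c = 0 then 1 else xpt a powi int c + xpt a powi (- int c)))"
  define c0 :: complex where "c0 = of_int (ccoeff t 0 int)"
  define Phi :: "complex fps" where "Phi = qprod fps_X"
  have det: "Determinant.det (mat t t (\<lambda>(a, c). column t c (xpt a))) = fps_const D * (\<Prod>c<t. theta_class c)"
  proof -
    have "Determinant.det (mat t t (\<lambda>(a, c). column t c (xpt a))) =
      (\<Sum>p\<in>{p. p permutes {0..<t}}. of_int (sign p) * (\<Prod>a<t. column t (p a) (xpt a)))"
      by (subst det_def'[of _ t])
         (auto simp: atLeast0LessThan intro!: sum.cong prod.cong dest: permutes_in_image)
    also have "\<dots> = (\<Sum>p\<in>{p. p permutes {0..<t}}. fps_const (of_int (sign p) *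
        (\<Prod>a<t. if p a = 0 then 1 else xpt a powi int (p a) + xpt a powi (- int (p a)))) *
        (\<Prod>c<t. theta_class c))"
    proof (intro sum.cong refl)
      fix p assume "p \<in> {p. p permutes {0..<t}}"
      then have p: "p permutes {..<t}" by (simp add: atLeast0LessThan)
      have "(\<Prod>a<t. theta_class (p a)) = (\<Prod>c<t. theta_class c)"
        by (rule prod.reindex_bij_betw[OF permutes_imp_bij[OF p]])
      moreover have "column t (p a) (xpt a) =
          fps_const (if p a = 0 then 1 else xpt a powi int (p a) + xpt a powi (- int (p a))) * theta_class (p a)"
        if "a \<in> {..<t}" for a
        using that permutes_in_image[OF p, of a] by (intro column_xpt) simp
      ultimately show "of_int (sign p) * (\<Prod>a<t. column t (p a) (xpt a)) = fps_const (of_int (sign p) *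
        (\<Prod>a<t. if p a = 0 then 1 else xpt a powi int (p a) + xpt a powi (- int (p a)))) *
        (\<Prod>c<t. theta_class c)"
        by (simp only: prod.distrib cong: prod.cong)
           (simp only: fps_const_mult[symmetric] fps_const_prod fps_of_int mult.assoc)
    qed
    also have "\<dots> = fps_const D * (\<Prod>c<t. theta_class c)"
    proof -
      have D: "D = (\<Sum>p\<in>{p. p permutes {0..<t}}. of_int (sign p) *
        (\<Prod>a<t. if p a = 0 then 1 else xpt a powi int (p a) + xpt a powi (- int (p a))))"
        unfolding D_def by (subst det_def'[of _ t])
          (auto simp: atLeast0LessThan intro!: sum.cong prod.cong dest: permutes_in_image)
      have "fps_const (\<Sum>p\<in>S. f p) = (\<Sum>p\<in>S. fps_const (f p :: complex))" for f :: "(nat \<Rightarrow> nat) \<Rightarrow> complex" and S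
        by (induction S rule: infinite_finite_induct) (simp_all flip: fps_const_add)
      then show ?thesis unfolding D by (simp only: sum_distrib_right)
    qed
    finally show ?thesis .
  qed
  have Phi0: "fps_nth Phi 0 = 1" "fps_nth (root_prod t xpt) 0 = 1"
    by (simp_all add: Phi_def qprod_nth_0 root_prod_nth_0)
  have det': "Determinant.det (mat t t (\<lambda>(a, c). column t c (xpt a))) =
      fps_const D * (2 * (Phi ^ t * root_prod t xpt))"
    unfolding det root_prod_xpt Phi_def ..
  \<comment> \<open>Comparing constant terms identifies the unevaluated determinant
    \<open>D\<close>; regularity of the point then shows that it can be cancelled.\<close>
  have "weyl_det t xpt = 2 * D"
    using det_columns_nth_0[of t xpt] unfolding det' by (simp add: Phi0 fps_nth_power_0 mult.commute)
  moreover have "weyl_const t xpt = c0 * weyl_det t xpt"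
    unfolding c0_def by (rule weyl_const_eq[OF t]) (rule xpt_neq_0)
  ultimately have wc: "weyl_const t xpt = c0 * (2 * D)" by simp
  then have D0: "D \<noteq> 0" using weyl_const_xpt by auto
  have "base_series t * (fps_const D * (2 * (Phi ^ t * root_prod t xpt))) =
      fps_const (c0 * (2 * D)) * (Phi ^ (t * t) * root_prod t xpt)"
  proof -
    have "theta_prod t xpt = base_series t * Determinant.det (mat t t (\<lambda>(a, c). column t c (xpt a)))"
      by (rule theta_prod_eq_det[OF t]) (rule xpt_neq_0)
    moreover have "theta_prod t xpt = fps_const (weyl_const t xpt) * (qprod fps_X ^ (t * t) * root_prod t xpt)"
      by (rule theta_prod_eq_qprod) (rule xpt_neq_0)
    ultimately show ?thesis unfolding det' wc Phi_def by (simp only:)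
  qed
  moreover have "fps_const (c0 * (2 * D)) = fps_const c0 * (2 * fps_const D)"
    by (simp add: fps_numeral_fps_const flip: fps_const_mult)
  moreover have "Phi ^ (t * t) = Phi ^ (t * t - t) * Phi ^ t"
    using t by (simp flip: power_add)
  ultimately have "base_series t * (2 * fps_const D * (Phi ^ t * root_prod t xpt)) =
      (fps_const c0 * Phi ^ (t * t - t)) * (2 * fps_const D * (Phi ^ t * root_prod t xpt))"
    by (simp only: mult_ac)
  moreover have "2 * fps_const D * (Phi ^ t * root_prod t xpt) \<noteq> 0"
    using D0 Phi0 by (auto simp del: fps_const_eq_0_iff simp: fps_const_eq_0_iff)
  ultimately show ?thesis
    unfolding c0_def Phi_def by (simp only: mult_cancel_right if_False) simp
qed

end

section \<open>The Macdonald identity\<close>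

definition fps_of_ints :: "int fps \<Rightarrow> 'a::comm_ring_1 fps" where
  "fps_of_ints f = Abs_fps (\<lambda>n. of_int (fps_nth f n))"

lemma fps_of_ints_nth [simp]: "fps_nth (fps_of_ints f) n = of_int (fps_nth f n)"
  by (simp add: fps_of_ints_def)

lemma fps_of_ints_mult: "fps_of_ints (f * h) = fps_of_ints f * fps_of_ints h"
  by (simp add: fps_eq_iff fps_mult_nth)

lemma fps_of_ints_simps [simp]: "fps_of_ints 1 = 1" "fps_of_ints fps_X = fps_X"
  "fps_of_ints (f - h) = fps_of_ints f - fps_of_ints h" "fps_of_ints (fps_const c) = fps_const (of_int c)"
  by (auto simp: fps_eq_iff)

lemma fps_of_ints_power: "fps_of_ints (f ^ n) = fps_of_ints f ^ n"
  by (induction n) (simp_all add: fps_of_ints_mult)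

lemma fps_of_ints_prod: "fps_of_ints (\<Prod>i\<in>I. f i) = (\<Prod>i\<in>I. fps_of_ints (f i))"
  by (induction I rule: infinite_finite_induct) (simp_all add: fps_of_ints_mult)

lemma fps_of_ints_qprod: "fps_of_ints (qprod fps_X) = (qprod fps_X :: 'a::comm_ring_1 fps)"
proof (rule LIMSEQ_unique)
  have lim: "(\<lambda>N. \<Prod>j<N. 1 - fps_X * fps_X ^ j :: int fps) \<longlonglongrightarrow> qprod fps_X"
    by (rule qprod_LIMSEQ) simp
  show "(\<lambda>N. fps_of_ints (\<Prod>j<N. 1 - fps_X * fps_X ^ j)) \<longlonglongrightarrow> (fps_of_ints (qprod fps_X) :: 'a fps)"
  proof (rule tendsto_fpsI)
    fix n
    have "\<forall>\<^sub>F N in sequentially. fps_nth (\<Prod>j<N. 1 - fps_X * fps_X ^ j :: int fps) n = fps_nth (qprod fps_X) n"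
      using lim unfolding tendsto_fps_iff by blast
    then show "\<forall>\<^sub>F N in sequentially. fps_nth (fps_of_ints (\<Prod>j<N. 1 - fps_X * fps_X ^ j)) n =
        fps_nth (fps_of_ints (qprod fps_X) :: 'a fps) n"
      by (rule eventually_mono) simp
  qed
  show "(\<lambda>N. fps_of_ints (\<Prod>j<N. 1 - fps_X * fps_X ^ j)) \<longlonglongrightarrow> (qprod fps_X :: 'a fps)"
    using qprod_LIMSEQ[of "fps_X :: 'a fps"]
    by (simp add: fps_of_ints_prod fps_of_ints_mult fps_of_ints_power)
qed

lemma fps_of_ints_base: "fps_of_ints (Abs_fps (\<lambda>k. ccoeff t (int k) int)) = base_series t"
  by (simp add: fps_eq_iff base_series_def)

text \<open>Both sides are images of integer series. The complex numbers have characteristic 0, so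
  the integer series themselves agree, and so do their images in any field.\<close>

lemma base_series_eq:
  assumes "0 < t"
  shows "base_series t = fps_const (of_int (ccoeff t 0 int)) * (qprod fps_X ^ (t * t - t) :: 'a::field fps)"
proof -
  define B where "B = Abs_fps (\<lambda>k. ccoeff t (int k) int)"
  define R :: "int fps" where "R = fps_const (ccoeff t 0 int) * qprod fps_X ^ (t * t - t)"
  note R_simps = R_def fps_of_ints_mult fps_of_ints_power fps_of_ints_qprod fps_of_ints_simps
  have "fps_of_ints B = (fps_of_ints R :: complex fps)"
    unfolding B_def fps_of_ints_base R_simps by (rule base_series_complex[OF assms refl])
  then have "B = R" by (simp add: fps_eq_iff)
  then have "fps_of_ints B = (fps_of_ints R :: 'a fps)" by simp
  then show ?thesis unfolding B_def fps_of_ints_base R_simps .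
qed

text \<open>A nonzero Weyl denominator at \<open>x\<close> forces the image of
  \<open>ccoeff t 0 int\<close> in the field to be nonzero, so the base series cancels.\<close>

theorem macdonald_determinant:
  fixes x :: "nat \<Rightarrow> 'a::field"
  assumes t: "0 < t" and x: "\<And>a. a < t \<Longrightarrow> x a \<noteq> 0" and nz: "weyl_const t x \<noteq> 0"
  shows "qprod fps_X ^ t * root_prod t x * fps_const (weyl_det t x) =
    Determinant.det (mat t t (\<lambda>(a, c). column t c (x a)))"
proof -
  define c0 :: 'a where "c0 = of_int (ccoeff t 0 int)"
  define P where "P = (qprod fps_X :: 'a fps)"
  let ?D = "Determinant.det (mat t t (\<lambda>(a, c). column t c (x a)))"
  have wc: "weyl_const t x = c0 * weyl_det t x"
    unfolding c0_def by (rule weyl_const_eq[OF t]) (rule x)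
  then have c0: "c0 \<noteq> 0" using nz by auto
  have "P \<noteq> 0" using qprod_nth_0[of "fps_X :: 'a fps"] by (auto simp: P_def)
  have "theta_prod t x = base_series t * ?D"
    by (rule theta_prod_eq_det[OF t]) (rule x)
  moreover have "theta_prod t x = fps_const (weyl_const t x) * (P ^ (t * t) * root_prod t x)"
    unfolding P_def by (rule theta_prod_eq_qprod) (rule x)
  moreover have "P ^ (t * t) = P ^ (t * t - t) * P ^ t" using t by (simp flip: power_add)
  moreover have "base_series t = fps_const c0 * P ^ (t * t - t)"
    unfolding c0_def P_def by (rule base_series_eq[OF t])
  ultimately have "(fps_const c0 * P ^ (t * t - t)) * (P ^ t * root_prod t x * fps_const (weyl_det t x)) =
      (fps_const c0 * P ^ (t * t - t)) * ?D"
    by (simp only: wc fps_const_mult[symmetric] mult_ac)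
  moreover have "fps_const c0 * P ^ (t * t - t) \<noteq> 0" using c0 \<open>P \<noteq> 0\<close> by simp
  ultimately show ?thesis unfolding P_def by (simp only: mult_cancel_left if_False) simp
qed

section \<open>Expansion of the determinant\<close>

text \<open>The numerator of an odd orthogonal character up to a monomial, with exponents normalised
  so that reflecting one of them by y -> g - y negates its column.\<close>

definition alt_det :: "nat \<Rightarrow> (nat \<Rightarrow> 'a::field) \<Rightarrow> (nat \<Rightarrow> int) \<Rightarrow> 'a" where
  "alt_det t x y = Determinant.det (mat t t (\<lambda>(a, c). x a powi y c - x a powi (int (2 * t - 1) - y c)))"

lemma weyl_det_eq: "weyl_det t x = alt_det t x int"
  by (simp add: weyl_det_def alt_det_def)

text \<open>The Leibniz formula indexed by columns: the summation index \<open>n c\<close> of the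
  expansion belongs to a column.\<close>

lemma det_mat_columns:
  fixes M :: "nat \<Rightarrow> nat \<Rightarrow> 'a::comm_ring_1"
  shows "Determinant.det (mat t t (\<lambda>(a, c). M a c)) =
    (\<Sum>p\<in>{p. p permutes {..<t}}. of_int (sign p) * (\<Prod>c<t. M (inv_into UNIV p c) c))"
proof -
  have "Determinant.det (mat t t (\<lambda>(a, c). M a c)) =
    (\<Sum>p\<in>{p. p permutes {..<t}}. of_int (sign p) * (\<Prod>a<t. M a (p a)))"
    by (subst det_def'[of _ t])
       (auto simp: atLeast0LessThan intro!: sum.cong prod.cong dest: permutes_in_image)
  also have "(\<Prod>a<t. M a (p a)) = (\<Prod>c<t. M (inv_into UNIV p c) c)" if "p permutes {..<t}" for p
    using prod.reindex_bij_betw[OF permutes_imp_bij[OF that], of "\<lambda>c. M (inv_into UNIV p c) c"]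
    by (simp add: permutes_inverses[OF that])
  then have "(\<Sum>p\<in>{p. p permutes {..<t}}. of_int (sign p) * (\<Prod>a<t. M a (p a))) =
    (\<Sum>p\<in>{p. p permutes {..<t}}. of_int (sign p) * (\<Prod>c<t. M (inv_into UNIV p c) c))"
    by (intro sum.cong refl) simp
  finally show ?thesis .
qed

lemma det_scale_columns:
  fixes M :: "nat \<Rightarrow> nat \<Rightarrow> 'a::comm_ring_1"
  shows "Determinant.det (mat t t (\<lambda>(a, c). d c * M a c)) =
    (\<Prod>c<t. d c) * Determinant.det (mat t t (\<lambda>(a, c). M a c))"
  unfolding det_mat_columns[of t "\<lambda>a c. d c * M a c"] det_mat_columns[of t M]
  by (simp add: prod.distrib sum_distrib_left mult_ac)

lemma det_scale_rows:
  fixes M :: "nat \<Rightarrow> nat \<Rightarrow> 'a::comm_ring_1"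
  shows "Determinant.det (mat t t (\<lambda>(a, c). d a * M a c)) =
    (\<Prod>a<t. d a) * Determinant.det (mat t t (\<lambda>(a, c). M a c))"
proof -
  have "(\<Prod>c<t. d (inv_into UNIV p c)) = (\<Prod>a<t. d a)" if "p permutes {..<t}" for p
    by (rule prod.reindex_bij_betw[OF permutes_imp_bij[OF permutes_inv[OF that]]])
  then show ?thesis
    unfolding det_mat_columns[of t "\<lambda>a c. d a * M a c"] det_mat_columns[of t M]
    by (simp add: prod.distrib sum_distrib_left mult_ac)
qed

lemma det_permute_columns':
  fixes M :: "nat \<Rightarrow> nat \<Rightarrow> 'a::comm_ring_1"
  assumes \<sigma>: "\<sigma> permutes {..<t}"
  shows "Determinant.det (mat t t (\<lambda>(a, c). M a (\<sigma> c))) =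
    of_int (sign \<sigma>) * Determinant.det (mat t t (\<lambda>(a, c). M a c))"
proof -
  have lt: "\<sigma> c < t" if "c < t" for c using permutes_in_image[OF \<sigma>, of c] that by simp
  let ?A = "mat t t (\<lambda>(c, a). M a c)"
  have "Determinant.det (mat t t (\<lambda>(a, c). M a (\<sigma> c))) =
      Determinant.det (transpose_mat (mat t t (\<lambda>(a, c). M a (\<sigma> c))))"
    by (rule det_transpose[symmetric, of _ t]) simp
  also have "transpose_mat (mat t t (\<lambda>(a, c). M a (\<sigma> c))) = mat t t (\<lambda>(i, j). ?A $$ (\<sigma> i, j))"
    by (rule eq_matI) (auto simp: lt)
  also have "Determinant.det \<dots> = of_int (sign \<sigma>) * Determinant.det ?A"
    by (rule det_permute_rows) (use \<sigma> in \<open>auto simp: atLeast0LessThan\<close>)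
  also have "Determinant.det ?A = Determinant.det (transpose_mat ?A)"
    by (rule det_transpose[symmetric, of _ t]) simp
  also have "transpose_mat ?A = mat t t (\<lambda>(a, c). M a c)"
    by (rule eq_matI) auto
  finally show ?thesis .
qed

lemma alt_det_permute:
  "\<sigma> permutes {..<t} \<Longrightarrow> alt_det t x (\<lambda>c. y (\<sigma> c)) = of_int (sign \<sigma>) * alt_det t x y"
  unfolding alt_det_def by (rule det_permute_columns')

lemma alt_det_cong:
  assumes "\<And>c. c < t \<Longrightarrow> y c = z c"
  shows "alt_det t x y = alt_det t x z"
  unfolding alt_det_def by (intro arg_cong[of _ _ Determinant.det] eq_matI) (auto simp: assms)

lemma alt_det_flip:
  fixes x :: "nat \<Rightarrow> 'a::field"
  assumes "\<And>c. c < t \<Longrightarrow> (z c = y c \<and> d c = 1) \<or> (z c = int (2 * t - 1) - y c \<and> d c = - 1)"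
  shows "alt_det t x z = (\<Prod>c<t. d c) * alt_det t x y"
proof -
  have "alt_det t x z = Determinant.det (mat t t (\<lambda>(a, c). d c *
      (x a powi y c - x a powi (int (2 * t - 1) - y c))))"
    unfolding alt_det_def
    by (intro arg_cong[of _ _ Determinant.det] eq_matI) (use assms in \<open>force+\<close>)
  then show ?thesis unfolding alt_det_def by (simp only: det_scale_columns)
qed

definition level_exp :: "nat \<Rightarrow> (nat \<Rightarrow> int) \<Rightarrow> nat \<Rightarrow> int" where
  "level_exp g n c = int g * n c + int c"

text \<open>One integer per column; for \<open>c > 0\<close>, \<open>n c\<close> later marks where
  the beads of residue \<open>c\<close> end, and \<open>n 0\<close> is the height of the
  rectangle.\<close>

definition charges :: "nat \<Rightarrow> (nat \<Rightarrow> int) set" where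
  "charges t = PiE {..<t} class_range"

lemma fsum_sum:
  assumes "finite_fibres I w"
  shows "(\<Sum>p\<in>P. fsum I w (A p)) = fsum I w (\<lambda>i. \<Sum>p\<in>P. A p i)"
  by (rule fps_ext) (simp add: fps_sum_nth fsum_nth sum.swap[of _ P])

lemma det_columns_expand:
  fixes x :: "nat \<Rightarrow> 'a::field"
  shows "Determinant.det (mat t t (\<lambda>(a, c). column t c (x a))) =
    fsum (charges t) (\<lambda>n. \<Sum>c<t. en1 t (level_exp (2 * t - 1) n c))
      (\<lambda>n. (\<Prod>c<t. msgn (n c)) * alt_det t x (level_exp (2 * t - 1) n))"
    and "finite_fibres (charges t) (\<lambda>n. \<Sum>c<t. en1 t (level_exp (2 * t - 1) n c))"
proof -
  let ?g = "int (2 * t - 1)" and ?E = "\<lambda>n. \<Sum>c<t. en1 t (level_exp (2 * t - 1) n c)"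
  let ?h = "\<lambda>z n c. z powi (?g * n + int c) - z powi (?g - (?g * n + int c)) :: 'a"
  have prod: "finite_fibres (PiE {..<t} class_range) (\<lambda>n. \<Sum>c<t. en1 t (?g * n c + int c)) \<and>
    (\<Prod>c<t. fsum (class_range c) (\<lambda>n. en1 t (?g * n + int c)) (\<lambda>n. msgn n * ?h (z c) n c)) =
    fsum (PiE {..<t} class_range) (\<lambda>n. \<Sum>c<t. en1 t (?g * n c + int c))
      (\<lambda>n. \<Prod>c<t. msgn (n c) * ?h (z c) (n c) c)" for z :: "nat \<Rightarrow> 'a"
    by (rule fsum_prod) (simp, rule column_eq(2), simp)
  then show fin: "finite_fibres (charges t) ?E"
    by (simp add: charges_def level_exp_def)
  have prod': "(\<Prod>c<t. column t c (z c)) = fsum (charges t) ?E (\<lambda>n. (\<Prod>c<t. msgn (n c)) * (\<Prod>c<t. ?h (z c) (n c) c))"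
    for z :: "nat \<Rightarrow> 'a"
    using prod[of z] by (simp add: column_eq(1) charges_def level_exp_def prod.distrib)
  have "Determinant.det (mat t t (\<lambda>(a, c). column t c (x a))) =
    (\<Sum>p\<in>{p. p permutes {..<t}}. fsum (charges t) ?E (\<lambda>n. (\<Prod>c<t. msgn (n c)) *
      (of_int (sign p) * (\<Prod>c<t. ?h (x (inv_into UNIV p c)) (n c) c))))"
    unfolding det_mat_columns prod' fps_of_int[symmetric] fsum_const_mult by (simp only: mult_ac)
  also have "\<dots> = fsum (charges t) ?E (\<lambda>n. (\<Prod>c<t. msgn (n c)) * alt_det t x (level_exp (2 * t - 1) n))"
    unfolding fsum_sum[OF fin]
    unfolding alt_det_def det_mat_columns level_exp_def sum_distrib_left ..
  finally show "Determinant.det (mat t t (\<lambda>(a, c). column t c (x a))) =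
    fsum (charges t) ?E (\<lambda>n. (\<Prod>c<t. msgn (n c)) * alt_det t x (level_exp (2 * t - 1) n))" .
qed

section \<open>Odd orthogonal characters\<close>

abbreviation Xs :: "nat \<Rightarrow> laurent fract" where "Xs a \<equiv> X (Suc a)"

lemma X_neq_0: "X i \<noteq> 0"
  by (simp add: X_def)

definition lmon :: "(nat \<Rightarrow>\<^sub>0 int) \<Rightarrow> laurent fract" where
  "lmon m = to_fract (Poly_Mapping.single m 1)"

lemma lmon_add: "lmon (m + n) = lmon m * lmon n"
  by (simp add: lmon_def mult_single flip: to_fract_mult)

lemma lmon_0: "lmon 0 = 1"
  by (simp add: lmon_def)

lemma single_1_eq_iff:
  "Poly_Mapping.single m (1::'b::zero_neq_one) = Poly_Mapping.single n 1 \<longleftrightarrow> m = n"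
  by (metis lookup_single_eq lookup_single_not_eq zero_neq_one)

lemma lmon_eq_iff: "lmon m = lmon n \<longleftrightarrow> m = n"
  by (simp add: lmon_def single_1_eq_iff)

lemma X_eq_lmon: "X i = lmon (Poly_Mapping.single i 1)"
  by (simp add: X_def lmon_def)

lemma X_mult_eq: "X i * X j = lmon (Poly_Mapping.single i 1 + Poly_Mapping.single j 1)"
  by (simp add: X_eq_lmon lmon_add)

text \<open>A positive root is a monomial with nonzero exponent vector, and distinct monomials are
  distinct elements of the field.\<close>

lemma posroot_X_neq_1:
  assumes "r \<in> {..<t} \<times> {..<t}"
  shows "posroot Xs r \<noteq> 1"
proof -
  obtain i j where r: "r = (i, j)" by (cases r)
  have single: "Poly_Mapping.lookup (Poly_Mapping.single k (1::int)) l = (if k = l then 1 else 0)" for k l :: nat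
    by (simp add: lookup_single when_def)
  consider "i < j" | "j < i" | "i = j" by linarith
  then show ?thesis
  proof cases
    case 1
    have "Xs i \<noteq> Xs j" using 1 by (simp add: X_eq_lmon lmon_eq_iff single_1_eq_iff)
    then show ?thesis using 1 X_neq_0[of "Suc j"] by (simp add: r posroot_def)
  next
    case 2
    have "Poly_Mapping.lookup (Poly_Mapping.single (Suc i) (1::int) + Poly_Mapping.single (Suc j) 1) (Suc i) \<noteq> 0"
      using 2 by (simp add: lookup_add single)
    then have "Poly_Mapping.single (Suc i) (1::int) + Poly_Mapping.single (Suc j) 1 \<noteq> 0"
      by (metis lookup_zero)
    then have "Xs i * Xs j \<noteq> 1" by (simp only: X_mult_eq lmon_0[symmetric] lmon_eq_iff) simp
    then show ?thesis using 2 by (simp add: r posroot_def)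
  next
    case 3
    have "Poly_Mapping.lookup (Poly_Mapping.single (Suc i) (1::int)) (Suc i) \<noteq> 0" by (simp add: single)
    then have "Poly_Mapping.single (Suc i) (1::int) \<noteq> 0" by (metis lookup_zero)
    then have "Xs i \<noteq> 1" by (simp only: X_eq_lmon lmon_0[symmetric] lmon_eq_iff) simp
    then show ?thesis using 3 by (simp add: r posroot_def)
  qed
qed

lemma weyl_const_X: "weyl_const t Xs \<noteq> 0"
  using posroot_X_neq_1 by (auto simp: weyl_const_def X_neq_0)

lemma weyl_det_X: "0 < t \<Longrightarrow> weyl_det t Xs \<noteq> 0"
  using weyl_const_X[of t] weyl_const_eq[of t Xs] X_neq_0 by auto

text \<open>Extracting x_a^(1 - t) from row \<open>a\<close> brings numerator and denominator into
  the form \<open>alt_det\<close>, and these monomials cancel in the quotient.\<close>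

lemma so_char_eq_alt_det:
  assumes t: "0 < t"
  shows "so_char t mu = alt_det t Xs (\<lambda>b. mu (Suc b) + int (2 * t) - int (Suc b)) / (msgn (int t) * weyl_det t Xs)"
proof -
  have num: "Determinant.det (mat t t (\<lambda>(a, b). let i = Suc a; j = Suc b in
       X i powi (nu j + int t - int j + 1) - X i powi (- (nu j + int t - int j)))) =
    (\<Prod>a<t. Xs a powi (1 - int t)) * alt_det t Xs (\<lambda>b. nu (Suc b) + int (2 * t) - int (Suc b))" for nu
  proof -
    have entry: "X (Suc a) powi (nu (Suc b) + int t - int (Suc b) + 1) - X (Suc a) powi (- (nu (Suc b) + int t - int (Suc b))) =
      Xs a powi (1 - int t) * (Xs a powi (nu (Suc b) + int (2 * t) - int (Suc b)) -
        Xs a powi (int (2 * t - 1) - (nu (Suc b) + int (2 * t) - int (Suc b))))" for a b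
      unfolding right_diff_distrib power_int_add[OF disjI1[OF X_neq_0], symmetric]
      using t by (simp add: algebra_simps of_nat_diff)
    show ?thesis
      unfolding alt_det_def det_scale_rows[symmetric]
      by (intro arg_cong[of _ _ Determinant.det] cong_mat refl) (simp only: entry split Let_def)
  qed
  have "so_char t mu = ((\<Prod>a<t. Xs a powi (1 - int t)) * alt_det t Xs (\<lambda>b. mu (Suc b) + int (2 * t) - int (Suc b))) /
     ((\<Prod>a<t. Xs a powi (1 - int t)) * alt_det t Xs (\<lambda>b. 0 + int (2 * t) - int (Suc b)))"
    unfolding so_char_def num[of mu] num[of "\<lambda>_. 0", symmetric] by simp
  \<comment> \<open>For \<open>mu = 0\<close> the exponents are g - b, so all t columns are
    reflected; hence the sign (-1)^t.\<close>
  also have "alt_det t Xs (\<lambda>b. 0 + int (2 * t) - int (Suc b)) = (\<Prod>c<t. - 1) * alt_det t Xs int"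
    by (rule alt_det_flip) (use t in auto)
  also have "(\<Prod>c<t. - 1 :: laurent fract) = msgn (int t)" by (simp add: msgn_def)
  finally show ?thesis
    by (simp add: weyl_det_eq X_neq_0)
qed

section \<open>Beads of a partition\<close>

definition bead :: "nat list \<Rightarrow> nat \<Rightarrow> int" where
  "bead lam i = int (part lam i) - int i"

definition beads :: "nat list \<Rightarrow> int set" where
  "beads lam = {k. \<exists>i\<ge>1. k = bead lam i}"

lemma word_eq_0_iff: "word lam k = 0 \<longleftrightarrow> k \<in> beads lam"
  by (simp add: word_def beads_def bead_def)

lemma word_eq_iff: "word lam k = word lam' k' \<longleftrightarrow> (k \<in> beads lam \<longleftrightarrow> k' \<in> beads lam')"
  unfolding word_def beads_def bead_def by auto

lemma part_antimono:
  assumes "is_partition lam" "1 \<le> i" "i \<le> j"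
  shows "part lam j \<le> part lam i"
proof (cases "j \<le> length lam \<and> i < j")
  case True
  then have "lam ! (i - 1) \<ge> lam ! (j - 1)"
    using assms by (auto simp: is_partition_def sorted_wrt_iff_nth_less)
  then show ?thesis using True assms by (simp add: part_def)
qed (use assms in \<open>auto simp: part_def\<close>)

lemma part_pos_iff:
  assumes "is_partition lam" "1 \<le> i"
  shows "0 < part lam i \<longleftrightarrow> i \<le> length lam"
proof (cases "i \<le> length lam")
  case True
  then have "lam ! (i - 1) \<in> set lam" using assms by (intro nth_mem) auto
  then have "lam ! (i - 1) \<noteq> 0" using assms(1) by (metis is_partition_def)
  then show ?thesis using assms True by (simp add: part_def)
qed (simp add: part_def)

lemma partition_eqI:
  assumes "is_partition lam" "is_partition mu" "\<And>i. 1 \<le> i \<Longrightarrow> part lam i = part mu i"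
  shows "lam = mu"
proof (rule nth_equalityI)
  have "i \<le> length lam \<longleftrightarrow> i \<le> length mu" if "1 \<le> i" for i
    using part_pos_iff[OF assms(1) that] part_pos_iff[OF assms(2) that] assms(3)[OF that] by simp
  from this[of "length lam"] this[of "length mu"] show len: "length lam = length mu"
    by (cases "length lam = 0"; cases "length mu = 0") auto
  fix i assume "i < length lam"
  then show "lam ! i = mu ! i" using assms(3)[of "Suc i"] len by (simp add: part_def)
qed

lemma bead_strict:
  assumes "is_partition lam" "1 \<le> i" "i < j"
  shows "bead lam j < bead lam i"
  using part_antimono[of lam i j] assms by (simp add: bead_def)

lemma bead_eq_iff:
  assumes "is_partition lam" "1 \<le> i" "1 \<le> j"
  shows "bead lam i = bead lam j \<longleftrightarrow> i = j"
  using bead_strict[of lam i j] bead_strict[of lam j i] assms by (cases i j rule: linorder_cases) auto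

text \<open>A strictly decreasing sequence lists its range from the top, so the range determines
  it.\<close>

lemma decreasing_range_unique:
  fixes a b :: "nat \<Rightarrow> int"
  assumes a: "\<And>i j. i < j \<Longrightarrow> a j < a i" and b: "\<And>i j. i < j \<Longrightarrow> b j < b i"
    and range: "range a = range b"
  shows "a i = b i"
proof (induction i rule: less_induct)
  case (less i)
  have le: "a i \<le> b i" if a: "\<And>i j. i < j \<Longrightarrow> a j < a i" and b: "\<And>i j. i < j \<Longrightarrow> b j < b i"
    and range: "range a = range b" and IH: "\<And>j. j < i \<Longrightarrow> a j = b j" for a b :: "nat \<Rightarrow> int"
  proof -
    obtain k where k: "a i = b k" using range by (metis rangeE rangeI)
    have "\<not> k < i" using IH[of k] a[of k i] k by auto
    then show ?thesis using b[of i k] k by (cases "k = i") auto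
  qed
  show ?case
    using le[of a b] le[of b a] a b range less.IH by (metis antisym)
qed

lemma beads_eq_range: "beads lam = range (\<lambda>i. bead lam (Suc i))"
proof (intro equalityI subsetI)
  fix k assume "k \<in> beads lam"
  then obtain i where "1 \<le> i" "k = bead lam i" by (auto simp: beads_def)
  then show "k \<in> range (\<lambda>i. bead lam (Suc i))" by (intro image_eqI[of _ _ "i - 1"]) auto
qed (auto simp: beads_def)

text \<open>The uniqueness behind the quotient, which is specified only up to a shift of its
  word.\<close>

lemma beads_shift_unique:
  assumes "is_partition lam" "is_partition mu" "\<And>k. k \<in> beads lam \<longleftrightarrow> k + s \<in> beads mu"
  shows "s = 0 \<and> lam = mu"
proof -
  have eq: "bead lam (Suc i) + s = bead mu (Suc i)" for i
  proof (rule decreasing_range_unique[of "\<lambda>i. bead lam (Suc i) + s" "\<lambda>i. bead mu (Suc i)" i])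
    show "range (\<lambda>i. bead lam (Suc i) + s) = range (\<lambda>i. bead mu (Suc i))"
    proof (intro equalityI subsetI)
      fix k assume "k \<in> range (\<lambda>i. bead lam (Suc i) + s)"
      then show "k \<in> range (\<lambda>i. bead mu (Suc i))"
        using assms(3)[of "k - s"] unfolding beads_eq_range by auto
    next
      fix k assume "k \<in> range (\<lambda>i. bead mu (Suc i))"
      then have "k - s \<in> beads lam" using assms(3)[of "k - s"] unfolding beads_eq_range by auto
      then obtain i where "k - s = bead lam (Suc i)" unfolding beads_eq_range by auto
      then show "k \<in> range (\<lambda>i. bead lam (Suc i) + s)" by (intro image_eqI[of _ _ i]) auto
    qed
  qed (use assms bead_strict in auto)
  \<comment> \<open>Beyond both lengths the i-th bead is \<open>- i\<close> on either side, which
    leaves no room for a shift.\<close>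
  have "part lam (Suc (max (length lam) (length mu))) = 0" "part mu (Suc (max (length lam) (length mu))) = 0"
    by (simp_all add: part_def)
  with eq[of "max (length lam) (length mu)"] have s: "s = 0" by (simp add: bead_def)
  have "part lam i = part mu i" if "1 \<le> i" for i
    using eq[of "i - 1"] s that by (simp add: bead_def)
  then show ?thesis using s partition_eqI[OF assms(1,2)] by blast
qed

lemma beads_inj:
  "is_partition lam \<Longrightarrow> is_partition mu \<Longrightarrow> beads lam = beads mu \<Longrightarrow> lam = mu"
  using beads_shift_unique[of lam mu 0] by simp

text \<open>Existence: a set that is full below, empty far up and has a gap at \<open>B + 1\<close>
  is a shifted bead set. The stated shift restores the normalisation that there are as many
  nonnegative beads as negative gaps.\<close>

lemma partition_of_beads:
  assumes low: "\<And>k. k \<le> B \<Longrightarrow> k \<in> M" and gap: "B + 1 \<notin> M" and fin: "finite {k \<in> M. B < k}"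
  obtains lam where "is_partition lam"
    "\<And>k. k \<in> beads lam \<longleftrightarrow> k + (B + 1 + int (card {k \<in> M. B < k})) \<in> M"
proof -
  define F where "F = {k \<in> M. B < k}"
  define ls where "ls = rev (sorted_list_of_set F)"
  define L where "L = length ls"
  have finF: "finite F" using fin by (simp add: F_def)
  have set: "set ls = F" using finF by (simp add: ls_def)
  have card: "card F = L" using finF by (simp add: L_def ls_def)
  have "sorted_wrt (>) ls"
    unfolding ls_def sorted_wrt_rev by (rule strict_sorted_list_of_set)
  then have dec: "ls ! j < ls ! i" if "i < j" "j < L" for i j
    using that by (auto simp: sorted_wrt_iff_nth_less L_def)
  have gap_le: "ls ! j + (int j - int i) \<le> ls ! i" if "i \<le> j" "j < L" for i j
    using that
  proof (induction j rule: dec_induct)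
    case (step j)
    then show ?case using dec[of j "Suc j"] by simp
  qed simp
  have low_le: "B + int (L - i) < ls ! i" if "i < L" for i
  proof -
    have "ls ! (L - 1) \<in> F" using that set[symmetric] L_def by simp
    then have "B + 2 \<le> ls ! (L - 1)" using gap unfolding F_def by (cases "ls ! (L - 1) = B + 1") auto
    moreover have "i \<le> L - 1" "L - 1 < L" using that by auto
    ultimately show ?thesis using gap_le[of i "L - 1"] that by (simp add: of_nat_diff)
  qed
  \<comment> \<open>The part belonging to a bead counts the gaps below it; the gap at
    \<open>B + 1\<close> makes every part positive.\<close>
  define lam where "lam = map (\<lambda>i. nat (ls ! i - B - int (L - i))) [0..<L]"
  have part: "int (part lam (Suc i)) = (if i < L then ls ! i - B - int (L - i) else 0)" for i
    using low_le[of i] by (cases "i < L") (simp_all add: part_def lam_def)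
  have "sorted_wrt (\<ge>) lam"
    unfolding sorted_wrt_iff_nth_less
  proof (intro allI impI)
    fix i j assume "i < j" "j < length lam"
    then show "lam ! i \<ge> lam ! j"
      using gap_le[of i j] by (simp add: lam_def of_nat_diff)
  qed
  moreover have "0 \<notin> set lam"
  proof
    assume "0 \<in> set lam"
    then obtain i where "i < L" "nat (ls ! i - B - int (L - i)) = 0" by (auto simp: lam_def)
    then show False using low_le[of i] by simp
  qed
  ultimately have "is_partition lam" by (simp add: is_partition_def)
  moreover have "k \<in> beads lam \<longleftrightarrow> k + (B + 1 + int L) \<in> M" for k
  proof -
    have b: "bead lam (Suc i) = (if i < L then ls ! i - (B + 1 + int L) else - int (Suc i))" for i
      unfolding bead_def part by simp
    show ?thesis
    proof
      assume "k \<in> beads lam"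
      then obtain i where i: "k = bead lam (Suc i)" unfolding beads_eq_range by auto
      show "k + (B + 1 + int L) \<in> M"
      proof (cases "i < L")
        case True
        then have "ls ! i \<in> F" using set[symmetric] L_def by simp
        then show ?thesis using True i b by (simp add: F_def)
      next
        case False
        then show ?thesis using i b by (intro low) simp
      qed
    next
      assume M: "k + (B + 1 + int L) \<in> M"
      show "k \<in> beads lam"
      proof (cases "k + (B + 1 + int L) \<le> B")
        case True
        then have "k = bead lam (Suc (nat (- k - 1)))" unfolding b by auto
        then show ?thesis unfolding beads_eq_range by blast
      next
        case False
        then have "k + (B + 1 + int L) \<in> set ls" using M set by (simp add: F_def)
        then obtain i where "i < L" "ls ! i = k + (B + 1 + int L)"
          unfolding L_def in_set_conv_nth by auto
        then have "k = bead lam (Suc i)" unfolding b by simp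
        then show ?thesis unfolding beads_eq_range by blast
      qed
    qed
  qed
  ultimately show thesis using that card unfolding F_def by blast
qed

section \<open>Conjugation\<close>

definition col_len :: "nat list \<Rightarrow> nat \<Rightarrow> nat" where
  "col_len lam j = card {i. (i, j) \<in> boxes lam}"

lemma down_closed_eq:
  assumes "finite D" "\<And>i j. i \<in> D \<Longrightarrow> 1 \<le> j \<Longrightarrow> j \<le> i \<Longrightarrow> j \<in> D" "\<And>i. i \<in> D \<Longrightarrow> 1 \<le> i"
  shows "D = {1..card D}"
proof (cases "D = {}")
  case False
  define m where "m = Max D"
  have m: "m \<in> D" "\<And>i. i \<in> D \<Longrightarrow> i \<le> m" using assms(1) False by (auto simp: m_def)
  have "D = {1..m}"
  proof (intro equalityI subsetI)
    fix i assume "i \<in> D"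
    then show "i \<in> {1..m}" using m(2) assms(3) by simp
  next
    fix i assume "i \<in> {1..m}"
    then show "i \<in> D" using assms(2)[OF m(1), of i] by simp
  qed
  then show ?thesis by simp
qed simp

lemma boxes_iff: "(i, j) \<in> boxes lam \<longleftrightarrow> 1 \<le> i \<and> 1 \<le> j \<and> j \<le> part lam i"
  by (simp add: boxes_def)

lemma part_0_beyond: "length lam < i \<Longrightarrow> part lam i = 0"
  by (simp add: part_def)

lemma le_part_iff:
  assumes "is_partition lam" "1 \<le> i" "1 \<le> j"
  shows "j \<le> part lam i \<longleftrightarrow> i \<le> col_len lam j"
proof -
  let ?D = "{i. (i, j) \<in> boxes lam}"
  have "?D = {1..card ?D}"
  proof (rule down_closed_eq)
    have "?D \<subseteq> {..length lam}"
    proof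
      fix i assume "i \<in> ?D"
      then show "i \<in> {..length lam}"
        using part_0_beyond[of lam i] assms(3) by (cases "length lam < i") (auto simp: boxes_iff)
    qed
    then show "finite ?D" using finite_subset by blast
    show "j' \<in> ?D" if "i \<in> ?D" "1 \<le> j'" "j' \<le> i" for i j'
      using that part_antimono[OF assms(1) that(2,3)] by (auto simp: boxes_iff)
  qed (auto simp: boxes_iff)
  then have "i \<in> ?D \<longleftrightarrow> i \<in> {1..card ?D}" by (simp only:)
  then show ?thesis using assms by (simp add: boxes_iff col_len_def)
qed

lemma part_conj:
  assumes "is_partition lam" "1 \<le> j"
  shows "part (conj_partition lam) j = col_len lam j"
proof (cases "j \<le> part lam 1")
  case False
  have "\<not> 1 \<le> col_len lam j" using False le_part_iff[OF assms(1) _ assms(2), of 1] by simp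
  then show ?thesis using False by (simp add: part_def conj_partition_def)
next
  case True
  then have "[1..<Suc (part lam 1)] ! (j - 1) = j" using assms by (subst nth_upt) auto
  then show ?thesis using True assms
    unfolding part_def[of "conj_partition lam"]
    by (simp add: conj_partition_def col_len_def del: upt_Suc)
qed

lemma col_antimono:
  assumes "is_partition lam" "1 \<le> i" "i \<le> j"
  shows "col_len lam j \<le> col_len lam i"
proof (cases "col_len lam j = 0")
  case False
  then have "j \<le> part lam (col_len lam j)" using assms by (subst le_part_iff) auto
  then have "i \<le> part lam (col_len lam j)" using assms by simp
  then show ?thesis using assms False by (subst (asm) le_part_iff) auto
qed simp

lemma is_partition_conj:
  assumes "is_partition lam"
  shows "is_partition (conj_partition lam)"
proof -
  have nth: "conj_partition lam ! j = col_len lam (Suc j)" if "j < part lam 1" for j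
    using that by (simp add: conj_partition_def col_len_def del: upt_Suc)
  have len: "length (conj_partition lam) = part lam 1" by (simp add: conj_partition_def)
  have "sorted_wrt (\<ge>) (conj_partition lam)"
    unfolding sorted_wrt_iff_nth_less len using col_antimono[OF assms] by (auto simp: nth)
  moreover have "col_len lam (Suc j) \<noteq> 0" if "j < part lam 1" for j
    using le_part_iff[OF assms, of 1 "Suc j"] that by simp
  then have "0 \<notin> set (conj_partition lam)"
    by (auto simp: in_set_conv_nth len nth)
  ultimately show ?thesis by (simp add: is_partition_def)
qed

text \<open>The gaps are the horizontal border steps, one for each column. For the converse, the
  column of a gap \<open>k\<close> ends just above the first row \<open>i0\<close> whose bead lies
  below \<open>k\<close>.\<close>

lemma not_in_beads_iff:
  assumes "is_partition lam"
  shows "k \<notin> beads lam \<longleftrightarrow> (\<exists>j\<ge>1. k = int j - 1 - int (col_len lam j))"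
proof
  assume "\<exists>j\<ge>1. k = int j - 1 - int (col_len lam j)"
  then obtain j where j: "1 \<le> j" "k = int j - 1 - int (col_len lam j)" by blast
  show "k \<notin> beads lam"
  proof
    assume "k \<in> beads lam"
    then obtain i where i: "1 \<le> i" "k = int (part lam i) - int i" by (auto simp: beads_def bead_def)
    show False using le_part_iff[OF assms i(1) j(1)] i j by linarith
  qed
next
  assume k: "k \<notin> beads lam"
  define i0 where "i0 = (LEAST i. 1 \<le> i \<and> bead lam i < k)"
  have "\<exists>i. 1 \<le> i \<and> bead lam i < k"
  proof (intro exI conjI)
    let ?i = "Suc (length lam) + nat (- k)"
    show "bead lam ?i < k" by (simp add: bead_def part_def)
  qed simp
  from LeastI_ex[OF this] have i0: "1 \<le> i0" "bead lam i0 < k" by (auto simp: i0_def)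
  have below: "k < bead lam i" if "1 \<le> i" "i < i0" for i
  proof -
    have "\<not> bead lam i < k" using not_less_Least[of i "\<lambda>i. 1 \<le> i \<and> bead lam i < k"] that by (simp add: i0_def)
    moreover have "bead lam i \<noteq> k" using k that by (auto simp: beads_def)
    ultimately show ?thesis by simp
  qed
  define j where "j = nat (k + int i0)"
  have j: "int j = k + int i0" "1 \<le> j" using i0 by (auto simp: j_def bead_def)
  have iff: "i \<le> col_len lam j \<longleftrightarrow> i < i0" if "1 \<le> i" for i
  proof -
    have "j \<le> part lam i \<longleftrightarrow> i < i0"
    proof (cases "i < i0")
      case True
      have "k < bead lam (i0 - 1)" using True that by (intro below) auto
      then have "j \<le> part lam (i0 - 1)" using j True by (simp add: bead_def of_nat_diff)
      also have "\<dots> \<le> part lam i" using True that by (intro part_antimono assms) auto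
      finally show ?thesis using True by simp
    next
      case False
      then have "part lam i \<le> part lam i0" using i0 by (intro part_antimono assms) auto
      also have "\<dots> < j" using i0 j by (simp add: bead_def)
      finally show ?thesis using False by simp
    qed
    then show ?thesis using le_part_iff[OF assms that j(2)] by simp
  qed
  have "i0 - 1 \<le> col_len lam j"
    using iff[of "i0 - 1"] i0 by (cases "i0 = 1") simp_all
  moreover have "\<not> i0 \<le> col_len lam j" using iff[of i0] i0 by simp
  ultimately have "col_len lam j = i0 - 1" by simp
  then show "\<exists>j\<ge>1. k = int j - 1 - int (col_len lam j)"
    using i0 j by (intro exI[of _ j]) (simp add: of_nat_diff)
qed

lemma beads_conj_iff:
  assumes "is_partition lam"
  shows "k \<in> beads (conj_partition lam) \<longleftrightarrow> - 1 - k \<notin> beads lam"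
proof -
  have "k \<in> beads (conj_partition lam) \<longleftrightarrow> (\<exists>j\<ge>1. k = int (col_len lam j) - int j)"
    by (simp add: beads_def bead_def part_conj[OF assms] cong: conj_cong)
  also have "\<dots> \<longleftrightarrow> (\<exists>j\<ge>1. - 1 - k = int j - 1 - int (col_len lam j))"
    by (rule ex_cong1) auto
  finally show ?thesis unfolding not_in_beads_iff[OF assms] .
qed

lemma conj_conj:
  assumes "is_partition lam"
  shows "conj_partition (conj_partition lam) = lam"
proof (rule beads_inj)
  show "beads (conj_partition (conj_partition lam)) = beads lam"
    by (rule Set.set_eqI) (simp add: beads_conj_iff is_partition_conj assms)
qed (simp_all add: is_partition_conj assms)

section \<open>Doubled distinct partitions\<close>

lemma le_durfee_iff:
  assumes "is_partition lam" "1 \<le> i"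
  shows "i \<le> durfee lam \<longleftrightarrow> i \<le> part lam i"
proof -
  let ?D = "{s. 1 \<le> s \<and> s \<le> part lam s}"
  have "?D \<subseteq> {..length lam}"
  proof
    fix i assume "i \<in> ?D"
    then show "i \<in> {..length lam}" using part_0_beyond[of lam i] by (cases "length lam < i") auto
  qed
  then have fin: "finite ?D" using finite_subset by blast
  have D: "?D = {1..card ?D}"
  proof (rule down_closed_eq[OF fin])
    show "j \<in> ?D" if "i \<in> ?D" "1 \<le> j" "j \<le> i" for i j
      using that part_antimono[OF assms(1) that(2,3)] by auto
  qed auto
  have "durfee lam = Max (insert 0 {1..card ?D})" unfolding durfee_def using D by simp
  also have "insert 0 {1..card ?D} = {0..card ?D}" by auto
  also have "Max {0..card ?D} = card ?D" by (rule Max_eqI) auto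
  finally have "durfee lam = card ?D" .
  moreover have "i \<in> ?D \<longleftrightarrow> i \<in> {1..card ?D}" using D by (simp only:)
  ultimately show ?thesis using assms(2) by simp
qed

text \<open>The condition on row and column \<open>i\<close> says that the i-th bead is the negative
  of the gap of column \<open>i\<close>. Up to the Durfee size these are the nonnegative beads and
  the negative gaps.\<close>

lemma DD_iff:
  "lam \<in> DD \<longleftrightarrow> is_partition lam \<and> 0 \<notin> beads lam \<and> (\<forall>k. k \<noteq> 0 \<longrightarrow> (k \<in> beads lam \<longleftrightarrow> - k \<notin> beads lam))"
proof (cases "is_partition lam")
  case p: True
  have DD: "lam \<in> DD \<longleftrightarrow> (\<forall>i\<ge>1. i \<le> part lam i \<longrightarrow> part lam i = col_len lam i + 1)"
    using p by (auto simp: DD_def le_durfee_iff part_conj)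
  show ?thesis
  proof
    assume "lam \<in> DD"
    then have eq: "part lam i = col_len lam i + 1" if "1 \<le> i" "i \<le> part lam i" for i
      using that DD by blast
    have 1: "- k \<notin> beads lam" if k: "0 \<le> k" "k \<in> beads lam" for k
    proof -
      obtain i where i: "1 \<le> i" "k = int (part lam i) - int i" using k by (auto simp: beads_def bead_def)
      then have "part lam i = col_len lam i + 1" using k by (intro eq) auto
      then show ?thesis unfolding not_in_beads_iff[OF p] using i by (intro exI[of _ i]) simp
    qed
    have 2: "- k \<in> beads lam" if k: "k < 0" "k \<notin> beads lam" for k
    proof -
      obtain j where j: "1 \<le> j" "k = int j - 1 - int (col_len lam j)"
        using k not_in_beads_iff[OF p] by blast
      then have "j \<le> part lam j" using le_part_iff[OF p j(1) j(1)] k by simp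
      then have "part lam j = col_len lam j + 1" using j by (intro eq) auto
      then show ?thesis using j by (auto simp: beads_def bead_def intro!: exI[of _ j])
    qed
    have "0 \<notin> beads lam" using 1[of 0] by auto
    moreover have "k \<in> beads lam \<longleftrightarrow> - k \<notin> beads lam" if "k \<noteq> 0" for k
      using 1[of k] 2[of k] 1[of "- k"] 2[of "- k"] that by (cases "k > 0") auto
    ultimately show "is_partition lam \<and> 0 \<notin> beads lam \<and> (\<forall>k. k \<noteq> 0 \<longrightarrow> (k \<in> beads lam \<longleftrightarrow> - k \<notin> beads lam))"
      using p by blast
  next
    assume asm: "is_partition lam \<and> 0 \<notin> beads lam \<and> (\<forall>k. k \<noteq> 0 \<longrightarrow> (k \<in> beads lam \<longleftrightarrow> - k \<notin> beads lam))"
    then have z: "0 \<notin> beads lam" and sym: "k \<in> beads lam \<longleftrightarrow> - k \<notin> beads lam" if "k \<noteq> 0" for k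
      using that by blast+
    have "part lam i = col_len lam i + 1" if "1 \<le> i" "i \<le> part lam i" for i
      using that
    proof (induction i rule: less_induct)
      case (less i)
      have IH: "part lam m = col_len lam m + 1" if "1 \<le> m" "m < i" for m
        using less.IH[of m] that part_antimono[OF p, of m i] less.prems by auto
      have coli: "i \<le> col_len lam i" using le_part_iff[OF p, of i i] less.prems by simp
      \<comment> \<open>\<open>b\<close> is the gap of column \<open>i\<close>; its mirror image is
        a bead, say the m-th. By induction the earlier rows are already matched with their columns,
        so m < i is impossible. If i < m, the mirror image of bead \<open>i\<close> would be a gap
        of a column for which no place is left.\<close>
      define b where "b = int i - 1 - int (col_len lam i)"
      have "b \<notin> beads lam" unfolding not_in_beads_iff[OF p] b_def using less.prems by blast
      moreover have "b < 0" using coli by (simp add: b_def)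
      ultimately have "- b \<in> beads lam" using sym[of b] by auto
      then obtain m where m: "1 \<le> m" "- b = bead lam m" by (auto simp: beads_def)
      have "\<not> m < i"
      proof
        assume "m < i"
        then have "bead lam m = int (col_len lam m) + 1 - int m" using IH[of m] m by (simp add: bead_def)
        then show False using m \<open>m < i\<close> col_antimono[OF p, of m i] by (simp add: b_def)
      qed
      moreover have "\<not> i < m"
      proof
        assume "i < m"
        then have lt: "- b < bead lam i" using bead_strict[OF p less.prems(1)] m by simp
        have "bead lam i \<in> beads lam" using less.prems by (auto simp: beads_def)
        moreover have "bead lam i \<noteq> 0" using calculation asm by metis
        ultimately have "- bead lam i \<notin> beads lam" using sym[of "bead lam i"] by blast
        then obtain j where j: "1 \<le> j" "- bead lam i = int j - 1 - int (col_len lam j)"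
          using not_in_beads_iff[OF p] by blast
        show False
        proof (cases "j < i")
          case True
          then have "bead lam i = bead lam j" using IH[of j] j by (simp add: bead_def)
          then show False using bead_strict[OF p j(1) True] by simp
        next
          case False
          then have "col_len lam j \<le> col_len lam i" using less.prems by (intro col_antimono[OF p]) auto
          then show False using False j lt by (simp add: b_def)
        qed
      qed
      ultimately have "m = i" by simp
      then show ?case using m by (simp add: b_def bead_def)
    qed
    then show "lam \<in> DD" using DD by blast
  qed
qed (simp add: DD_def)

text \<open>Shifting the beads by one makes the symmetry of a partition in \<open>DD_conj\<close> a reflection at 0.\<close>

definition cbeads :: "nat list \<Rightarrow> int set" where
  "cbeads lam = {k. k - 1 \<in> beads lam}"

definition reflective :: "int set \<Rightarrow> bool" where
  "reflective T \<longleftrightarrow> 0 \<in> T \<and> (\<forall>k. k \<noteq> 0 \<longrightarrow> (k \<in> T \<longleftrightarrow> - k \<notin> T))"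

lemma cbeads_conj_iff:
  "is_partition lam \<Longrightarrow> k \<in> cbeads (conj_partition lam) \<longleftrightarrow> - k \<notin> beads lam"
  by (simp add: cbeads_def beads_conj_iff)

lemma reflectiveD: "reflective T \<Longrightarrow> k \<noteq> 0 \<Longrightarrow> k \<in> T \<longleftrightarrow> - k \<notin> T"
  unfolding reflective_def by blast

lemma reflective_0: "reflective T \<Longrightarrow> 0 \<in> T"
  by (simp add: reflective_def)

lemma DD_conj_iff: "lam \<in> DD_conj \<longleftrightarrow> is_partition lam \<and> reflective (cbeads lam)"
proof
  assume "lam \<in> DD_conj"
  then obtain kap where kap: "kap \<in> DD" "lam = conj_partition kap" by (auto simp: DD_conj_def)
  then have p: "is_partition kap" by (simp add: DD_def)
  have cb: "k \<in> cbeads lam \<longleftrightarrow> - k \<notin> beads kap" for k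
    using cbeads_conj_iff[OF p] kap(2) by simp
  have z: "0 \<notin> beads kap" and sym: "k \<noteq> 0 \<Longrightarrow> k \<in> beads kap \<longleftrightarrow> - k \<notin> beads kap" for k
    using kap(1) unfolding DD_iff by blast+
  have "reflective (cbeads lam)"
    unfolding reflective_def
  proof (intro conjI allI impI)
    show "0 \<in> cbeads lam" using cb[of 0] z by simp
    show "k \<in> cbeads lam \<longleftrightarrow> - k \<notin> cbeads lam" if "k \<noteq> 0" for k
      unfolding cb using sym[OF that] by simp
  qed
  then show "is_partition lam \<and> reflective (cbeads lam)"
    using is_partition_conj[OF p] kap(2) by simp
next
  assume asm: "is_partition lam \<and> reflective (cbeads lam)"
  then have p: "is_partition lam" and r: "reflective (cbeads lam)" by auto
  have b: "k \<in> beads (conj_partition lam) \<longleftrightarrow> - k \<notin> cbeads lam" for k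
  proof -
    have "- 1 - k = - k - 1" by simp
    then show ?thesis unfolding beads_conj_iff[OF p] cbeads_def mem_Collect_eq by (simp only: not_not)
  qed
  have "conj_partition lam \<in> DD"
    unfolding DD_iff
  proof (intro conjI allI impI)
    show "0 \<notin> beads (conj_partition lam)" using b[of 0] reflective_0[OF r] by simp
    show "k \<in> beads (conj_partition lam) \<longleftrightarrow> - k \<notin> beads (conj_partition lam)" if "k \<noteq> 0" for k
      unfolding b using reflectiveD[OF r that] by simp
  qed (rule is_partition_conj[OF p])
  moreover have "lam = conj_partition (conj_partition lam)" using p by (simp add: conj_conj)
  ultimately show "lam \<in> DD_conj" unfolding DD_conj_def by blast
qed

lemma DD_conj_col:
  assumes "lam \<in> DD_conj" "1 \<le> i" "i \<le> part lam i"
  shows "col_len lam i = part lam i + 1"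
proof -
  obtain kap where kap: "kap \<in> DD" "lam = conj_partition kap" using assms by (auto simp: DD_conj_def)
  then have p: "is_partition kap" by (simp add: DD_def)
  have pl: "part lam i = col_len kap i" using part_conj[OF p assms(2)] kap by simp
  have "col_len lam i = part (conj_partition lam) i"
    using part_conj[of lam i] assms kap is_partition_conj[OF p] by simp
  then have cl: "col_len lam i = part kap i" using conj_conj[OF p] kap by simp
  have "i \<le> part kap i" using le_part_iff[OF p assms(2) assms(2)] assms(3) pl by simp
  then have "part kap i = part (conj_partition kap) i + 1"
    using kap(1) le_durfee_iff[OF p assms(2)] assms(2) by (simp add: DD_def)
  then show ?thesis using cl kap by simp
qed

section \<open>Sizes and hooks in terms of beads\<close>

lemma beads_bounded_below:
  assumes "is_partition lam" "k \<le> - int (length lam) - 1"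
  shows "k \<in> beads lam"
proof -
  have "k = bead lam (nat (- k))" using assms(2) part_0_beyond[of lam "nat (- k)"] by (simp add: bead_def)
  then show ?thesis using assms(2) by (auto simp: beads_def intro!: exI[of _ "nat (- k)"])
qed

lemma beads_le_part:
  assumes "is_partition lam" "k \<in> beads lam"
  shows "k < int (part lam 1)"
proof -
  obtain i where "1 \<le> i" "k = bead lam i" using assms by (auto simp: beads_def)
  then show ?thesis using part_antimono[OF assms(1), of 1 i] by (simp add: bead_def)
qed

lemma finite_pos_beads:
  assumes "is_partition lam"
  shows "finite {k \<in> beads lam. c \<le> k}" "finite {k. k \<notin> beads lam \<and> k \<le> c}"
proof -
  have "{k \<in> beads lam. c \<le> k} \<subseteq> {c..int (part lam 1)}"
    using beads_le_part[OF assms] by force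
  then show "finite {k \<in> beads lam. c \<le> k}" using finite_subset by blast
  have "{k. k \<notin> beads lam \<and> k \<le> c} \<subseteq> {- int (length lam)..c}"
    using beads_bounded_below[OF assms] by force
  then show "finite {k. k \<notin> beads lam \<and> k \<le> c}" using finite_subset by blast
qed

text \<open>The size is the total displacement of the beads from those of the empty partition, which
  are the negative integers.\<close>

lemma size_eq_beads:
  assumes "is_partition lam"
  shows "int (sum_list lam) = (\<Sum>k\<in>{k \<in> beads lam. 0 \<le> k}. k) - (\<Sum>k\<in>{k. k \<notin> beads lam \<and> k < 0}. k)"
proof -
  define N where "N = length lam"
  let ?neg = "{- int N..-1}" and ?pos = "{k \<in> beads lam. 0 \<le> k}"
  have "int (sum_list lam) = (\<Sum>i<N. int (part lam (Suc i)))"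
    by (simp add: sum_list_sum_nth N_def part_def atLeast0LessThan)
  also have "\<dots> = (\<Sum>i<N. bead lam (Suc i)) + (\<Sum>i<N. int (Suc i))"
    by (simp add: bead_def flip: sum.distrib)
  also have "(\<Sum>i<N. bead lam (Suc i)) = (\<Sum>k\<in>{k \<in> beads lam. - int N \<le> k}. k)"
  proof (rule sum.reindex_bij_betw)
    have "inj_on (\<lambda>i. bead lam (Suc i)) {..<N}"
      using bead_eq_iff[OF assms] by (auto simp: inj_on_def)
    moreover have "(\<lambda>i. bead lam (Suc i)) ` {..<N} = {k \<in> beads lam. - int N \<le> k}"
    proof (intro equalityI subsetI)
      fix k assume "k \<in> {k \<in> beads lam. - int N \<le> k}"
      then obtain i where i: "k = bead lam (Suc i)" "- int N \<le> k" unfolding beads_eq_range by auto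
      then have "i < N" by (cases "i < N") (auto simp: bead_def part_def N_def)
      then show "k \<in> (\<lambda>i. bead lam (Suc i)) ` {..<N}" using i by auto
    qed (auto simp: beads_eq_range bead_def)
    ultimately show "bij_betw (\<lambda>i. bead lam (Suc i)) {..<N} {k \<in> beads lam. - int N \<le> k}"
      by (simp add: bij_betw_def)
  qed
  also have "{k \<in> beads lam. - int N \<le> k} = ?pos \<union> (?neg \<inter> beads lam)" by auto
  also have "(\<Sum>k\<in>?pos \<union> (?neg \<inter> beads lam). k) = (\<Sum>k\<in>?pos. k) + (\<Sum>k\<in>?neg \<inter> beads lam. k)"
    using finite_pos_beads[OF assms] by (intro sum.union_disjoint) auto
  also have "(\<Sum>i<N. int (Suc i)) = - (\<Sum>k\<in>?neg. k)"
  proof -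
    have "(\<Sum>i<N. int (Suc i)) = (\<Sum>k\<in>?neg. - k)"
      by (rule sum.reindex_bij_witness[of _ "\<lambda>k. nat (- k) - 1" "\<lambda>i. - int (Suc i)"]) auto
    then show ?thesis by (simp add: sum_negf)
  qed
  also have "(\<Sum>k\<in>?neg. k) = (\<Sum>k\<in>?neg \<inter> beads lam. k) + (\<Sum>k\<in>?neg - beads lam. k)"
    by (metis finite_atLeastAtMost_int sum.Int_Diff)
  also have "?neg - beads lam = {k. k \<notin> beads lam \<and> k < 0}"
    using beads_bounded_below[OF assms] by (force simp: N_def)
  finally show ?thesis by simp
qed

definition pos_cbeads :: "nat list \<Rightarrow> int set" where
  "pos_cbeads lam = {s \<in> cbeads lam. 0 < s}"

text \<open>A positive \<open>s\<close> in \<open>cbeads lam\<close> stands for a bead at s - 1 and,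
  by reflection, a gap at - s - 1; together they contribute 2 s.\<close>

lemma size_DD_conj:
  assumes "lam \<in> DD_conj"
  shows "int (sum_list lam) = 2 * (\<Sum>s\<in>pos_cbeads lam. s)" and "finite (pos_cbeads lam)"
proof -
  have p: "is_partition lam" and r: "reflective (cbeads lam)" using assms by (auto simp: DD_conj_iff)
  have b1: "bij_betw (\<lambda>s. s - 1) (pos_cbeads lam) {k \<in> beads lam. 0 \<le> k}"
    by (rule bij_betwI[of _ _ _ "\<lambda>k. k + 1"]) (auto simp: pos_cbeads_def cbeads_def)
  have b2: "bij_betw (\<lambda>s. - s - 1) (pos_cbeads lam) {k. k \<notin> beads lam \<and> k < 0}"
  proof (rule bij_betwI[of _ _ _ "\<lambda>k. - k - 1"])
    show "(\<lambda>s. - s - 1) \<in> pos_cbeads lam \<rightarrow> {k. k \<notin> beads lam \<and> k < 0}"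
    proof clarify
      fix s assume "s \<in> pos_cbeads lam"
      then have s: "s \<in> cbeads lam" "0 < s" by (auto simp: pos_cbeads_def)
      then have "- s \<notin> cbeads lam" using reflectiveD[OF r, of s] by simp
      then show "- s - 1 \<notin> beads lam \<and> - s - 1 < 0" using s by (simp add: cbeads_def)
    qed
    show "(\<lambda>k. - k - 1) \<in> {k. k \<notin> beads lam \<and> k < 0} \<rightarrow> pos_cbeads lam"
    proof clarify
      fix k assume k: "k \<notin> beads lam" "k < 0"
      then have "k + 1 \<notin> cbeads lam" by (simp add: cbeads_def)
      moreover have nz: "k + 1 \<noteq> 0" using calculation reflective_0[OF r] by metis
      ultimately have "- (k + 1) \<in> cbeads lam" using reflectiveD[OF r nz] by blast
      moreover have "0 < - (k + 1)" using k nz by simp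
      ultimately show "- k - 1 \<in> pos_cbeads lam" by (simp add: pos_cbeads_def)
    qed
  qed auto
  show fin: "finite (pos_cbeads lam)"
    using bij_betw_finite[OF b1] finite_pos_beads(1)[OF p] by simp
  show "int (sum_list lam) = 2 * (\<Sum>s\<in>pos_cbeads lam. s)"
    unfolding size_eq_beads[OF p] sum.reindex_bij_betw[OF b1, symmetric] sum.reindex_bij_betw[OF b2, symmetric]
    by (simp add: sum_subtractf sum_negf)
qed

lemma durfee_eq_card:
  assumes "is_partition lam"
  shows "durfee lam = card (pos_cbeads lam)"
proof -
  have "bij_betw (\<lambda>i. bead lam i + 1) {1..durfee lam} (pos_cbeads lam)"
    unfolding bij_betw_def
  proof
    show "inj_on (\<lambda>i. bead lam i + 1) {1..durfee lam}"
      using bead_eq_iff[OF assms] by (auto simp: inj_on_def)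
    show "(\<lambda>i. bead lam i + 1) ` {1..durfee lam} = pos_cbeads lam"
    proof (intro equalityI subsetI)
      fix s assume "s \<in> (\<lambda>i. bead lam i + 1) ` {1..durfee lam}"
      then show "s \<in> pos_cbeads lam"
        using le_durfee_iff[OF assms] by (auto simp: pos_cbeads_def cbeads_def beads_def bead_def)
    next
      fix s assume "s \<in> pos_cbeads lam"
      then obtain i where i: "1 \<le> i" "s = bead lam i + 1" "0 < s"
        by (auto simp: pos_cbeads_def cbeads_def beads_def)
      then have "i \<le> durfee lam" using le_durfee_iff[OF assms i(1)] by (simp add: bead_def)
      then show "s \<in> (\<lambda>i. bead lam i + 1) ` {1..durfee lam}" using i by auto
    qed
  qed
  from bij_betw_same_card[OF this] show ?thesis by simp
qed

lemma hook_eq: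
  assumes "is_partition lam" "(i, j) \<in> boxes lam"
  shows "int (hook lam (i, j)) = (bead lam i + 1) + (int (col_len lam j) - int j)"
proof -
  have ij: "1 \<le> i" "1 \<le> j" "j \<le> part lam i" using assms by (auto simp: boxes_iff)
  have icol: "i \<le> col_len lam j" using le_part_iff[OF assms(1) ij(1,2)] ij by simp
  have "{(a, b) \<in> boxes lam. (a = fst (i, j) \<and> snd (i, j) \<le> b) \<or> (b = snd (i, j) \<and> fst (i, j) \<le> a)} =
      {i} \<times> {j..part lam i} \<union> {Suc i..col_len lam j} \<times> {j}"
  proof (intro equalityI subsetI)
    fix q assume "q \<in> {(a, b) \<in> boxes lam. (a = fst (i, j) \<and> snd (i, j) \<le> b) \<or> (b = snd (i, j) \<and> fst (i, j) \<le> a)}"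
    then obtain a b where q: "q = (a, b)" "(a, b) \<in> boxes lam" "a = i \<and> j \<le> b \<or> b = j \<and> i \<le> a" by auto
    then show "q \<in> {i} \<times> {j..part lam i} \<union> {Suc i..col_len lam j} \<times> {j}"
      using le_part_iff[OF assms(1), of a j] ij by (auto simp: boxes_iff)
  next
    fix q assume "q \<in> {i} \<times> {j..part lam i} \<union> {Suc i..col_len lam j} \<times> {j}"
    then obtain a b where q: "q = (a, b)" "a = i \<and> j \<le> b \<and> b \<le> part lam i \<or> Suc i \<le> a \<and> a \<le> col_len lam j \<and> b = j"
      by auto
    then show "q \<in> {(a, b) \<in> boxes lam. (a = fst (i, j) \<and> snd (i, j) \<le> b) \<or> (b = snd (i, j) \<and> fst (i, j) \<le> a)}"
      using le_part_iff[OF assms(1), of a j] ij by (auto simp: boxes_iff)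
  qed
  then have "hook lam (i, j) = card ({i} \<times> {j..part lam i} \<union> {Suc i..col_len lam j} \<times> {j})"
    by (simp add: hook_def)
  also have "\<dots> = card ({i} \<times> {j..part lam i}) + card ({Suc i..col_len lam j} \<times> {j})"
    by (rule card_Un_disjoint) auto
  finally show ?thesis using ij icol by (simp add: card_cartesian_product bead_def of_nat_diff)
qed

text \<open>Rows range over all elements of the set but columns only over the nonzero ones, hence
  the condition on \<open>b\<close>. Diagonal boxes become the pairs with
  \<open>a = b\<close>.\<close>

definition hook_pairs :: "nat \<Rightarrow> int set \<Rightarrow> (int \<times> int) set" where
  "hook_pairs g T = {(a, b). a \<in> T \<and> b \<in> T \<and> b \<noteq> 0 \<and> b \<le> a \<and> 0 < a + b \<and> a + b < int g}"

text \<open>Row \<open>i\<close> and column \<open>j\<close> of a box correspond to two elements of \<open>cbeads lam\<close> whose sum is the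
  hook length; the box is above or on the diagonal iff the row element is not the smaller one.\<close>

lemma hooks_bij:
  assumes "lam \<in> DD_conj"
  shows "bij_betw (\<lambda>(i, j). (bead lam i + 1, int (col_len lam j) - int j)) (hooks_lt_plus g lam) (hook_pairs g (cbeads lam))"
    and "(i, j) \<in> boxes lam \<Longrightarrow> bead lam i + 1 = int (col_len lam j) - int j \<longleftrightarrow> i = j"
proof -
  have p: "is_partition lam" and r: "reflective (cbeads lam)" using assms by (auto simp: DD_conj_iff)
  define b where "b j = int (col_len lam j) - int j" for j
  define a where "a i = bead lam i + 1" for i
  have b_dec: "b j < b i" if "1 \<le> i" "i < j" for i j
    using col_antimono[OF p, of i j] that by (simp add: b_def)
  have a_dec: "a j < a i" if "1 \<le> i" "i < j" for i j
    using bead_strict[OF p that] by (simp add: a_def)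
  have diag: "a i = b i" if "1 \<le> i" "i \<le> part lam i" for i
    using DD_conj_col[OF assms that] by (simp add: a_def b_def bead_def)
  \<comment> \<open>\<open>a\<close> and \<open>b\<close> agree on the diagonal, so the two values
    of a box are compared through the diagonal box with the smaller of its indices.\<close>
  have cmp: "(b j \<le> a i \<longleftrightarrow> i \<le> j) \<and> (a i = b j \<longleftrightarrow> i = j)" if "(i, j) \<in> boxes lam" for i j
  proof -
    have ij: "1 \<le> i" "1 \<le> j" "j \<le> part lam i" "i \<le> col_len lam j"
      using that le_part_iff[OF p, of i j] by (auto simp: boxes_iff)
    consider "i = j" | "i < j" | "j < i" by linarith
    then show ?thesis
    proof cases
      case 1
      then show ?thesis using diag[of i] ij by simp
    next
      case 2
      then show ?thesis using diag[of i] b_dec[of i j] ij by simp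
    next
      case 3
      have "j \<le> col_len lam j" using 3 ij by simp
      then have "j \<le> part lam j" using le_part_iff[OF p ij(2) ij(2)] by simp
      then show ?thesis using diag[of j] a_dec[of j i] 3 ij by simp
    qed
  qed
  show "bead lam i + 1 = int (col_len lam j) - int j \<longleftrightarrow> i = j" if "(i, j) \<in> boxes lam"
    using cmp[OF that] by (simp add: a_def b_def)
  have aT: "k \<in> cbeads lam \<longleftrightarrow> (\<exists>i\<ge>1. k = a i)" for k
    unfolding cbeads_def beads_def a_def by force
  have bT: "k \<in> cbeads lam \<and> k \<noteq> 0 \<longleftrightarrow> (\<exists>j\<ge>1. k = b j)" for k
  proof -
    have "k \<in> cbeads lam \<and> k \<noteq> 0 \<longleftrightarrow> - k \<notin> cbeads lam"
      using reflectiveD[OF r, of k] reflective_0[OF r] by (cases "k = 0") auto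
    also have "\<dots> \<longleftrightarrow> - k - 1 \<notin> beads lam" by (simp add: cbeads_def)
    also have "\<dots> \<longleftrightarrow> (\<exists>j\<ge>1. k = b j)"
      unfolding not_in_beads_iff[OF p] b_def by force
    finally show ?thesis .
  qed
  have hook: "int (hook lam (i, j)) = a i + b j" if "(i, j) \<in> boxes lam" for i j
    using hook_eq[OF p that] by (simp add: a_def b_def)
  have box: "(i, j) \<in> boxes lam \<longleftrightarrow> 0 < a i + b j" if "1 \<le> i" "1 \<le> j" for i j
    using le_part_iff[OF p that] that by (auto simp: boxes_iff a_def b_def bead_def)
  have "bij_betw (\<lambda>(i, j). (a i, b j)) (hooks_lt_plus g lam) (hook_pairs g (cbeads lam))"
    unfolding bij_betw_def
  proof
    have "a i = a i' \<Longrightarrow> i = i'" if "1 \<le> i" "1 \<le> i'" for i i'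
      using a_dec[of i i'] a_dec[of i' i] that by (cases i i' rule: linorder_cases) auto
    moreover have "b i = b i' \<Longrightarrow> i = i'" if "1 \<le> i" "1 \<le> i'" for i i'
      using b_dec[of i i'] b_dec[of i' i] that by (cases i i' rule: linorder_cases) auto
    ultimately show "inj_on (\<lambda>(i, j). (a i, b j)) (hooks_lt_plus g lam)"
      by (auto simp: inj_on_def hooks_lt_plus_def boxes_iff)
    show "(\<lambda>(i, j). (a i, b j)) ` hooks_lt_plus g lam = hook_pairs g (cbeads lam)"
    proof (intro equalityI subsetI)
      fix q assume "q \<in> (\<lambda>(i, j). (a i, b j)) ` hooks_lt_plus g lam"
      then obtain i j where ij: "q = (a i, b j)" "(i, j) \<in> boxes lam" "hook lam (i, j) < g" "i \<le> j"
        by (auto simp: hooks_lt_plus_def eps_def split: if_splits)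
      then have "1 \<le> i" "1 \<le> j" by (auto simp: boxes_iff)
      then have "a i \<in> cbeads lam" "b j \<in> cbeads lam \<and> b j \<noteq> 0" using aT bT by blast+
      then show "q \<in> hook_pairs g (cbeads lam)"
        using ij cmp[OF ij(2)] hook[OF ij(2)] box[OF \<open>1 \<le> i\<close> \<open>1 \<le> j\<close>] by (auto simp: hook_pairs_def)
    next
      fix q assume "q \<in> hook_pairs g (cbeads lam)"
      then obtain k l where q: "q = (k, l)" "k \<in> cbeads lam" "l \<in> cbeads lam \<and> l \<noteq> 0" "l \<le> k" "0 < k + l" "k + l < int g"
        by (auto simp: hook_pairs_def)
      then obtain i j where ij: "1 \<le> i" "1 \<le> j" "k = a i" "l = b j" using aT bT by blast
      then have bx: "(i, j) \<in> boxes lam" using box q by simp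
      then have "(i, j) \<in> hooks_lt_plus g lam"
        using hook[OF bx] cmp[OF bx] q ij by (auto simp: hooks_lt_plus_def eps_def)
      then show "q \<in> (\<lambda>(i, j). (a i, b j)) ` hooks_lt_plus g lam" using q ij by force
    qed
  qed
  then show "bij_betw (\<lambda>(i, j). (bead lam i + 1, int (col_len lam j) - int j)) (hooks_lt_plus g lam) (hook_pairs g (cbeads lam))"
    by (simp add: a_def b_def)
qed

definition strict_pairs :: "nat \<Rightarrow> int set \<Rightarrow> (int \<times> int) set" where
  "strict_pairs g A = {(a, b). a \<in> A \<and> b \<in> A \<and> b < a \<and> 0 < a + b \<and> a + b < int g}"

lemma finite_boxes: "finite (boxes lam)"
proof -
  have "boxes lam \<subseteq> {..length lam} \<times> {..Max (insert 0 (set lam))}"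
  proof clarify
    fix i j assume "(i, j) \<in> boxes lam"
    then have ij: "1 \<le> i" "1 \<le> j" "j \<le> part lam i" by (auto simp: boxes_iff)
    then have i: "i \<le> length lam" by (auto simp: part_def split: if_splits)
    then have "part lam i \<in> set lam" using ij by (auto simp: part_def)
    then have "part lam i \<le> Max (insert 0 (set lam))" by (intro Max_ge) auto
    then show "i \<in> {..length lam} \<and> j \<in> {..Max (insert 0 (set lam))}" using i ij by simp
  qed
  then show ?thesis using finite_subset by blast
qed

text \<open>The diagonal boxes are counted twice and drop out modulo 2. In a remaining pair both
  entries are nonzero: the smaller because it comes from a column, the larger because the sum is
  positive.\<close>

lemma hook_sign_eq:
  assumes "lam \<in> DD_conj"
  shows "(- 1) ^ (card (hooks_lt_plus g lam) + card (hooks_lt_plus g lam \<inter> main_diagonal lam)) =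
    (- 1 :: 'a::comm_ring_1) ^ card (strict_pairs g (cbeads lam - {0}))"
    and "finite (strict_pairs g (cbeads lam - {0}))"
proof -
  let ?H = "hooks_lt_plus g lam" and ?D = "main_diagonal lam"
  let ?f = "\<lambda>(i, j). (bead lam i + 1, int (col_len lam j) - int j)"
  have sub: "?H \<subseteq> boxes lam" by (auto simp: hooks_lt_plus_def)
  have finH: "finite ?H" using sub finite_boxes finite_subset by blast
  note bij = hooks_bij(1)[OF assms, of g] and dg = hooks_bij(2)[OF assms]
  have "strict_pairs g (cbeads lam - {0}) = ?f ` (?H - ?D)"
  proof -
    have im: "?f ` ?H = hook_pairs g (cbeads lam)" using bij by (simp add: bij_betw_def)
    have r0: "a \<noteq> 0" if "b \<le> a" "0 < a + b" "a \<noteq> b" for a b :: int using that by linarith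
    have "strict_pairs g (cbeads lam - {0}) = {q \<in> ?f ` ?H. fst q \<noteq> snd q}"
      unfolding im by (auto simp: strict_pairs_def hook_pairs_def)
    also have "\<dots> = ?f ` (?H - ?D)"
      using sub dg by (auto simp: main_diagonal_def boxes_iff)
    finally show ?thesis .
  qed
  moreover have "inj_on ?f (?H - ?D)" using bij by (auto simp: bij_betw_def intro: inj_on_subset)
  ultimately have "card (strict_pairs g (cbeads lam - {0})) = card (?H - ?D)"
    by (simp add: card_image)
  moreover have "card ?H = card (?H \<inter> ?D) + card (?H - ?D)"
    using finH by (simp add: card_Int_Diff)
  ultimately have "card ?H + card (?H \<inter> ?D) = 2 * card (?H \<inter> ?D) + card (strict_pairs g (cbeads lam - {0}))"
    by simp
  then show "(- 1) ^ (card ?H + card (?H \<inter> ?D)) = (- 1 :: 'a) ^ card (strict_pairs g (cbeads lam - {0}))"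
    by (simp only: power_add power_mult) simp
  show "finite (strict_pairs g (cbeads lam - {0}))"
    using \<open>strict_pairs g (cbeads lam - {0}) = ?f ` (?H - ?D)\<close> finH by simp
qed

section \<open>Partitions from bead sets and quotients\<close>

lemma exists_gap:
  fixes M :: "int set"
  assumes "\<And>k. k \<le> B0 \<Longrightarrow> k \<in> M" "c \<notin> M"
  obtains B where "\<And>k. k \<le> B \<Longrightarrow> k \<in> M" "B + 1 \<notin> M"
proof -
  define n where "n = (LEAST n. B0 + int n \<notin> M)"
  have "B0 + int (nat (c - B0)) \<notin> M"
    using assms by (cases "c \<le> B0") auto
  then have 1: "B0 + int n \<notin> M" unfolding n_def by (rule LeastI)
  have "k \<in> M" if "k < B0 + int n" for k
  proof (cases "k \<le> B0")
    case False
    then have "nat (k - B0) < n" using that by simp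
    then have "B0 + int (nat (k - B0)) \<in> M" unfolding n_def using not_less_Least by blast
    then show ?thesis using False by simp
  qed (rule assms)
  then show thesis using that[of "B0 + int n - 1"] 1 by simp
qed

text \<open>Reflection symmetry forces the normalisation of the index, so the shift in
  \<open>partition_of_beads\<close> vanishes.\<close>

lemma partition_of_reflective:
  assumes r: "reflective T" and low: "\<And>k. k \<le> B0 \<Longrightarrow> k \<in> T"
  obtains lam where "is_partition lam" "cbeads lam = T"
proof -
  have "\<not> (1 \<in> T \<and> - 1 \<in> T)" using reflectiveD[OF r, of 1] by simp
  then obtain c where "c \<notin> T" by blast
  with exists_gap[of B0 T] low obtain B where B: "\<And>k. k \<le> B \<Longrightarrow> k \<in> T" "B + 1 \<notin> T" by metis
  define M where "M = {k. k + 1 \<in> T}"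
  have B0: "B \<le> 0"
  proof (rule ccontr)
    assume "\<not> B \<le> 0"
    then have "1 \<in> T" "- 1 \<in> T" using B(1) by auto
    then show False using reflectiveD[OF r, of 1] by simp
  qed
  \<comment> \<open>Of two opposite nonzero numbers exactly one lies in \<open>T\<close>. Taking -
    |.| therefore matches the elements above \<open>B\<close> with the integers B + 1, ...,
    0.\<close>
  have bij: "bij_betw (\<lambda>k. - \<bar>k + 1\<bar>) {k \<in> M. B - 1 < k} {B + 1..0}"
    unfolding bij_betw_def
  proof
    have "x = y" if "x \<in> T" "y \<in> T" "\<bar>x\<bar> = \<bar>y\<bar>" for x y :: int
      using that reflectiveD[OF r, of y] by (cases "y = 0") (auto simp: abs_eq_iff)
    then show "inj_on (\<lambda>k. - \<bar>k + 1\<bar>) {k \<in> M. B - 1 < k}"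
      unfolding inj_on_def M_def by (metis (no_types, lifting) add_right_cancel mem_Collect_eq neg_equal_iff_equal)
    show "(\<lambda>k. - \<bar>k + 1\<bar>) ` {k \<in> M. B - 1 < k} = {B + 1..0}"
    proof (intro equalityI subsetI)
      fix z assume "z \<in> (\<lambda>k. - \<bar>k + 1\<bar>) ` {k \<in> M. B - 1 < k}"
      then obtain k where k: "z = - \<bar>k + 1\<bar>" "k + 1 \<in> T" "B < k + 1" by (auto simp: M_def)
      show "z \<in> {B + 1..0}"
      proof (cases "k + 1 \<le> 0")
        case False
        then have "- (k + 1) \<notin> T" using reflectiveD[OF r, of "k + 1"] k by simp
        then have "\<not> - (k + 1) \<le> B" using B(1) by blast
        then show ?thesis using False k by auto
      qed (use k in auto)
    next
      fix z assume z: "z \<in> {B + 1..0}"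
      show "z \<in> (\<lambda>k. - \<bar>k + 1\<bar>) ` {k \<in> M. B - 1 < k}"
      proof (cases "z \<in> T")
        case True
        then show ?thesis using z by (intro image_eqI[of _ _ "z - 1"]) (auto simp: M_def)
      next
        case False
        then have "z \<noteq> 0" using reflective_0[OF r] by metis
        then have "- z \<in> T" using reflectiveD[OF r, of z] False by blast
        then show ?thesis using z by (intro image_eqI[of _ _ "- z - 1"]) (auto simp: M_def)
      qed
    qed
  qed
  have fin: "finite {k \<in> M. B - 1 < k}" using bij_betw_finite[OF bij] by simp
  have card: "int (card {k \<in> M. B - 1 < k}) = - B" using bij_betw_same_card[OF bij] B0 by simp
  obtain lam where lam: "is_partition lam"
    "\<And>k. k \<in> beads lam \<longleftrightarrow> k + (B - 1 + 1 + int (card {k \<in> M. B - 1 < k})) \<in> M"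
    by (rule partition_of_beads[of "B - 1" M]) (use B fin in \<open>auto simp: M_def\<close>)
  have "cbeads lam = T"
    unfolding cbeads_def using lam(2) unfolding card by (auto simp: M_def)
  then show thesis using that lam(1) by blast
qed

text \<open>Existence by \<open>partition_of_beads\<close> and uniqueness by
  \<open>beads_shift_unique\<close> make the definite description meaningful.\<close>

lemma g_quotient_eq_iff:
  assumes p: "is_partition lam" and g: "0 < g" and nu: "is_partition nu"
  shows "g_quotient g lam k = nu \<longleftrightarrow>
    (\<exists>s. \<forall>i. i \<in> beads nu \<longleftrightarrow> int g * (i + s) + int k \<in> beads lam)"
proof -
  define P where "P nu \<longleftrightarrow> is_partition nu \<and>
     (\<exists>s::int. \<forall>i::int. word nu i = word lam (int g * (i + s) + int k))" for nu
  have P: "P nu \<longleftrightarrow> is_partition nu \<and> (\<exists>s. \<forall>i. i \<in> beads nu \<longleftrightarrow> int g * (i + s) + int k \<in> beads lam)" for nu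
    unfolding P_def word_eq_iff ..
  define M where "M = {i. int g * i + int k \<in> beads lam}"
  have low: "i \<in> M" if "i \<le> - int (length lam) - 1 - int k" for i
  proof -
    have "int g * i \<le> i" using mult_right_mono_neg[of 1 "int g" i] g that by simp
    then have "int g * i + int k \<le> - int (length lam) - 1" using that by linarith
    then show ?thesis unfolding M_def by (simp add: beads_bounded_below[OF p])
  qed
  have high: "i \<notin> M" if "i \<ge> int (part lam 1)" for i
  proof -
    have "1 * i \<le> int g * i" using g that by (intro mult_right_mono) auto
    then show ?thesis unfolding M_def using that beads_le_part[OF p] by fastforce
  qed
  obtain B where B: "\<And>k. k \<le> B \<Longrightarrow> k \<in> M" "B + 1 \<notin> M"
    using exists_gap[of _ M "int (part lam 1)"] low high by (metis order_refl)
  have "{i \<in> M. B < i} \<subseteq> {B..int (part lam 1)}"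
  proof clarify
    fix i assume "i \<in> M" "B < i"
    then show "i \<in> {B..int (part lam 1)}" using high[of i] by (cases "int (part lam 1) \<le> i") auto
  qed
  then have "finite {i \<in> M. B < i}" using finite_subset by blast
  with partition_of_beads[of B M] B obtain nu0 where nu0: "is_partition nu0"
    "\<And>i. i \<in> beads nu0 \<longleftrightarrow> i + (B + 1 + int (card {i \<in> M. B < i})) \<in> M" by metis
  then have "P nu0" unfolding P M_def by blast
  moreover have "nu1 = nu2" if P12: "P nu1" "P nu2" for nu1 nu2
  proof -
    obtain s1 s2 where s: "\<And>i. i \<in> beads nu1 \<longleftrightarrow> int g * (i + s1) + int k \<in> beads lam"
      "\<And>i. i \<in> beads nu2 \<longleftrightarrow> int g * (i + s2) + int k \<in> beads lam"
      using P12 unfolding P by blast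
    have "i \<in> beads nu1 \<longleftrightarrow> i + (s1 - s2) \<in> beads nu2" for i
      using s(1)[of i] s(2)[of "i + (s1 - s2)"] by simp
    then show ?thesis using beads_shift_unique[of nu1 nu2 "s1 - s2"] P12 unfolding P by blast
  qed
  ultimately have "g_quotient g lam k = nu \<longleftrightarrow> P nu"
    unfolding g_quotient_def P_def[symmetric] by (metis the_equality)
  then show ?thesis using nu by (simp add: P)
qed

lemma beads_Nil: "k \<in> beads [] \<longleftrightarrow> k < 0"
proof
  assume "k < 0"
  then show "k \<in> beads []" by (auto simp: beads_def bead_def part_def intro!: exI[of _ "nat (- k)"])
qed (auto simp: beads_def bead_def part_def)

lemma is_partition_rect: "is_partition (rect_partition m b)"
  by (auto simp: is_partition_def rect_partition_def sorted_wrt_iff_nth_less)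

text \<open>Shifted by one these are 0, ..., m - 1 and all numbers up to - m, a reflective set; this
  explains the shape m times m - 1.\<close>

lemma beads_rect:
  assumes "1 \<le> m"
  shows "k \<in> beads (rect_partition m (m - 1)) \<longleftrightarrow> (- 1 \<le> k \<and> k \<le> int m - 2) \<or> k \<le> - int m - 1"
proof -
  have part: "part (rect_partition m (m - 1)) i = (if i \<le> m then m - 1 else 0)" if "1 \<le> i" for i
    using that assms by (auto simp: part_def rect_partition_def)
  show ?thesis
  proof
    assume "k \<in> beads (rect_partition m (m - 1))"
    then show "(- 1 \<le> k \<and> k \<le> int m - 2) \<or> k \<le> - int m - 1"
      using part assms by (auto simp: beads_def bead_def of_nat_diff split: if_splits)
  next
    assume "(- 1 \<le> k \<and> k \<le> int m - 2) \<or> k \<le> - int m - 1"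
    then show "k \<in> beads (rect_partition m (m - 1))"
    proof
      assume k: "- 1 \<le> k \<and> k \<le> int m - 2"
      then have "1 \<le> nat (int m - 1 - k)" "nat (int m - 1 - k) \<le> m" by auto
      then have "k = bead (rect_partition m (m - 1)) (nat (int m - 1 - k))"
        using part k assms by (simp add: bead_def of_nat_diff)
      then show ?thesis using \<open>1 \<le> nat (int m - 1 - k)\<close> unfolding beads_def by blast
    next
      assume k: "k \<le> - int m - 1"
      then have "1 \<le> nat (- k)" "\<not> nat (- k) \<le> m" by auto
      then have "k = bead (rect_partition m (m - 1)) (nat (- k))"
        using part k by (simp add: bead_def)
      then show ?thesis using \<open>1 \<le> nat (- k)\<close> unfolding beads_def by blast
    qed
  qed
qed

section \<open>Parametrisation by charges\<close>

context
  fixes t g :: nat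
  assumes t: "0 < t" and g: "g = 2 * t - 1"
begin

lemma g_gt_0: "0 < g" and int_g: "int g = 2 * int t - 1"
  using t by (auto simp: g)

text \<open>Residue c carries the beads below level \<open>n c\<close>, residue g - c those forced
  by reflection, and residue 0 the rectangle. The \<open>q + 1\<close> arises because g q' - c has
  quotient q' - 1.\<close>

definition charge_set :: "(nat \<Rightarrow> int) \<Rightarrow> int set" where
  "charge_set n = {k. let q = k div int g; b = k mod int g in
     if b = 0 then q \<le> - n 0 \<or> (0 \<le> q \<and> q < n 0)
     else if b < int t then q < n (nat b)
     else q + 1 \<le> - n (nat (int g - b))}"

lemma residue_simps:
  assumes "c < t"
  shows "(int g * q + int c) div int g = q" "(int g * q + int c) mod int g = int c"
    "0 < c \<Longrightarrow> (int g * q - int c) div int g = q - 1" "0 < c \<Longrightarrow> (int g * q - int c) mod int g = int g - int c"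
proof -
  note rc = residue_cases[OF t, folded g]
  show "(int g * q + int c) div int g = q" "(int g * q + int c) mod int g = int c"
    using rc[of "int c" q] assms int_g by auto
  have eq: "int g * q - int c = int g * (q - 1) + (int g - int c)" by (simp add: algebra_simps)
  have b: "0 \<le> int g - int c" "int g - int c < int g" if "0 < c" using that assms int_g by auto
  show "(int g * q - int c) div int g = q - 1" "(int g * q - int c) mod int g = int g - int c" if "0 < c"
    unfolding eq by (rule rc(1)[OF b[OF that]], rule rc(2)[OF b[OF that]])
qed

lemma charge_set_iff:
  assumes "c < t"
  shows "0 < c \<Longrightarrow> int g * q + int c \<in> charge_set n \<longleftrightarrow> q < n c"
    "0 < c \<Longrightarrow> int g * q - int c \<in> charge_set n \<longleftrightarrow> q \<le> - n c"
    "int g * q \<in> charge_set n \<longleftrightarrow> q \<le> - n 0 \<or> (0 \<le> q \<and> q < n 0)"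
proof -
  show "int g * q + int c \<in> charge_set n \<longleftrightarrow> q < n c" if "0 < c"
  proof -
    have "int c mod int g = int c" "int c div int g = 0" using residue_simps(1,2)[OF assms, of 0] by simp_all
    then show ?thesis using that assms g_gt_0 by (simp add: charge_set_def Let_def)
  qed
  show "int g * q - int c \<in> charge_set n \<longleftrightarrow> q \<le> - n c" if "0 < c"
  proof -
    have "int g - int c \<noteq> 0" "\<not> int g - int c < int t" using that assms int_g by auto
    then show ?thesis using that assms by (simp add: charge_set_def residue_simps(3,4)[OF assms that] Let_def)
  qed
  show "int g * q \<in> charge_set n \<longleftrightarrow> q \<le> - n 0 \<or> (0 \<le> q \<and> q < n 0)"
    using g_gt_0 by (simp add: charge_set_def Let_def)
qed

lemma int_residue_cases:
  obtains (zero) q where "k = int g * q"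
  | (pos) q c where "0 < c" "c < t" "k = int g * q + int c"
  | (neg) q c where "0 < c" "c < t" "k = int g * q - int c"
proof -
  define b q where "b = k mod int g" and "q = k div int g"
  have k: "k = int g * q + b" by (simp add: b_def q_def)
  have b: "0 \<le> b" "b < int g" using g_gt_0 by (simp_all add: b_def)
  consider "b = 0" | "0 < b" "b < int t" | "int t \<le> b" using b by linarith
  then show thesis
  proof cases
    case 1
    then show thesis using zero[of q] k by simp
  next
    case 2
    then show thesis using pos[of "nat b" q] k by simp
  next
    case 3
    have "k = int g * (q + 1) - int (nat (int g - b))" using b k by (simp add: algebra_simps)
    moreover have "0 < nat (int g - b)" "nat (int g - b) < t" using 3 b int_g by auto
    ultimately show thesis using neg by blast
  qed
qed

lemma charges_0: "n \<in> charges t \<Longrightarrow> 1 \<le> n 0"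
  using t by (auto simp: charges_def class_range_def PiE_def Pi_def)

lemma reflective_charge_set:
  assumes "n \<in> charges t"
  shows "reflective (charge_set n)"
  unfolding reflective_def
proof (intro conjI allI impI)
  note n0 = charges_0[OF assms]
  show "0 \<in> charge_set n" using charge_set_iff(3)[OF t, of 0 n] n0 by simp
  fix k :: int assume "k \<noteq> 0"
  show "k \<in> charge_set n \<longleftrightarrow> - k \<notin> charge_set n"
  proof (cases k rule: int_residue_cases)
    case (zero q)
    have m: "- k = int g * (- q)" and q: "q \<noteq> 0" using zero \<open>k \<noteq> 0\<close> by auto
    show ?thesis
      unfolding m unfolding zero charge_set_iff(3)[OF t] using n0 q by auto
  next
    case (pos q c)
    have "- k = int g * (- q) - int c" using pos by simp
    then show ?thesis using pos charge_set_iff(1)[of c q n] charge_set_iff(2)[of c "- q" n] by auto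
  next
    case (neg q c)
    have "- k = int g * (- q) + int c" using neg by simp
    then show ?thesis using neg charge_set_iff(2)[of c q n] charge_set_iff(1)[of c "- q" n] by auto
  qed
qed

lemma charge_set_low:
  assumes "n \<in> charges t"
  obtains B where "\<And>k. k \<le> B \<Longrightarrow> k \<in> charge_set n"
proof -
  define N where "N = Max (insert 1 ((\<lambda>c. \<bar>n c\<bar>) ` {..<t}))"
  have N: "\<bar>n c\<bar> \<le> N" if "c < t" for c unfolding N_def using that by (intro Max_ge) auto
  have N1: "1 \<le> N" unfolding N_def by (intro Max_ge) auto
  have "k \<in> charge_set n" if k: "k \<le> - int g * (N + 2)" for k
  proof -
    have q: "q \<le> - N - 1" if "k = int g * q + d" "- int g < d" for q d
    proof -
      have "int g * q < int g * (- N - 1)" using k that by (simp add: algebra_simps)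
      then have "q < - N - 1" using g_gt_0 by (simp add: mult_less_cancel_left_pos)
      then show ?thesis by simp
    qed
    show ?thesis
    proof (cases k rule: int_residue_cases)
      case (zero q)
      then have "q \<le> - N - 1" using q[of q 0] g_gt_0 by simp
      then have "q \<le> - n 0" using N[OF t] by linarith
      then show ?thesis using zero by (simp add: charge_set_iff(3)[OF t])
    next
      case (pos q c)
      then show ?thesis using q[of q "int c"] N[of c] N1 by (simp add: charge_set_iff(1))
    next
      case (neg q c)
      then have "- int g < - int c" using int_g by linarith
      then show ?thesis using q[of q "- int c"] N[of c] neg by (simp add: charge_set_iff(2))
    qed
  qed
  then show thesis using that by blast
qed

definition partition_of :: "(nat \<Rightarrow> int) \<Rightarrow> nat list" where
  "partition_of n = (THE lam. is_partition lam \<and> cbeads lam = charge_set n)"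

lemma cbeads_inj:
  assumes "is_partition lam" "is_partition mu" "cbeads lam = cbeads mu"
  shows "lam = mu"
proof (rule beads_inj[OF assms(1,2)])
  have "k \<in> beads lam \<longleftrightarrow> k \<in> beads mu" for k
    using assms(3) unfolding cbeads_def set_eq_iff by (metis add_diff_cancel_right' mem_Collect_eq)
  then show "beads lam = beads mu" by blast
qed

lemma partition_of:
  assumes "n \<in> charges t"
  shows "is_partition (partition_of n)" "cbeads (partition_of n) = charge_set n"
proof -
  obtain B where "\<And>k. k \<le> B \<Longrightarrow> k \<in> charge_set n" using charge_set_low[OF assms] by blast
  from partition_of_reflective[OF reflective_charge_set[OF assms] this]
  obtain lam where lam: "is_partition lam" "cbeads lam = charge_set n" by blast
  have "is_partition (partition_of n) \<and> cbeads (partition_of n) = charge_set n"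
    unfolding partition_of_def
    by (rule theI[of _ lam]) (use lam cbeads_inj in auto)
  then show "is_partition (partition_of n)" "cbeads (partition_of n) = charge_set n" by auto
qed

lemma in_beads_iff: "k \<in> beads lam \<longleftrightarrow> k + 1 \<in> cbeads lam"
  by (simp add: cbeads_def)

text \<open>Because of the shift by one, component \<open>k\<close> of the quotient is residue class
  k + 1 of \<open>cbeads\<close>; in particular component 2 t - 2 is residue class 0.\<close>

lemma quotient_Nil_iff:
  assumes "is_partition lam"
  shows "g_quotient g lam k = [] \<longleftrightarrow> (\<exists>s. \<forall>j. j < s \<longleftrightarrow> int g * j + int (Suc k) \<in> cbeads lam)"
proof -
  have "is_partition []" by (simp add: is_partition_def)
  from g_quotient_eq_iff[OF assms g_gt_0 this, of k]
  have "g_quotient g lam k = [] \<longleftrightarrow> (\<exists>s. \<forall>i. i < 0 \<longleftrightarrow> int g * (i + s) + int (Suc k) \<in> cbeads lam)"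
    unfolding beads_Nil unfolding in_beads_iff by (simp add: add_ac)
  also have "\<dots> \<longleftrightarrow> (\<exists>s. \<forall>j. j < s \<longleftrightarrow> int g * j + int (Suc k) \<in> cbeads lam)"
  proof (rule ex_cong1)
    fix s
    show "(\<forall>i. i < 0 \<longleftrightarrow> int g * (i + s) + int (Suc k) \<in> cbeads lam) \<longleftrightarrow>
        (\<forall>j. j < s \<longleftrightarrow> int g * j + int (Suc k) \<in> cbeads lam)"
      by (metis add.commute add_diff_cancel_left' diff_add_cancel less_iff_diff_less_0)
  qed
  finally show ?thesis .
qed

lemma quotient_rect_iff:
  assumes "is_partition lam" "1 \<le> m"
  shows "g_quotient g lam (2 * t - 2) = rect_partition m (m - 1) \<longleftrightarrow>
    (\<exists>s. \<forall>j. ((0 \<le> j - s \<and> j - s < int m) \<or> j - s \<le> - int m) \<longleftrightarrow> int g * j \<in> cbeads lam)"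
proof -
  have k: "int g * (i + s) + int (2 * t - 2) + 1 = int g * (i + 1 + s)" for i s
    using t by (simp add: int_g algebra_simps of_nat_diff)
  have "g_quotient g lam (2 * t - 2) = rect_partition m (m - 1) \<longleftrightarrow>
    (\<exists>s. \<forall>i. ((- 1 \<le> i \<and> i \<le> int m - 2) \<or> i \<le> - int m - 1) \<longleftrightarrow> int g * (i + 1 + s) \<in> cbeads lam)"
    unfolding g_quotient_eq_iff[OF assms(1) g_gt_0 is_partition_rect] beads_rect[OF assms(2)]
    unfolding in_beads_iff k ..
  also have "\<dots> \<longleftrightarrow> (\<exists>s. \<forall>j. ((0 \<le> j - s \<and> j - s < int m) \<or> j - s \<le> - int m) \<longleftrightarrow> int g * j \<in> cbeads lam)"
  proof (rule ex_cong1)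
    fix s
    let ?Q = "\<lambda>i. ((- 1 \<le> i \<and> i \<le> int m - 2) \<or> i \<le> - int m - 1) \<longleftrightarrow> int g * (i + 1 + s) \<in> cbeads lam"
    let ?R = "\<lambda>j. ((0 \<le> j - s \<and> j - s < int m) \<or> j - s \<le> - int m) \<longleftrightarrow> int g * j \<in> cbeads lam"
    have QR: "?Q i \<longleftrightarrow> ?R (i + 1 + s)" for i by (simp add: algebra_simps) linarith
    have "?R j \<longleftrightarrow> ?Q (j - 1 - s)" for j unfolding QR by simp
    with QR show "(\<forall>i. ?Q i) \<longleftrightarrow> (\<forall>j. ?R j)" by blast
  qed
  finally show ?thesis .
qed

text \<open>The components of the quotient prescribe residues only up to shifts. For residues 1,
  ..., t - 1 the shifts are the charges, and reflection then determines the residues g - c.\<close>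

lemma DD_conj_1_iff:
  "lam \<in> DD_conj_1 t \<longleftrightarrow> is_partition lam \<and> (\<exists>n\<in>charges t. cbeads lam = charge_set n)"
proof
  assume "is_partition lam \<and> (\<exists>n\<in>charges t. cbeads lam = charge_set n)"
  then obtain n where p: "is_partition lam" and n: "n \<in> charges t" "cbeads lam = charge_set n" by blast
  have "lam \<in> DD_conj" using p n reflective_charge_set by (simp add: DD_conj_iff)
  moreover have "g_quotient (2 * t - 1) lam k = []" if k: "k < 2 * t - 1" "k \<noteq> 2 * t - 2" for k
    unfolding g[symmetric] quotient_Nil_iff[OF p] n(2)
  proof (cases "Suc k < t")
    case True
    then show "\<exists>s. \<forall>j. j < s \<longleftrightarrow> int g * j + int (Suc k) \<in> charge_set n"
      using charge_set_iff(1)[OF True] by auto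
  next
    case False
    define c where "c = g - Suc k"
    have c: "0 < c" "c < t" using False k g by (auto simp: c_def)
    have "int g * j + int (Suc k) = int g * (j + 1) - int c" for j
      using k by (simp add: c_def g of_nat_diff algebra_simps)
    then have "int g * j + int (Suc k) \<in> charge_set n \<longleftrightarrow> j < - n c" for j
      using charge_set_iff(2)[OF c(2,1), of "j + 1" n] by auto
    then show "\<exists>s. \<forall>j. j < s \<longleftrightarrow> int g * j + int (Suc k) \<in> charge_set n" by auto
  qed
  moreover have "g_quotient (2 * t - 1) lam (2 * t - 2) = rect_partition (nat (n 0)) (nat (n 0) - 1)"
  proof -
    have n0: "1 \<le> n 0" by (rule charges_0[OF n(1)])
    then have "1 \<le> nat (n 0)" by simp
    then show ?thesis
      unfolding g[symmetric] using n0
      by (subst quotient_rect_iff[OF p]) (auto simp: n(2) charge_set_iff(3)[OF t] intro!: exI[of _ 0])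
  qed
  moreover have "1 \<le> nat (n 0)" using charges_0[OF n(1)] by simp
  ultimately show "lam \<in> DD_conj_1 t" unfolding DD_conj_1_def by blast
next
  assume lam: "lam \<in> DD_conj_1 t"
  then have p: "is_partition lam" and r: "reflective (cbeads lam)"
    by (auto simp: DD_conj_1_def DD_conj_iff)
  have "\<exists>s. \<forall>j. j < s \<longleftrightarrow> int g * j + int c \<in> cbeads lam" if c: "0 < c" "c < t" for c
  proof -
    have "c - 1 < 2 * t - 1" "c - 1 \<noteq> 2 * t - 2" using c by auto
    then have "g_quotient g lam (c - 1) = []" using lam unfolding DD_conj_1_def g by blast
    then show ?thesis using c unfolding quotient_Nil_iff[OF p] by simp
  qed
  then obtain s where s: "\<And>c j. 0 < c \<Longrightarrow> c < t \<Longrightarrow> j < s c \<longleftrightarrow> int g * j + int c \<in> cbeads lam" by metis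
  obtain m where m: "1 \<le> m" "g_quotient g lam (2 * t - 2) = rect_partition m (m - 1)"
    using lam unfolding DD_conj_1_def g by blast
  then obtain s0 where s0: "\<And>j. ((0 \<le> j - s0 \<and> j - s0 < int m) \<or> j - s0 \<le> - int m) \<longleftrightarrow> int g * j \<in> cbeads lam"
    using quotient_rect_iff[OF p m(1)] by blast
  have refl0: "((0 \<le> j - s0 \<and> j - s0 < int m) \<or> j - s0 \<le> - int m) \<longleftrightarrow>
      \<not> ((0 \<le> - j - s0 \<and> - j - s0 < int m) \<or> - j - s0 \<le> - int m)" if "j \<noteq> 0" for j
    unfolding s0 using reflectiveD[OF r, of "int g * j"] that g_gt_0 by simp
  have zero0: "(0 \<le> 0 - s0 \<and> 0 - s0 < int m) \<or> 0 - s0 \<le> - int m"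
    unfolding s0 using reflective_0[OF r] by simp
  \<comment> \<open>The rectangle has no free shift: containing 0 and being reflective centres
    it.\<close>
  have "s0 = 0"
  proof (cases s0 "0 :: int" rule: linorder_cases)
    case less
    then have "- s0 < int m" using zero0 by auto
    then show ?thesis using less refl0[of "int m"] m(1) by auto
  next
    case greater
    then have "int m \<le> s0" using zero0 by auto
    then show ?thesis using greater refl0[of s0] m(1) by auto
  qed
  define n where "n = restrict (\<lambda>c. if c = 0 then int m else s c) {..<t}"
  have n: "n 0 = int m" "\<And>c. 0 < c \<Longrightarrow> c < t \<Longrightarrow> n c = s c" using t by (auto simp: n_def)
  have "n \<in> charges t" using m by (auto simp: charges_def n_def class_range_def)
  moreover have "k \<in> cbeads lam \<longleftrightarrow> k \<in> charge_set n" for k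
  proof (cases k rule: int_residue_cases)
    case (zero q)
    then show ?thesis using s0[of q] by (auto simp: charge_set_iff(3)[OF t] n \<open>s0 = 0\<close>)
  next
    case (pos q c)
    then show ?thesis using s[of c q] by (simp add: charge_set_iff(1) n)
  next
    case (neg q c)
    have "k \<noteq> 0"
    proof
      assume "k = 0"
      then have "0 mod int g = int g - int c" using residue_simps(4)[of c q] neg by simp
      then show False using neg int_g by simp
    qed
    moreover have "- k = int g * (- q) + int c" using neg by simp
    ultimately have "k \<in> cbeads lam \<longleftrightarrow> \<not> - q < s c"
      using reflectiveD[OF r, of k] s[of c "- q"] neg by simp
    then show ?thesis using neg by (simp add: charge_set_iff(2) n) linarith
  qed
  then have "cbeads lam = charge_set n" by blast
  ultimately show "is_partition lam \<and> (\<exists>n\<in>charges t. cbeads lam = charge_set n)" using p by blast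
qed

lemma charge_set_inj:
  assumes n: "n \<in> charges t" and m: "m \<in> charges t" and eq: "charge_set n = charge_set m"
  shows "n = m"
proof (rule PiE_ext[of n "{..<t}" class_range m])
  show "n \<in> PiE {..<t} class_range" "m \<in> PiE {..<t} class_range" using n m by (auto simp: charges_def)
  fix c assume "c \<in> {..<t}"
  then have c: "c < t" by simp
  show "n c = m c"
  proof (cases "c = 0")
    case True
    have iff: "(q \<le> - n 0 \<or> (0 \<le> q \<and> q < n 0)) \<longleftrightarrow> (q \<le> - m 0 \<or> (0 \<le> q \<and> q < m 0))" for q
      using eq charge_set_iff(3)[OF t, of q n] charge_set_iff(3)[OF t, of q m] by simp
    show ?thesis using iff[of "n 0"] iff[of "m 0"] charges_0[OF n] charges_0[OF m] True by auto
  next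
    case False
    have "q < n c \<longleftrightarrow> q < m c" for q
      using eq charge_set_iff(1)[OF c, of q n] charge_set_iff(1)[OF c, of q m] False by simp
    from this[of "n c"] this[of "m c"] show ?thesis by auto
  qed
qed

lemma bij_betw_partition_of: "bij_betw partition_of (charges t) (DD_conj_1 t)"
  unfolding bij_betw_def
proof
  show "inj_on partition_of (charges t)"
    by (rule inj_onI) (metis charge_set_inj partition_of(2))
  show "partition_of ` charges t = DD_conj_1 t"
  proof (intro equalityI subsetI)
    fix lam assume "lam \<in> DD_conj_1 t"
    then obtain n where "is_partition lam" "n \<in> charges t" "cbeads lam = charge_set n"
      by (auto simp: DD_conj_1_iff)
    then show "lam \<in> partition_of ` charges t"
      using partition_of cbeads_inj by (intro image_eqI[of _ _ n]) auto
  qed (use partition_of DD_conj_1_iff in auto)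
qed

section \<open>The coding vector\<close>

lemma beta_eqI:
  assumes "int g * K + int (Suc i) \<in> cbeads lam" "\<And>k. int g * k + int (Suc i) \<in> cbeads lam \<Longrightarrow> k \<le> K"
  shows "beta g lam i = (K + 1) * int g + int i"
  unfolding beta_def word_eq_0_iff in_beads_iff
proof (rule Greatest_equality)
  show "\<exists>k. (K + 1) * int g + int i = (k + 1) * int g + int i \<and> k * int g + int i + 1 \<in> cbeads lam"
    using assms(1) by (intro exI[of _ K]) (simp add: mult.commute add_ac)
next
  fix y assume "\<exists>k. y = (k + 1) * int g + int i \<and> k * int g + int i + 1 \<in> cbeads lam"
  then obtain k where k: "y = (k + 1) * int g + int i" "int g * k + int (Suc i) \<in> cbeads lam"
    by (auto simp: mult.commute add_ac)
  then have "k \<le> K" using assms(2) by blast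
  then show "y \<le> (K + 1) * int g + int i" unfolding k by (intro add_right_mono mult_right_mono) auto
qed

text \<open>The larger of the two mirror exponents of class \<open>c\<close>; decreased by one,
  these become the entries of the coding vector.\<close>

definition top_exp :: "(nat \<Rightarrow> int) \<Rightarrow> nat \<Rightarrow> int" where
  "top_exp n c = max (level_exp g n c) (int g - level_exp g n c)"

lemma beta_partition_of:
  assumes n: "n \<in> charges t"
  shows "beta g (partition_of n) (g - 1) = level_exp g n 0 - 1"
    "0 < c \<Longrightarrow> c < t \<Longrightarrow> beta g (partition_of n) (c - 1) = level_exp g n c - 1"
    "0 < c \<Longrightarrow> c < t \<Longrightarrow> beta g (partition_of n) (g - 1 - c) = int g - level_exp g n c - 1"
proof -
  note cb = partition_of(2)[OF n] and n0 = charges_0[OF n]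
  have "int g * k + int (Suc (g - 1)) = int g * (k + 1)" for k using g_gt_0 by (simp add: algebra_simps)
  then have "beta g (partition_of n) (g - 1) = (n 0 - 2 + 1) * int g + int (g - 1)"
    by (intro beta_eqI) (use n0 in \<open>auto simp: cb charge_set_iff(3)[OF t]\<close>)
  then show "beta g (partition_of n) (g - 1) = level_exp g n 0 - 1"
    using g_gt_0 by (simp add: level_exp_def algebra_simps of_nat_diff)
  show "beta g (partition_of n) (c - 1) = level_exp g n c - 1" if c: "0 < c" "c < t"
  proof -
    have "beta g (partition_of n) (c - 1) = (n c - 1 + 1) * int g + int (c - 1)"
      by (intro beta_eqI) (use c in \<open>auto simp: cb charge_set_iff(1)\<close>)
    then show ?thesis using c by (simp add: level_exp_def of_nat_diff)
  qed
  show "beta g (partition_of n) (g - 1 - c) = int g - level_exp g n c - 1" if c: "0 < c" "c < t"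
  proof -
    have "int g * k + int (Suc (g - 1 - c)) = int g * (k + 1) - int c" for k
      using c g by (simp add: algebra_simps of_nat_diff)
    note eq = this
    have "beta g (partition_of n) (g - 1 - c) = (- n c - 1 + 1) * int g + int (g - 1 - c)"
    proof (rule beta_eqI)
      show "int g * (- n c - 1) + int (Suc (g - 1 - c)) \<in> cbeads (partition_of n)"
        unfolding eq cb charge_set_iff(2)[OF c(2,1)] by simp
      show "k \<le> - n c - 1" if "int g * k + int (Suc (g - 1 - c)) \<in> cbeads (partition_of n)" for k
        using that unfolding eq cb charge_set_iff(2)[OF c(2,1)] by simp
    qed
    moreover have "int (g - 1 - c) = int g - 1 - int c" using c g by (simp add: of_nat_diff)
    ultimately show ?thesis by (simp add: level_exp_def algebra_simps)
  qed
qed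

lemma cls_lexp: "c < t \<Longrightarrow> cls t (level_exp g n c) = c"
  using alcove_shift(1)[of c t "n c", folded g] by (simp add: level_exp_def)

lemma cls_reflect: "cls t (int g - y) = cls t y"
proof (cases "y mod int g < int t")
  case True
  show ?thesis
  proof (cases y rule: int_residue_cases)
    case (zero q)
    have "cls t (int g * k + int 0) = 0" for k using alcove_shift(1)[OF t, of k, folded g] by simp
    from this[of q] this[of "1 - q"] show ?thesis using zero by (simp add: algebra_simps)
  next
    case (pos q c)
    have "int g - (int g - y) = y" by simp
    moreover have "\<not> (int g - y) mod int g < int t"
    proof -
      have "int g - y = int g * (1 - q) - int c" using pos by (simp add: algebra_simps)
      then have "(int g - y) mod int g = int g - int c"
        using residue_simps(4)[OF pos(2,1), of "1 - q"] by (simp only:)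
      then show ?thesis using pos int_g by simp
    qed
    ultimately show ?thesis using alcove_reflect(1)[OF t, of "int g - y", folded g] by simp
  next
    case (neg q c)
    then have "y mod int g = int g - int c" using residue_simps(4)[of c q] by simp
    then show ?thesis using True neg int_g by simp
  qed
qed (use alcove_reflect(1)[OF t, of y, folded g] in simp)

lemma cls_top_exp: "c < t \<Longrightarrow> cls t (top_exp n c) = c"
  using cls_lexp[of c n] cls_reflect[of "level_exp g n c"] by (simp add: top_exp_def max_def)

lemma top_exp_inj: "inj_on (top_exp n) {..<t}"
  by (rule inj_onI) (metis cls_top_exp lessThan_iff)

text \<open>Class 0 occupies one residue and contributes its larger exponent only, since
  \<open>n 0 >= 1\<close>; the other classes contribute two values each, g in total.\<close>

lemma beta_image:
  assumes n: "n \<in> charges t"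
  shows "beta g (partition_of n) ` {0..<g} =
    (\<lambda>c. top_exp n c - 1) ` {..<t} \<union> (\<lambda>c. int g - top_exp n c - 1) ` {1..<t}"
proof -
  have n0: "top_exp n 0 = level_exp g n 0"
  proof -
    have "int g * 1 \<le> int g * n 0" using charges_0[OF n] by (intro mult_left_mono) auto
    then show ?thesis by (simp add: top_exp_def level_exp_def)
  qed
  have split: "{0..<g} = insert (g - 1) ((\<lambda>c. c - 1) ` {1..<t} \<union> (\<lambda>c. g - 1 - c) ` {1..<t})"
  proof (intro equalityI subsetI)
    fix i assume "i \<in> {0..<g}"
    then have i: "i < g" by simp
    consider "i = g - 1" | "Suc i < t" | "t \<le> Suc i" "i < g - 1" using i by linarith
    then show "i \<in> insert (g - 1) ((\<lambda>c. c - 1) ` {1..<t} \<union> (\<lambda>c. g - 1 - c) ` {1..<t})"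
    proof cases
      case 2
      then have "i \<in> (\<lambda>c. c - 1) ` {1..<t}" by (intro image_eqI[of _ _ "Suc i"]) auto
      then show ?thesis by simp
    next
      case 3
      then have "i \<in> (\<lambda>c. g - 1 - c) ` {1..<t}" using g by (intro image_eqI[of _ _ "g - 1 - i"]) auto
      then show ?thesis by simp
    qed simp
  qed (use g t in auto)
  have "beta g (partition_of n) ` {0..<g} = insert (level_exp g n 0 - 1)
      ((\<lambda>c. level_exp g n c - 1) ` {1..<t} \<union> (\<lambda>c. int g - level_exp g n c - 1) ` {1..<t})"
  proof -
    have "(\<lambda>c. beta g (partition_of n) (c - 1)) ` {1..<t} = (\<lambda>c. level_exp g n c - 1) ` {1..<t}"
      by (rule image_cong[OF refl], rule beta_partition_of(2)[OF n]) auto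
    moreover have "(\<lambda>c. beta g (partition_of n) (g - 1 - c)) ` {1..<t} = (\<lambda>c. int g - level_exp g n c - 1) ` {1..<t}"
      by (rule image_cong[OF refl], rule beta_partition_of(3)[OF n]) auto
    ultimately show ?thesis
      by (simp only: split image_insert image_Un image_image beta_partition_of(1)[OF n])
  qed
  also have "(\<lambda>c. level_exp g n c - 1) ` {1..<t} \<union> (\<lambda>c. int g - level_exp g n c - 1) ` {1..<t} =
      (\<lambda>c. top_exp n c - 1) ` {1..<t} \<union> (\<lambda>c. int g - top_exp n c - 1) ` {1..<t}"
  proof -
    have "{level_exp g n c - 1, int g - level_exp g n c - 1} = {top_exp n c - 1, int g - top_exp n c - 1}" for c
      by (auto simp: top_exp_def max_def)
    then have "(\<Union>c\<in>{1..<t}. {level_exp g n c - 1, int g - level_exp g n c - 1}) =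
        (\<Union>c\<in>{1..<t}. {top_exp n c - 1, int g - top_exp n c - 1})" by (simp only:)
    then show ?thesis by (simp only: UN_insert_distrib set_eq_iff) blast
  qed
  also have "insert (level_exp g n 0 - 1) ((\<lambda>c. top_exp n c - 1) ` {1..<t} \<union> (\<lambda>c. int g - top_exp n c - 1) ` {1..<t}) =
      (\<lambda>c. top_exp n c - 1) ` insert 0 {1..<t} \<union> (\<lambda>c. int g - top_exp n c - 1) ` {1..<t}"
    by (simp add: n0)
  also have "insert 0 {1..<t} = {..<t}" using t by auto
  finally show ?thesis .
qed

lemma take_top_sorted:
  fixes A B :: "int set"
  assumes "finite A" "finite B" "\<And>a b. a \<in> A \<Longrightarrow> b \<in> B \<Longrightarrow> b < a"
  shows "take (card A) (rev (sorted_list_of_set (A \<union> B))) = rev (sorted_list_of_set A)"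
proof -
  have "sorted_list_of_set (A \<union> B) = sorted_list_of_set B @ sorted_list_of_set A"
  proof (rule sorted_distinct_set_unique)
    show "sorted (sorted_list_of_set B @ sorted_list_of_set A)"
      using assms by (auto simp: sorted_append intro: less_imp_le)
    show "distinct (sorted_list_of_set B @ sorted_list_of_set A)"
      using assms by auto
  qed (use assms in auto)
  then show ?thesis using assms by simp
qed

lemma top_exp_ge: "int t \<le> top_exp n c"
  unfolding top_exp_def int_g by linarith

text \<open>The larger exponents are at least t and their mirror images at most g - t = t - 1, so
  the t largest values are those of \<open>top_exp\<close>; \<open>\<sigma>\<close> sorts
  them.\<close>

lemma V_coding_partition_of:
  assumes n: "n \<in> charges t"
  obtains \<sigma> where "\<sigma> permutes {..<t}" "\<And>b. b < t \<Longrightarrow> V_coding g t (partition_of n) ! b = top_exp n (\<sigma> b) - 1"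
    "\<And>i j. i < j \<Longrightarrow> j < t \<Longrightarrow> top_exp n (\<sigma> j) < top_exp n (\<sigma> i)"
proof -
  define f where "f c = top_exp n c - 1" for c
  define A where "A = f ` {..<t}"
  have inj: "inj_on f {..<t}" using top_exp_inj[of n] by (auto simp: inj_on_def f_def)
  have cardA: "card A = t" using inj by (simp add: A_def card_image)
  define V where "V = rev (sorted_list_of_set A)"
  have "b < a" if ab: "a \<in> A" "b \<in> (\<lambda>c. int g - top_exp n c - 1) ` {1..<t}" for a b
  proof -
    obtain c c' where "a = top_exp n c - 1" "b = int g - top_exp n c' - 1"
      using ab unfolding A_def f_def by blast
    then show ?thesis using top_exp_ge[of n c] top_exp_ge[of n c'] int_g by simp
  qed
  then have V: "V_coding g t (partition_of n) = V"
    unfolding V_coding_def beta_image[OF n] V_def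
    using take_top_sorted[of A "(\<lambda>c. int g - top_exp n c - 1) ` {1..<t}"]
    by (simp add: cardA) (simp add: A_def f_def)
  have len: "length V = t" "set V = A" "distinct V" using cardA by (simp_all add: V_def A_def)
  have dec: "V ! j < V ! i" if "i < j" "j < t" for i j
  proof -
    have "sorted_wrt (>) V" unfolding V_def sorted_wrt_rev by (rule strict_sorted_list_of_set)
    then show ?thesis using that len by (simp add: sorted_wrt_iff_nth_less)
  qed
  have bV: "bij_betw ((!) V) {..<t} A" using bij_betw_nth[of V "{..<t}" A] len by simp
  have bf: "bij_betw f {..<t} A" using inj by (simp add: A_def bij_betw_def)
  define \<sigma> where "\<sigma> b = (if b < t then inv_into {..<t} f (V ! b) else b)" for b
  have "bij_betw (inv_into {..<t} f \<circ> (!) V) {..<t} {..<t}"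
    using bij_betw_trans[OF bV bij_betw_inv_into[OF bf]] .
  then have "bij_betw \<sigma> {..<t} {..<t}" by (rule bij_betw_cong[THEN iffD1, rotated]) (simp add: \<sigma>_def)
  then have "\<sigma> permutes {..<t}" by (rule bij_imp_permutes) (simp add: \<sigma>_def)
  moreover have Vs: "V ! b = f (\<sigma> b)" if "b < t" for b
  proof -
    have "V ! b \<in> f ` {..<t}" using that len by (metis A_def nth_mem)
    then show ?thesis using that by (simp add: \<sigma>_def f_inv_into_f)
  qed
  ultimately show thesis
    using that[of \<sigma>] dec V by (simp add: f_def)
qed

section \<open>Residue classes of the bead set\<close>

definition run :: "int \<Rightarrow> int set \<Rightarrow> int set" where
  "run c K = (\<lambda>k. int g * k + c) ` K"

definition cross :: "int set \<Rightarrow> int set \<Rightarrow> (int \<times> int) set" where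
  "cross A B = {(a, b). a \<in> A \<and> b \<in> B \<and> 0 < a + b \<and> a + b < int g}"

lemma level_pos_iff:
  fixes m d :: int
  assumes "\<bar>d\<bar> < int g"
  shows "0 < int g * m + d \<longleftrightarrow> 1 \<le> m \<or> (m = 0 \<and> 0 < d)"
proof (cases m "0 :: int" rule: linorder_cases)
  case less
  then have "int g * m \<le> int g * (- 1)" by (intro mult_left_mono) auto
  then show ?thesis using less assms by auto
next
  case greater
  then have "int g * 1 \<le> int g * m" by (intro mult_left_mono) auto
  then show ?thesis using greater assms by auto
qed auto

text \<open>The sum of two beads from given residues has the form g m + d. It is a counted hook
  length for exactly one m, so each bead has at most one partner in a given residue.\<close>

lemma window_iff:
  fixes m d :: int
  assumes "\<bar>d\<bar> < int g" "d \<noteq> 0"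
  shows "0 < int g * m + d \<and> int g * m + d < int g \<longleftrightarrow> m = (if 0 < d then 0 else 1)"
proof -
  have eq: "int g * m + d < int g \<longleftrightarrow> 0 < int g * (1 - m) + - d" by (simp add: algebra_simps)
  show ?thesis
    unfolding eq using level_pos_iff[of d m] level_pos_iff[of "- d" "1 - m"] assms by auto
qed

lemma window_0: "\<not> (0 < int g * m \<and> int g * m < int g)"
proof -
  have "int g * m < int g * 1 \<longleftrightarrow> m < 1" using g_gt_0 by (simp add: mult_less_cancel_left_pos)
  moreover have "0 < int g * m \<longleftrightarrow> 0 < m" using g_gt_0 by (simp add: zero_less_mult_iff)
  ultimately show ?thesis by auto
qed

lemma cross_run:
  fixes e :: int
  assumes "\<bar>c + c'\<bar> < int g" "c + c' \<noteq> 0"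
    and e_def: "e = (if 0 < c + c' then 0 else 1)"
  shows "card (cross (run c K) (run c' K')) = card {k \<in> K. e - k \<in> K'}"
proof -
  let ?f = "\<lambda>k. (int g * k + c, int g * (e - k) + c')"
  have "cross (run c K) (run c' K') = ?f ` {k \<in> K. e - k \<in> K'}"
  proof (intro equalityI subsetI)
    fix q assume "q \<in> cross (run c K) (run c' K')"
    then obtain k k' where k: "k \<in> K" "k' \<in> K'" "q = (int g * k + c, int g * k' + c')"
      and s: "0 < (int g * k + c) + (int g * k' + c')" "(int g * k + c) + (int g * k' + c') < int g"
      by (auto simp: cross_def run_def)
    have "(int g * k + c) + (int g * k' + c') = int g * (k + k') + (c + c')" by (simp add: algebra_simps)
    then have "k + k' = e" using s window_iff[OF assms(1,2), of "k + k'"] unfolding e_def by simp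
    then have "k' = e - k" by simp
    then show "q \<in> ?f ` {k \<in> K. e - k \<in> K'}" using k by auto
  next
    fix q assume "q \<in> ?f ` {k \<in> K. e - k \<in> K'}"
    then obtain k where k: "k \<in> K" "e - k \<in> K'" "q = ?f k" by auto
    have "(int g * k + c) + (int g * (e - k) + c') = int g * e + (c + c')" by (simp add: algebra_simps)
    then show "q \<in> cross (run c K) (run c' K')"
      using k window_iff[OF assms(1,2), of e] unfolding e_def[symmetric] by (auto simp: cross_def run_def)
  qed
  moreover have "inj_on ?f {k \<in> K. e - k \<in> K'}" using g_gt_0 by (auto simp: inj_on_def)
  ultimately show ?thesis by (simp add: card_image)
qed

lemma run_pos: "{s \<in> run c K. 0 < s} = run c {k \<in> K. 0 < int g * k + c}"
  by (auto simp: run_def)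

lemma in_runI: "k \<in> K \<Longrightarrow> int g * k + c \<in> run c K"
  unfolding run_def by (rule imageI)

lemma run_disjoint:
  assumes "0 < c" "c < t"
  shows "run (int c) K \<inter> run (- int c) K' = {}"
proof -
  have "x mod int g = int c" if "x \<in> run (int c) K" for x
    using that residue_simps(2)[OF assms(2)] by (auto simp: run_def)
  moreover have "x mod int g = int g - int c" if "x \<in> run (- int c) K'" for x
    using that residue_simps(4)[OF assms(2,1)] by (auto simp: run_def)
  moreover have "int c \<noteq> int g - int c" using int_g by presburger
  ultimately show ?thesis by (metis disjoint_iff)
qed

definition nzclass :: "(nat \<Rightarrow> int) \<Rightarrow> nat \<Rightarrow> int set" where
  "nzclass n c = {s \<in> charge_set n - {0}. cls t s = c}"

lemma cls_vals:
  assumes "c < t"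
  shows "cls t (int g * q + int c) = c" "cls t (int g * q - int c) = c"
proof -
  show 1: "cls t (int g * q + int c) = c" for q using alcove_shift(1)[OF assms, of q, folded g] .
  have "int g * q - int c = int g - (int g * (1 - q) + int c)" by (simp add: algebra_simps)
  then show "cls t (int g * q - int c) = c" using cls_reflect 1 by metis
qed

lemma nzclass_pos:
  assumes "0 < c" "c < t"
  shows "nzclass n c = run (int c) {..<n c} \<union> run (- int c) {..- n c}"
proof (intro equalityI subsetI)
  fix s assume s: "s \<in> nzclass n c"
  show "s \<in> run (int c) {..<n c} \<union> run (- int c) {..- n c}"
  proof (cases s rule: int_residue_cases)
    case (zero q)
    then show ?thesis using s cls_vals(1)[OF t, of q] assms by (simp add: nzclass_def)
  next
    case (pos q c')
    then show ?thesis using s cls_vals(1)[of c' q] charge_set_iff(1)[of c' q n]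
      by (auto simp: nzclass_def run_def)
  next
    case (neg q c')
    then show ?thesis using s cls_vals(2)[of c' q] charge_set_iff(2)[of c' q n]
      by (auto simp: nzclass_def run_def)
  qed
next
  fix s assume "s \<in> run (int c) {..<n c} \<union> run (- int c) {..- n c}"
  then consider q where "q < n c" "s = int g * q + int c" | q where "q \<le> - n c" "s = int g * q - int c"
    by (auto simp: run_def)
  then show "s \<in> nzclass n c"
  proof cases
    case 1
    have "s mod int g = int c" unfolding 1(2) by (rule residue_simps(2)[OF assms(2)])
    then have "s \<noteq> 0" using assms by auto
    then show ?thesis using 1 cls_vals(1)[OF assms(2)] charge_set_iff(1)[OF assms(2,1)] by (simp add: nzclass_def)
  next
    case 2
    have "s mod int g = int g - int c" unfolding 2(2) by (rule residue_simps(4)[OF assms(2,1)])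
    then have "s \<noteq> 0" using assms int_g by auto
    then show ?thesis using 2 cls_vals(2)[OF assms(2)] charge_set_iff(2)[OF assms(2,1)] by (simp add: nzclass_def)
  qed
qed

lemma nzclass_0:
  assumes "n \<in> charges t"
  shows "nzclass n 0 = run 0 ({..- n 0} \<union> {1..<n 0})"
proof -
  note n0 = charges_0[OF assms]
  have "s \<in> nzclass n 0 \<longleftrightarrow> (\<exists>q. s = int g * q \<and> (q \<le> - n 0 \<or> (1 \<le> q \<and> q < n 0)))" for s
  proof
    assume s: "s \<in> nzclass n 0"
    show "\<exists>q. s = int g * q \<and> (q \<le> - n 0 \<or> (1 \<le> q \<and> q < n 0))"
    proof (cases s rule: int_residue_cases)
      case (zero q)
      then have "q \<noteq> 0" "q \<le> - n 0 \<or> (0 \<le> q \<and> q < n 0)"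
        using s charge_set_iff(3)[OF t, of q n] by (auto simp: nzclass_def)
      then have "q \<le> - n 0 \<or> (1 \<le> q \<and> q < n 0)" by auto
      then show ?thesis using zero by blast
    next
      case (pos q c')
      then show ?thesis using s cls_vals(1)[of c' q] by (simp add: nzclass_def)
    next
      case (neg q c')
      then show ?thesis using s cls_vals(2)[of c' q] by (simp add: nzclass_def)
    qed
  next
    assume "\<exists>q. s = int g * q \<and> (q \<le> - n 0 \<or> (1 \<le> q \<and> q < n 0))"
    then obtain q where q: "s = int g * q" "q \<le> - n 0 \<or> (1 \<le> q \<and> q < n 0)" by blast
    then have "s \<noteq> 0" using n0 g_gt_0 by auto
    then show "s \<in> nzclass n 0"
      using q charge_set_iff(3)[OF t, of q n] cls_vals(1)[OF t, of q] by (auto simp: nzclass_def)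
  qed
  then have "s \<in> nzclass n 0 \<longleftrightarrow> s \<in> run 0 ({..- n 0} \<union> {1..<n 0})" for s
    unfolding run_def by auto
  then show ?thesis by blast
qed

section \<open>Size and Durfee square\<close>

lemma sum_run_nat:
  "(\<Sum>k\<in>{0..<int m}. int g * k + c) = int m * c + int g * int (triang (int m))"
proof (induction m)
  case (Suc m)
  have "{0..<int (Suc m)} = insert (int m) {0..<int m}" by auto
  then have "(\<Sum>k\<in>{0..<int (Suc m)}. int g * k + c) = (int g * int m + c) + (\<Sum>k\<in>{0..<int m}. int g * k + c)"
    by simp
  also have "\<dots> = int (Suc m) * c + int g * (int (triang (int m)) + int m)"
    unfolding Suc by (simp add: algebra_simps)
  also have "int (triang (int m)) + int m = int (triang (int m + 1))" by (rule triang_Suc[symmetric])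
  finally show ?case by (simp add: add.commute)
qed (simp add: triang_def)

lemma sum_run_nat_neg:
  "(\<Sum>k\<in>{1..int m}. int g * k - c) = - int m * c + int g * int (triang (- int m))"
proof (induction m)
  case (Suc m)
  have "{1..int (Suc m)} = insert (int (Suc m)) {1..int m}" by auto
  then have "(\<Sum>k\<in>{1..int (Suc m)}. int g * k - c) = (int g * int (Suc m) - c) + (\<Sum>k\<in>{1..int m}. int g * k - c)"
    by simp
  also have "\<dots> = - int (Suc m) * c + int g * (int (triang (- int m)) + int (Suc m))"
    unfolding Suc by (simp add: algebra_simps)
  also have "int (triang (- int m)) + int (Suc m) = int (triang (- int (Suc m)))"
    using triang_Suc[of "- int (Suc m)"] by simp
  finally show ?case .
qed (simp add: triang_def)

definition posclass :: "(nat \<Rightarrow> int) \<Rightarrow> nat \<Rightarrow> int set" where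
  "posclass n c = {s \<in> nzclass n c. 0 < s}"

lemma posclass_pos:
  assumes c: "0 < c" "c < t"
  shows "posclass n c = (if 0 \<le> n c then run (int c) {0..<n c} else run (- int c) {1..- n c})"
proof -
  have b: "\<bar>int c\<bar> < int g" "\<bar>- int c\<bar> < int g" using c int_g by auto
  have 1: "0 < int g * k + int c \<longleftrightarrow> 0 \<le> k" for k using level_pos_iff[OF b(1), of k] c by auto
  have 2: "0 < int g * k + - int c \<longleftrightarrow> 1 \<le> k" for k using level_pos_iff[OF b(2), of k] c by auto
  have "posclass n c = {s \<in> run (int c) {..<n c}. 0 < s} \<union> {s \<in> run (- int c) {..- n c}. 0 < s}"
    unfolding posclass_def nzclass_pos[OF c] by auto
  also have "\<dots> = run (int c) {0..<n c} \<union> run (- int c) {1..- n c}"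
  proof -
    have "{k \<in> {..<n c}. 0 \<le> k} = {0..<n c}" "{k \<in> {..- n c}. 1 \<le> k} = {1..- n c}" by auto
    then show ?thesis unfolding run_pos 1 2 by simp
  qed
  finally show ?thesis by (simp add: run_def)
qed

lemma posclass_0:
  assumes "n \<in> charges t"
  shows "posclass n 0 = run 0 {1..<n 0}"
proof -
  have pos: "0 < int g * k + 0 \<longleftrightarrow> 1 \<le> k" for k
    using level_pos_iff[of 0 k] g_gt_0 by simp
  have "{k \<in> {..- n 0} \<union> {1..<n 0}. 1 \<le> k} = {1..<n 0}"
    using charges_0[OF assms] by auto
  then show ?thesis
    unfolding posclass_def nzclass_0[OF assms] run_pos pos by (rule arg_cong)
qed

lemma sum_run: "(\<Sum>s\<in>run c K. s) = (\<Sum>k\<in>K. int g * k + c)"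
  unfolding run_def using g_gt_0 by (subst sum.reindex) (auto simp: inj_on_def)

lemma card_run: "card (run c K) = card K"
  unfolding run_def using g_gt_0 by (intro card_image) (auto simp: inj_on_def)

lemma lexp_en1: "c < t \<Longrightarrow> int (en1 t (level_exp g n c)) = n c * int c + int g * int (triang (n c))"
  using alcove_shift(3)[of c t "n c", folded g] by (simp add: level_exp_def)

text \<open>The positive beads of a class form one arithmetic progression of step g, on residue c or
  on residue g - c according to the sign of \<open>n c\<close>. For class 0 the missing bead 0
  contributes nothing to the sum.\<close>

lemma posclass_sum:
  assumes n: "n \<in> charges t" and c: "c < t"
  shows "(\<Sum>s\<in>posclass n c. s) = int (en1 t (level_exp g n c))"
proof (cases "c = 0")
  case True
  have n0: "1 \<le> n 0" by (rule charges_0[OF n])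
  have "{0..<n 0} = insert 0 {1..<n 0}" using n0 by auto
  then have "(\<Sum>s\<in>posclass n 0. s) = (\<Sum>k\<in>{0..<int (nat (n 0))}. int g * k + 0)"
    using n0 by (simp add: posclass_0[OF n] sum_run)
  also have "\<dots> = int (en1 t (level_exp g n 0))"
    unfolding sum_run_nat lexp_en1[OF t] using n0 by simp
  finally show ?thesis unfolding True .
next
  case False
  then have c': "0 < c" by simp
  show ?thesis
  proof (cases "0 \<le> n c")
    case True
    then show ?thesis
      using sum_run_nat[where m = "nat (n c)" and c = "int c"] by (simp add: posclass_pos[OF c' c] sum_run lexp_en1[OF c])
  next
    case False
    then show ?thesis
      using sum_run_nat_neg[where m = "nat (- n c)" and c = "int c"] by (simp add: posclass_pos[OF c' c] sum_run lexp_en1[OF c])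
  qed
qed

lemma minus_one_power_nat: "0 \<le> m \<Longrightarrow> (- 1) ^ nat m = (msgn m :: 'a::comm_ring_1)"
  by (simp add: msgn_def minus_one_power_iff even_nat_iff)

text \<open>For c = 0 the bead at 0 does not count as positive, which leaves \<open>n 0 - 1\<close>
  beads and accounts for the extra sign.\<close>

lemma posclass_card:
  assumes n: "n \<in> charges t" and c: "c < t"
  shows "(- 1 :: 'a::comm_ring_1) ^ card (posclass n c) = (if c = 0 then - 1 else 1) * msgn (n c)"
proof (cases "c = 0")
  case True
  have n0: "1 \<le> n 0" by (rule charges_0[OF n])
  then have "(- 1 :: 'a) ^ card (posclass n c) = (- 1) ^ nat (n 0 - 1)"
    by (simp add: True posclass_0[OF n] card_run)
  also have "\<dots> = msgn (n 0 - 1)" using n0 by (intro minus_one_power_nat) simp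
  finally show ?thesis using True by (simp add: msgn_diff)
next
  case False
  then have "(- 1 :: 'a) ^ card (posclass n c) = (- 1) ^ nat \<bar>n c\<bar>"
    using c by (simp add: posclass_pos card_run)
  also have "\<dots> = msgn \<bar>n c\<bar>" by (intro minus_one_power_nat) simp
  finally show ?thesis using False by (simp add: msgn_def)
qed

lemma pos_cbeads_partition_of:
  assumes n: "n \<in> charges t"
  shows "int (sum_list (partition_of n)) = 2 * (\<Sum>c<t. int (en1 t (level_exp g n c)))"
    and "(- 1 :: 'a::comm_ring_1) ^ durfee (partition_of n) = - (\<Prod>c<t. msgn (n c))"
proof -
  let ?lam = "partition_of n" and ?P = "pos_cbeads (partition_of n)"
  note po = partition_of[OF n]
  have dd: "?lam \<in> DD_conj" using po reflective_charge_set[OF n] by (simp add: DD_conj_iff)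
  have P: "{s \<in> ?P. cls t s = c} = posclass n c" for c
    by (auto simp: pos_cbeads_def po(2) posclass_def nzclass_def)
  have fin: "finite ?P" by (rule size_DD_conj(2)[OF dd])
  have "(\<Sum>s\<in>?P. s) = (\<Sum>c<t. \<Sum>s\<in>{s \<in> ?P. cls t s = c}. s)"
    using fin cls_less[OF t] by (intro sum.group[symmetric]) auto
  also have "\<dots> = (\<Sum>c<t. int (en1 t (level_exp g n c)))"
    unfolding P by (intro sum.cong refl posclass_sum[OF n]) simp
  finally show "int (sum_list ?lam) = 2 * (\<Sum>c<t. int (en1 t (level_exp g n c)))"
    using size_DD_conj(1)[OF dd] by simp
  have "card ?P = (\<Sum>c<t. card {s \<in> ?P. cls t s = c})"
    using sum.group[of ?P "{..<t}" "cls t" "\<lambda>_. 1 :: nat"] fin cls_less[OF t] by (simp add: image_subset_iff)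
  then have "(- 1 :: 'a) ^ durfee ?lam = (\<Prod>c<t. (- 1) ^ card (posclass n c))"
    unfolding durfee_eq_card[OF po(1)] P by (simp add: power_sum)
  also have "\<dots> = (\<Prod>c<t. (if c = 0 then - 1 else 1) * msgn (n c))"
    by (intro prod.cong refl posclass_card[OF n]) simp
  also have "\<dots> = - (\<Prod>c<t. msgn (n c))"
    using t by (simp add: prod.distrib)
  finally show "(- 1 :: 'a) ^ durfee ?lam = - (\<Prod>c<t. msgn (n c))" .
qed

section \<open>Signs of the summands\<close>

text \<open>One of the two truncated numbers is 0: their sum is k - 1 for k >= 1 and - k
  otherwise.\<close>

lemma parity_pair:
  "(- 1 :: 'a::comm_ring_1) ^ (nat (k - 1) + nat (- k)) = msgn k * (if 1 \<le> k then - 1 else 1)"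
  using minus_one_power_nat[of "k - 1", where 'a = 'a] minus_one_power_nat[of "- k", where 'a = 'a]
  by (simp add: msgn_diff power_add)

lemma finite_cross_if_strict:
  assumes "finite (strict_pairs g A)" "U \<subseteq> A" "Y \<subseteq> A" "U \<inter> Y = {}"
  shows "finite (cross U Y)"
proof -
  have "cross U Y \<subseteq> strict_pairs g A \<union> prod.swap ` strict_pairs g A"
  proof clarify
    fix a b assume ab: "(a, b) \<in> cross U Y" "(a, b) \<notin> prod.swap ` strict_pairs g A"
    then have *: "a \<in> A" "b \<in> A" "0 < a + b" "a + b < int g" "a \<noteq> b" using assms by (auto simp: cross_def)
    show "(a, b) \<in> strict_pairs g A"
    proof (cases "b < a")
      case False
      then have "(b, a) \<in> strict_pairs g A" using * by (auto simp: strict_pairs_def)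
      then show ?thesis using ab(2) by (force simp: image_iff)
    qed (use * in \<open>auto simp: strict_pairs_def\<close>)
  qed
  then show ?thesis using assms(1) finite_subset by blast
qed

text \<open>Pairs are sorted by their unordered pair of classes. If the classes differ, the larger
  element may belong to either, so ordering by size is exchanged for ordering by class.\<close>

lemma strict_pairs_decompose:
  assumes fin: "finite (strict_pairs g A)" and k: "\<And>a. a \<in> A \<Longrightarrow> k a < t"
  shows "card (strict_pairs g A) = (\<Sum>i<t. card (strict_pairs g {a \<in> A. k a = i})) +
    (\<Sum>(i, j)\<in>lt_pairs t. card (cross {a \<in> A. k a = i} {a \<in> A. k a = j}))"
proof -
  let ?S = "strict_pairs g A"
  define key where "key = (\<lambda>(a, b). (min (k a) (k b), max (k a) (k b)))"
  let ?D = "(\<lambda>i. (i, i)) ` {..<t}"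
  have im: "key ` ?S \<subseteq> ?D \<union> lt_pairs t"
    using k by (fastforce simp: key_def strict_pairs_def lt_pairs_def min_def max_def)
  have "card ?S = (\<Sum>\<kappa>\<in>?D \<union> lt_pairs t. card {q \<in> ?S. key q = \<kappa>})"
    using sum.group[of ?S "?D \<union> lt_pairs t" key "\<lambda>_. 1 :: nat"] fin im by simp
  also have "\<dots> = (\<Sum>\<kappa>\<in>?D. card {q \<in> ?S. key q = \<kappa>}) + (\<Sum>\<kappa>\<in>lt_pairs t. card {q \<in> ?S. key q = \<kappa>})"
    by (rule sum.union_disjoint, simp, simp) (auto simp: lt_pairs_def)
  also have "(\<Sum>\<kappa>\<in>?D. card {q \<in> ?S. key q = \<kappa>}) = (\<Sum>i<t. card (strict_pairs g {a \<in> A. k a = i}))"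
  proof (subst sum.reindex)
    have "{q \<in> ?S. key q = (i, i)} = strict_pairs g {a \<in> A. k a = i}" for i
      by (auto simp: key_def strict_pairs_def min_def max_def split: if_splits)
    then show "(\<Sum>i<t. ((\<lambda>\<kappa>. card {q \<in> ?S. key q = \<kappa>}) \<circ> (\<lambda>i. (i, i))) i) =
        (\<Sum>i<t. card (strict_pairs g {a \<in> A. k a = i}))" by simp
  qed (auto simp: inj_on_def)
  also have "(\<Sum>\<kappa>\<in>lt_pairs t. card {q \<in> ?S. key q = \<kappa>}) =
      (\<Sum>(i, j)\<in>lt_pairs t. card (cross {a \<in> A. k a = i} {a \<in> A. k a = j}))"
  proof (intro sum.cong refl, clarify)
    fix i j assume "(i, j) \<in> lt_pairs t"
    then have ij: "i < j" by (simp add: lt_pairs_def)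
    have "bij_betw (\<lambda>(a, b). (max a b, min a b)) (cross {a \<in> A. k a = i} {a \<in> A. k a = j}) {q \<in> ?S. key q = (i, j)}"
    proof (rule bij_betwI[of _ _ _ "\<lambda>(a, b). if k a = i then (a, b) else (b, a)"])
      show "(\<lambda>(a, b). (max a b, min a b)) \<in> cross {a \<in> A. k a = i} {a \<in> A. k a = j} \<rightarrow> {q \<in> ?S. key q = (i, j)}"
      proof clarify
        fix a b assume "(a, b) \<in> cross {a \<in> A. k a = i} {a \<in> A. k a = j}"
        then have *: "a \<in> A" "b \<in> A" "k a = i" "k b = j" "0 < a + b" "a + b < int g" "a \<noteq> b"
          using ij by (auto simp: cross_def)
        show "(max a b, min a b) \<in> ?S \<and> key (max a b, min a b) = (i, j)"
          using * ij by (cases "a < b") (auto simp: key_def strict_pairs_def min_def max_def)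
      qed
      show "(\<lambda>(a, b). if k a = i then (a, b) else (b, a)) \<in> {q \<in> ?S. key q = (i, j)} \<rightarrow> cross {a \<in> A. k a = i} {a \<in> A. k a = j}"
      proof clarify
        fix a b assume "(a, b) \<in> ?S" "key (a, b) = (i, j)"
        then show "(if k a = i then (a, b) else (b, a)) \<in> cross {a \<in> A. k a = i} {a \<in> A. k a = j}"
          using ij by (auto simp: key_def strict_pairs_def cross_def min_def max_def add.commute split: if_splits)
      qed
      show "(\<lambda>(a, b). if k a = i then (a, b) else (b, a)) ((\<lambda>(a, b). (max a b, min a b)) q) = q"
        if "q \<in> cross {a \<in> A. k a = i} {a \<in> A. k a = j}" for q
        using that ij by (auto simp: cross_def min_def max_def split: if_splits)
      show "(\<lambda>(a, b). (max a b, min a b)) ((\<lambda>(a, b). if k a = i then (a, b) else (b, a)) q) = q"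
        if "q \<in> {q \<in> ?S. key q = (i, j)}" for q
        using that by (auto simp: strict_pairs_def min_def max_def)
    qed
    from bij_betw_same_card[OF this]
    show "card {q \<in> ?S. key q = (i, j)} = card (cross {a \<in> A. k a = i} {a \<in> A. k a = j})" by simp
  qed
  finally show ?thesis .
qed

section \<open>Parities of the pair counts between and within classes\<close>

lemma cross_Un:
  "cross (U \<union> U') Y = cross U Y \<union> cross U' Y" "cross U (Y \<union> Y') = cross U Y \<union> cross U Y'"
  by (auto simp: cross_def)

lemma card_cross_Un:
  assumes "finite (cross (U \<union> U') Y)" "U \<inter> U' = {}"
  shows "card (cross (U \<union> U') Y) = card (cross U Y) + card (cross U' Y)"
  using assms unfolding cross_Un by (intro card_Un_disjoint) (auto simp: cross_def)

lemma card_cross_Un2: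
  assumes "finite (cross U (Y \<union> Y'))" "Y \<inter> Y' = {}"
  shows "card (cross U (Y \<union> Y')) = card (cross U Y) + card (cross U Y')"
  using assms unfolding cross_Un by (intro card_Un_disjoint) (auto simp: cross_def)

text \<open>There are four combinations of the residues +c, -c with +c', -c'. Opposite combinations
  pair up by \<open>parity_pair\<close> at n c + n c' and n c - n c', which have equal parity, so
  only the threshold signs remain.\<close>

lemma card_cross_pos:
  assumes c: "0 < c" "c < c'" "c' < t" and fin: "finite (cross (nzclass n c) (nzclass n c'))"
  shows "(- 1 :: int) ^ card (cross (nzclass n c) (nzclass n c')) =
    (if 1 \<le> n c + n c' then - 1 else 1) * (if 1 \<le> n c - n c' then - 1 else 1)"
proof -
  let ?p = "n c" and ?q = "n c'"
  have c': "0 < c'" "c < t" using c by auto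
  have dc: "run (int c) {..<?p} \<inter> run (- int c) {..- ?p} = {}" by (rule run_disjoint) (use c in auto)
  have dc': "run (int c') {..<?q} \<inter> run (- int c') {..- ?q} = {}" by (rule run_disjoint) (use c in auto)
  note fin' = fin[unfolded nzclass_pos[OF c(1) c'(2)] nzclass_pos[OF c'(1) c(3)]]
  have f1: "finite (cross (run (int c) {..<?p}) (run (int c') {..<?q} \<union> run (- int c') {..- ?q}))"
    "finite (cross (run (- int c) {..- ?p}) (run (int c') {..<?q} \<union> run (- int c') {..- ?q}))"
    using fin' unfolding cross_Un(1) by auto
  have lt: "\<bar>int c + int c'\<bar> < int g" "\<bar>int c + - int c'\<bar> < int g" "\<bar>- int c + int c'\<bar> < int g" "\<bar>- int c + - int c'\<bar> < int g"
    using c int_g by auto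
  have 1: "card (cross (run (int c) {..<?p}) (run (int c') {..<?q})) = nat (?p + ?q - 1)"
  proof -
    have "{k \<in> {..<?p}. 0 - k \<in> {..<?q}} = {1 - ?q..?p - 1}" by auto
    then show ?thesis using cross_run[OF lt(1), of 0 "{..<?p}" "{..<?q}"] c by (simp add: algebra_simps)
  qed
  have 2: "card (cross (run (int c) {..<?p}) (run (- int c') {..- ?q})) = nat (?p - ?q - 1)"
  proof -
    have "{k \<in> {..<?p}. 1 - k \<in> {..- ?q}} = {1 + ?q..?p - 1}" by auto
    then show ?thesis using cross_run[OF lt(2), of 1 "{..<?p}" "{..- ?q}"] c by (simp add: algebra_simps)
  qed
  have 3: "card (cross (run (- int c) {..- ?p}) (run (int c') {..<?q})) = nat (- (?p - ?q))"
  proof -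
    have "{k \<in> {..- ?p}. 0 - k \<in> {..<?q}} = {1 - ?q..- ?p}" by auto
    then show ?thesis using cross_run[OF lt(3), of 0 "{..- ?p}" "{..<?q}"] c by (simp add: algebra_simps)
  qed
  have 4: "card (cross (run (- int c) {..- ?p}) (run (- int c') {..- ?q})) = nat (- (?p + ?q))"
  proof -
    have "{k \<in> {..- ?p}. 1 - k \<in> {..- ?q}} = {1 + ?q..- ?p}" by auto
    then show ?thesis using cross_run[OF lt(4), of 1 "{..- ?p}" "{..- ?q}"] c by (simp add: algebra_simps)
  qed
  have "card (cross (nzclass n c) (nzclass n c')) =
      (nat (?p + ?q - 1) + nat (- (?p + ?q))) + (nat (?p - ?q - 1) + nat (- (?p - ?q)))"
    unfolding nzclass_pos[OF c(1) c'(2)] nzclass_pos[OF c'(1) c(3)]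
    unfolding card_cross_Un[OF fin' dc] card_cross_Un2[OF f1(1) dc'] card_cross_Un2[OF f1(2) dc'] 1 2 3 4
    by simp
  then have "(- 1 :: int) ^ card (cross (nzclass n c) (nzclass n c')) =
    (msgn (?p + ?q) * (if 1 \<le> ?p + ?q then - 1 else 1)) * (msgn (?p - ?q) * (if 1 \<le> ?p - ?q then - 1 else 1))"
    by (simp only: power_add[of _ "nat (?p + ?q - 1) + nat (- (?p + ?q))"] parity_pair)
  also have "\<dots> = (if 1 \<le> ?p + ?q then - 1 else 1) * (if 1 \<le> ?p - ?q then - 1 else 1)"
  proof -
    have m: "msgn (?p + ?q) = (msgn (?p - ?q) :: int)" by (simp add: msgn_add msgn_diff)
    have "(msgn (?p - ?q) * x) * (msgn (?p - ?q) * y) = (msgn (?p - ?q) * msgn (?p - ?q)) * (x * y)" for x y :: int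
      by (simp only: mult_ac)
    then show ?thesis unfolding m by simp
  qed
  finally show ?thesis .
qed

text \<open>Class 0 is a single residue, so here the parity of \<open>n c\<close> survives; it
  cancels against \<open>card_strict_pos\<close>.\<close>

lemma card_cross_0:
  assumes n: "n \<in> charges t" and c: "0 < c" "c < t" and fin: "finite (cross (nzclass n 0) (nzclass n c))"
  shows "(- 1 :: int) ^ card (cross (nzclass n 0) (nzclass n c)) =
    msgn (n c) * ((if 1 \<le> n 0 + n c then - 1 else 1) * (if 1 \<le> n 0 - n c then - 1 else 1))"
proof -
  let ?p = "n 0" and ?q = "n c" and ?K = "{..- n 0} \<union> {1..<n 0}"
  have n0: "1 \<le> ?p" by (rule charges_0[OF n])
  have dc: "run (int c) {..<?q} \<inter> run (- int c) {..- ?q} = {}" by (rule run_disjoint) (use c in auto)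
  have lt: "\<bar>0 + int c\<bar> < int g" "\<bar>0 + - int c\<bar> < int g" using c int_g by auto
  have 1: "card (cross (run 0 ?K) (run (int c) {..<?q})) = nat (?q - ?p) + nat (?p - max 1 (1 - ?q))"
  proof -
    have "{k \<in> ?K. 0 - k \<in> {..<?q}} = {1 - ?q..- ?p} \<union> {max 1 (1 - ?q)..?p - 1}" by auto
    moreover have "card ({1 - ?q..- ?p} \<union> {max 1 (1 - ?q)..?p - 1}) = card {1 - ?q..- ?p} + card {max 1 (1 - ?q)..?p - 1}"
      using n0 by (intro card_Un_disjoint) auto
    ultimately show ?thesis using cross_run[OF lt(1), of 0 ?K "{..<?q}"] c by simp
  qed
  have 2: "card (cross (run 0 ?K) (run (- int c) {..- ?q})) = nat (- ?q - ?p) + nat (?p - max 1 (1 + ?q))"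
  proof -
    have "{k \<in> ?K. 1 - k \<in> {..- ?q}} = {1 + ?q..- ?p} \<union> {max 1 (1 + ?q)..?p - 1}" by auto
    moreover have "card ({1 + ?q..- ?p} \<union> {max 1 (1 + ?q)..?p - 1}) = card {1 + ?q..- ?p} + card {max 1 (1 + ?q)..?p - 1}"
      using n0 by (intro card_Un_disjoint) auto
    ultimately show ?thesis using cross_run[OF lt(2), of 1 ?K "{..- ?q}"] c by simp
  qed
  have card: "card (cross (nzclass n 0) (nzclass n c)) =
      nat (?q - ?p) + nat (?p - max 1 (1 - ?q)) + (nat (- ?q - ?p) + nat (?p - max 1 (1 + ?q)))"
    using fin unfolding nzclass_0[OF n] nzclass_pos[OF c]
    by (subst card_cross_Un2[OF _ dc]) (simp_all only: 1 2)
  \<comment> \<open>The closed form separates |n c| < n 0 from the opposite case, which is also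
    where the product of the two threshold signs changes.\<close>
  have "int (card (cross (nzclass n 0) (nzclass n c))) =
      (if \<bar>?q\<bar> < ?p then 2 * (?p - 1) - \<bar>?q\<bar> else \<bar>?q\<bar> - 1)"
    unfolding card using n0 by (auto simp: max_def abs_if)
  then have "even (card (cross (nzclass n 0) (nzclass n c))) \<longleftrightarrow> (even ?q \<longleftrightarrow> \<bar>?q\<bar> < ?p)"
    by (metis even_abs_add_iff even_diff even_mult_iff even_numeral even_of_nat odd_one abs_abs add_0 even_add dvd_triv_left)
  moreover have "\<bar>?q\<bar> < ?p \<longleftrightarrow> (1 \<le> ?p + ?q \<longleftrightarrow> 1 \<le> ?p - ?q)" using n0 by auto
  ultimately show ?thesis
    by (simp add: minus_one_power_iff msgn_def)
qed

text \<open>Within residue c the levels k and -k are partners, within residue -c the levels k and 1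
  - k. Mixed pairs have a multiple of g as sum and never count.\<close>

lemma card_strict_pos:
  assumes c: "0 < c" "c < t" and fin: "finite (strict_pairs g (nzclass n c))"
  shows "(- 1 :: int) ^ card (strict_pairs g (nzclass n c)) = msgn (n c) * (if 1 \<le> n c then - 1 else 1)"
proof -
  let ?p = "n c"
  let ?f = "\<lambda>k. (int g * k + int c, int g * (- k) + int c)" and ?h = "\<lambda>k. (int g * k + - int c, int g * (1 - k) + - int c)"
  have lt: "\<bar>int c + int c\<bar> < int g" "\<bar>- int c + - int c\<bar> < int g" using c int_g by auto
  have less: "int g * k' + d < int g * k + d \<longleftrightarrow> k' < k" for k k' d
    using g_gt_0 by (simp add: mult_less_cancel_left_pos)
  have w1: "0 < (int g * k + int c) + (int g * k' + int c) \<and> (int g * k + int c) + (int g * k' + int c) < int g \<longleftrightarrow> k + k' = 0" for k k'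
  proof -
    have eq: "(int g * k + int c) + (int g * k' + int c) = int g * (k + k') + (int c + int c)" by (simp add: algebra_simps)
    show ?thesis unfolding eq using window_iff[OF lt(1), of "k + k'"] c by simp
  qed
  have w2: "0 < (int g * k + - int c) + (int g * k' + - int c) \<and> (int g * k + - int c) + (int g * k' + - int c) < int g \<longleftrightarrow> k + k' = 1" for k k'
  proof -
    have eq: "(int g * k + - int c) + (int g * k' + - int c) = int g * (k + k') + (- int c + - int c)" by (simp add: algebra_simps)
    show ?thesis unfolding eq using window_iff[OF lt(2), of "k + k'"] c by simp
  qed
  have w3: "\<not> (0 < (int g * k + int c) + (int g * k' + - int c) \<and> (int g * k + int c) + (int g * k' + - int c) < int g)" for k k'
  proof -
    have "(int g * k + int c) + (int g * k' + - int c) = int g * (k + k')" by (simp add: algebra_simps)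
    then show ?thesis using window_0[of "k + k'"] by simp
  qed
  have eq: "strict_pairs g (nzclass n c) = ?f ` {1..?p - 1} \<union> ?h ` {1..- ?p}"
  proof (intro equalityI subsetI)
    fix z assume "z \<in> strict_pairs g (nzclass n c)"
    then obtain a b where z: "z = (a, b)" "a \<in> nzclass n c" "b \<in> nzclass n c" "b < a" "0 < a + b" "a + b < int g"
      by (auto simp: strict_pairs_def)
    have disj: "(\<exists>k<?p. s = int g * k + int c) \<or> (\<exists>k\<le>- ?p. s = int g * k + - int c)" if "s \<in> nzclass n c" for s
      using that unfolding nzclass_pos[OF c] run_def by blast
    from disj[OF z(2)] disj[OF z(3)]
    consider k k' where "k < ?p" "k' < ?p" "a = int g * k + int c" "b = int g * k' + int c"
      | k k' where "k \<le> - ?p" "k' \<le> - ?p" "a = int g * k + - int c" "b = int g * k' + - int c"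
      | k k' where "a = int g * k + int c" "b = int g * k' + - int c"
      | k k' where "a = int g * k + - int c" "b = int g * k' + int c" by blast
    then show "z \<in> ?f ` {1..?p - 1} \<union> ?h ` {1..- ?p}"
    proof cases
      case 1
      then have "k + k' = 0" "k' < k" using z w1[of k k'] less[of k' "int c" k] by auto
      then have "k' = - k" "k \<in> {1..?p - 1}" using 1 by auto
      then show ?thesis using 1 z by auto
    next
      case 2
      then have "k + k' = 1" "k' < k" using z w2[of k k'] less[of k' "- int c" k] by auto
      then have "k' = 1 - k" "k \<in> {1..- ?p}" using 2 by auto
      then show ?thesis using 2 z by auto
    next
      case 3
      then show ?thesis using z w3[of k k'] by simp
    next
      case 4
      then show ?thesis using z w3[of k' k] by (simp add: add.commute)
    qed
  next
    fix z assume "z \<in> ?f ` {1..?p - 1} \<union> ?h ` {1..- ?p}"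
    then consider k where "1 \<le> k" "k < ?p" "z = ?f k" | k where "1 \<le> k" "k \<le> - ?p" "z = ?h k" by auto
    then show "z \<in> strict_pairs g (nzclass n c)"
    proof cases
      case 1
      then have "fst z \<in> nzclass n c" "snd z \<in> nzclass n c"
        unfolding nzclass_pos[OF c]
        using in_runI[of k "{..<?p}" "int c"] in_runI[of "- k" "{..<?p}" "int c"] by auto
      then show ?thesis using 1 w1[of k "- k"] less[of "- k" "int c" k] by (auto simp: strict_pairs_def)
    next
      case 2
      then have "fst z \<in> nzclass n c" "snd z \<in> nzclass n c"
        unfolding nzclass_pos[OF c]
        using in_runI[of k "{..- ?p}" "- int c"] in_runI[of "1 - k" "{..- ?p}" "- int c"] by auto
      then show ?thesis using 2 w2[of k "1 - k"] less[of "1 - k" "- int c" k] by (auto simp: strict_pairs_def)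
    qed
  qed
  have inj: "inj_on ?f U" "inj_on ?h U" for U using g_gt_0 by (auto simp: inj_on_def)
  have "card (strict_pairs g (nzclass n c)) = nat (?p - 1) + nat (- ?p)"
  proof (cases "1 \<le> ?p")
    case True
    then have "strict_pairs g (nzclass n c) = ?f ` {1..?p - 1}" unfolding eq by simp
    then show ?thesis using True card_image[OF inj(1), of "{1..?p - 1}"] by simp
  next
    case False
    then have "strict_pairs g (nzclass n c) = ?h ` {1..- ?p}" unfolding eq by simp
    then show ?thesis using False card_image[OF inj(2), of "{1..- ?p}"] by simp
  qed
  then show ?thesis by (simp only: parity_pair)
qed

lemma strict_0:
  assumes "n \<in> charges t"
  shows "strict_pairs g (nzclass n 0) = {}"
proof -
  have "\<not> (0 < int g * k + int g * k' \<and> int g * k + int g * k' < int g)" for k k'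
    using window_0[of "k + k'"] by (simp add: distrib_left)
  then show ?thesis
    unfolding nzclass_0[OF assms] run_def by (auto simp: strict_pairs_def)
qed

lemma abs_less_iff_sum_diff:
  fixes w v :: int
  assumes "w + v \<noteq> 0" "w \<noteq> v"
  shows "\<bar>v\<bar> < \<bar>w\<bar> \<longleftrightarrow> (0 < w + v \<longleftrightarrow> 0 < w - v)"
  using assms by (auto simp: abs_if)

lemma top_exp_less_iff:
  assumes "i < t" "j < t"
  shows "top_exp n j < top_exp n i \<longleftrightarrow> \<bar>2 * level_exp g n j - int g\<bar> < \<bar>2 * level_exp g n i - int g\<bar>"
  by (auto simp: top_exp_def max_def abs_if)

text \<open>With w = 2 \<open>level_exp\<close> - g, \<open>top_exp\<close> increases with |w|.
  Comparing two absolute values needs only the signs of the sum and the difference, which the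
  charges determine. The result matches the signs of the cross counts.\<close>

lemma sgn_top_exp:
  assumes ij: "i < j" "j < t"
  shows "sgn (top_exp n i - top_exp n j) =
    (if 1 \<le> n i + n j then - 1 else 1) * (if 1 \<le> n i - n j then - 1 else 1 :: int)"
proof -
  define w where "w c = 2 * level_exp g n c - int g" for c
  have e1: "w i + w j = 2 * (int g * (n i + n j - 1) + (int i + int j))"
    and e2: "w i - w j = 2 * (int g * (n i - n j) + (int i - int j))"
    by (simp_all add: w_def level_exp_def algebra_simps)
  have lt: "\<bar>int i + int j\<bar> < int g" "\<bar>int i - int j\<bar> < int g" using ij int_g by auto
  have 1: "0 < w i + w j \<longleftrightarrow> 1 \<le> n i + n j"
    unfolding e1 using level_pos_iff[OF lt(1), of "n i + n j - 1"] ij by auto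
  have 2: "0 < w i - w j \<longleftrightarrow> 1 \<le> n i - n j"
    unfolding e2 using level_pos_iff[OF lt(2), of "n i - n j"] ij by auto
  have ne: "top_exp n i \<noteq> top_exp n j"
    using inj_onD[OF top_exp_inj[of n], of i j] ij by auto
  have "w i + w j \<noteq> 0 \<and> w i \<noteq> w j"
  proof -
    have "\<bar>w i\<bar> \<noteq> \<bar>w j\<bar>"
      using ne by (auto simp: w_def top_exp_def max_def abs_if split: if_splits)
    then show ?thesis by auto
  qed
  then have "top_exp n j < top_exp n i \<longleftrightarrow> (1 \<le> n i + n j \<longleftrightarrow> 1 \<le> n i - n j)"
    using top_exp_less_iff[of i j n] ij abs_less_iff_sum_diff[of "w i" "w j"] 1 2 by (simp add: w_def)
  then show ?thesis using ne by (auto simp: sgn_if)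
qed

text \<open>Pairs from different classes give the order of the mirror maxima. The parity of each
  \<open>n c\<close> with c > 0 arises twice, within class c and across to class 0, and
  cancels.\<close>

lemma sign_hooks_partition_of:
  assumes n: "n \<in> charges t"
  shows "(- 1 :: int) ^ card (strict_pairs g (charge_set n - {0})) =
    (\<Prod>(i, j)\<in>lt_pairs t. sgn (top_exp n i - top_exp n j)) *
    (\<Prod>c\<in>{1..<t}. if 1 \<le> n c then - 1 else 1)"
proof -
  let ?A = "charge_set n - {0}"
  have dd: "partition_of n \<in> DD_conj"
    using partition_of[OF n] reflective_charge_set[OF n] by (simp add: DD_conj_iff)
  have fin: "finite (strict_pairs g ?A)"
    using hook_sign_eq(2)[OF dd, of g] by (simp add: partition_of(2)[OF n])
  have classes: "{a \<in> ?A. cls t a = c} = nzclass n c" for c by (auto simp: nzclass_def)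
  have dec: "card (strict_pairs g ?A) = (\<Sum>i<t. card (strict_pairs g {a \<in> ?A. cls t a = i})) +
      (\<Sum>(i, j)\<in>lt_pairs t. card (cross {a \<in> ?A. cls t a = i} {a \<in> ?A. cls t a = j}))"
    by (rule strict_pairs_decompose[OF fin]) (rule cls_less[OF t])
  have fs: "finite (strict_pairs g (nzclass n c))" for c
    by (rule finite_subset[OF _ fin]) (auto simp: strict_pairs_def nzclass_def)
  have fc: "finite (cross (nzclass n c) (nzclass n c'))" if "c \<noteq> c'" for c c'
    by (rule finite_cross_if_strict[OF fin]) (use that in \<open>auto simp: nzclass_def\<close>)
  have "(- 1 :: int) ^ card (strict_pairs g ?A) =
    (\<Prod>c<t. (- 1) ^ card (strict_pairs g (nzclass n c))) *
    (\<Prod>(i, j)\<in>lt_pairs t. (- 1) ^ card (cross (nzclass n i) (nzclass n j)))"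
    unfolding dec classes
    by (simp add: power_add power_sum case_prod_unfold)
  also have "(\<Prod>c<t. (- 1 :: int) ^ card (strict_pairs g (nzclass n c))) =
      (\<Prod>c\<in>{1..<t}. msgn (n c)) * (\<Prod>c\<in>{1..<t}. if 1 \<le> n c then - 1 else 1)"
  proof -
    have "{..<t} = insert 0 {1..<t}" using t by auto
    then have "(\<Prod>c<t. (- 1 :: int) ^ card (strict_pairs g (nzclass n c))) =
        (\<Prod>c\<in>{1..<t}. (- 1) ^ card (strict_pairs g (nzclass n c)))"
      by (simp add: strict_0[OF n])
    also have "\<dots> = (\<Prod>c\<in>{1..<t}. msgn (n c) * (if 1 \<le> n c then - 1 else 1))"
      by (intro prod.cong refl card_strict_pos fs) auto
    finally show ?thesis by (simp only: prod.distrib)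
  qed
  also have "(\<Prod>(i, j)\<in>lt_pairs t. (- 1 :: int) ^ card (cross (nzclass n i) (nzclass n j))) =
      (\<Prod>(i, j)\<in>lt_pairs t. (if i = 0 then msgn (n j) else 1) * sgn (top_exp n i - top_exp n j))"
  proof (intro prod.cong refl, clarify)
    fix i j assume "(i, j) \<in> lt_pairs t"
    then have ij: "i < j" "j < t" by (auto simp: lt_pairs_def)
    show "(- 1 :: int) ^ card (cross (nzclass n i) (nzclass n j)) =
        (if i = 0 then msgn (n j) else 1) * sgn (top_exp n i - top_exp n j)"
    proof (cases "i = 0")
      case True
      then show ?thesis
        unfolding sgn_top_exp[OF ij] using card_cross_0[OF n, of j] ij fc[of 0 j] by simp
    next
      case False
      then show ?thesis
        unfolding sgn_top_exp[OF ij] using card_cross_pos[of i j n] ij fc[of i j] by simp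
    qed
  qed
  also have "\<dots> = (\<Prod>(i, j)\<in>lt_pairs t. if i = 0 then msgn (n j) else 1) *
      (\<Prod>(i, j)\<in>lt_pairs t. sgn (top_exp n i - top_exp n j))"
    by (simp add: case_prod_unfold prod.distrib)
  also have "(\<Prod>(i, j)\<in>lt_pairs t. if i = 0 then msgn (n j) else 1 :: int) = (\<Prod>c\<in>{1..<t}. msgn (n c))"
  proof -
    have "(\<Prod>(i, j)\<in>lt_pairs t. if i = 0 then msgn (n j) else 1 :: int) = (\<Prod>(i, j)\<in>(\<lambda>c. (0 :: nat, c)) ` {1..<t}. msgn (n j))"
      by (rule prod.mono_neutral_cong_right, simp) (auto simp: lt_pairs_def)
    also have "\<dots> = (\<Prod>c\<in>{1..<t}. msgn (n c))" by (subst prod.reindex) (auto simp: inj_on_def)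
    finally show ?thesis .
  qed
  finally have "(- 1 :: int) ^ card (strict_pairs g ?A) =
    ((\<Prod>c\<in>{1..<t}. msgn (n c)) * (\<Prod>c\<in>{1..<t}. msgn (n c))) *
    ((\<Prod>(i, j)\<in>lt_pairs t. sgn (top_exp n i - top_exp n j)) * (\<Prod>c\<in>{1..<t}. if 1 \<le> n c then - 1 else 1))"
    by (simp only: mult_ac)
  moreover have "(\<Prod>c\<in>{1..<t}. msgn (n c)) * (\<Prod>c\<in>{1..<t}. msgn (n c)) = (1 :: int)"
    by (simp flip: prod.distrib)
  ultimately show ?thesis by simp
qed

text \<open>The columns c > 0 with \<open>n c <= 0\<close> are reflected, then all columns are
  sorted. The sign of the sorting permutation is read off from the fact that all order signs equal 1
  afterwards.\<close>

lemma alt_det_V_coding: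
  assumes n: "n \<in> charges t"
  shows "alt_det t x (\<lambda>b. V_coding g t (partition_of n) ! b + 1) =
    of_int ((\<Prod>(i, j)\<in>lt_pairs t. sgn (top_exp n i - top_exp n j)) *
      (\<Prod>c\<in>{1..<t}. if 1 \<le> n c then 1 else - 1)) * alt_det t x (level_exp g n)"
proof -
  obtain \<sigma> where \<sigma>: "\<sigma> permutes {..<t}"
    "\<And>b. b < t \<Longrightarrow> V_coding g t (partition_of n) ! b = top_exp n (\<sigma> b) - 1"
    "\<And>i j. i < j \<Longrightarrow> j < t \<Longrightarrow> top_exp n (\<sigma> j) < top_exp n (\<sigma> i)"
    using V_coding_partition_of[OF n] by blast
  have "(\<Prod>(i, j)\<in>lt_pairs t. sgn (top_exp n (\<sigma> i) - top_exp n (\<sigma> j))) =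
      of_int (sign \<sigma>) * (\<Prod>(i, j)\<in>lt_pairs t. sgn (top_exp n i - top_exp n j))"
  proof (rule prod_antisymmetric_permute[OF \<sigma>(1), of "\<lambda>i j. sgn (top_exp n i - top_exp n j)"])
    show "sgn (top_exp n j - top_exp n i) = - sgn (top_exp n i - top_exp n j)" for i j
      by (simp add: sgn_if)
  qed
  moreover have "(\<Prod>(i, j)\<in>lt_pairs t. sgn (top_exp n (\<sigma> i) - top_exp n (\<sigma> j))) = 1"
  proof (intro prod.neutral ballI, clarify)
    fix i j assume "(i, j) \<in> lt_pairs t"
    then show "sgn (top_exp n (\<sigma> i) - top_exp n (\<sigma> j)) = 1" using \<sigma>(3)[of i j] by (simp add: lt_pairs_def)
  qed
  ultimately have "sign \<sigma> * (\<Prod>(i, j)\<in>lt_pairs t. sgn (top_exp n i - top_exp n j)) = 1" by simp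
  then have sgn: "sign \<sigma> = (\<Prod>(i, j)\<in>lt_pairs t. sgn (top_exp n i - top_exp n j))"
    by (cases \<sigma> rule: sign_cases) auto
  define d :: "nat \<Rightarrow> int" where "d c = (if c = 0 \<or> 1 \<le> n c then 1 else - 1)" for c
  have top: "top_exp n c = (if d c = 1 then level_exp g n c else int g - level_exp g n c)" if "c < t" for c
  proof -
    have eq: "2 * level_exp g n c - int g = int g * (2 * n c - 1) + 2 * int c"
      by (simp add: level_exp_def algebra_simps)
    have "\<bar>2 * int c\<bar> < int g" using that int_g by simp
    from level_pos_iff[OF this, of "2 * n c - 1", folded eq]
    have "0 < 2 * level_exp g n c - int g \<longleftrightarrow> 1 \<le> n c" by presburger
    moreover have "2 * level_exp g n c \<noteq> int g" using int_g by presburger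
    ultimately show ?thesis
      using charges_0[OF n] by (auto simp: top_exp_def d_def max_def)
  qed
  have "alt_det t x (\<lambda>b. V_coding g t (partition_of n) ! b + 1) = alt_det t x (\<lambda>b. top_exp n (\<sigma> b))"
    by (rule alt_det_cong) (simp add: \<sigma>(2))
  also have "\<dots> = of_int (sign \<sigma>) * alt_det t x (top_exp n)" by (rule alt_det_permute[OF \<sigma>(1)])
  also have "alt_det t x (top_exp n) = (\<Prod>c<t. of_int (d c)) * alt_det t x (level_exp g n)"
  proof (rule alt_det_flip, fold g)
    fix c assume "c < t"
    then show "top_exp n c = level_exp g n c \<and> of_int (d c) = (1 :: 'a) \<or>
        top_exp n c = int g - level_exp g n c \<and> of_int (d c) = (- 1 :: 'a)"
      using top[of c] by (simp add: d_def)
  qed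
  also have "(\<Prod>c<t. of_int (d c) :: 'a) = of_int (\<Prod>c\<in>{1..<t}. if 1 \<le> n c then 1 else - 1)"
  proof -
    have "{..<t} = insert 0 {1..<t}" using t by auto
    then have "(\<Prod>c<t. d c) = (\<Prod>c\<in>{1..<t}. d c)" by (simp add: d_def)
    also have "\<dots> = (\<Prod>c\<in>{1..<t}. if 1 \<le> n c then 1 else - 1)" by (intro prod.cong) (auto simp: d_def)
    finally show ?thesis by (simp flip: of_int_prod)
  qed
  finally show ?thesis unfolding sgn by (simp add: mult.assoc)
qed

text \<open>All signs combine: the inversions of the sorting permutation and the reflections of the
  coding vector cancel against the hooks, leaving the parity of the charges.\<close>

lemma summand_partition_of:
  assumes n: "n \<in> charges t"
  defines "lam \<equiv> partition_of n"
  shows "(- 1) ^ durfee lam *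
      (- 1) ^ (card (hooks_lt_plus g lam) + card (hooks_lt_plus g lam \<inter> main_diagonal lam)) *
      fps_X ^ (sum_list lam div 2) * fps_const (so_char t (mu_of t lam)) =
    fps_const ((\<Prod>c<t. msgn (n c)) * alt_det t Xs (level_exp g n) / weyl_det t Xs) * fps_X ^ (\<Sum>c<t. en1 t (level_exp g n c))"
proof -
  let ?S = "\<Prod>(i, j)\<in>lt_pairs t. sgn (top_exp n i - top_exp n j)"
  let ?N = "\<Prod>c\<in>{1..<t}. if 1 \<le> n c then - 1 else 1 :: int" and ?P = "\<Prod>c\<in>{1..<t}. if 1 \<le> n c then 1 else - 1 :: int"
  let ?M = "\<Prod>c<t. msgn (n c) :: laurent fract"
  have dd: "lam \<in> DD_conj"
    unfolding lam_def using partition_of[OF n] reflective_charge_set[OF n] by (simp add: DD_conj_iff)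
  have size: "sum_list lam div 2 = (\<Sum>c<t. en1 t (level_exp g n c))"
  proof -
    have "int (sum_list lam) = int (2 * (\<Sum>c<t. en1 t (level_exp g n c)))"
      using pos_cbeads_partition_of(1)[OF n] by (simp add: lam_def)
    then have "sum_list lam = 2 * (\<Sum>c<t. en1 t (level_exp g n c))" by (simp only: of_nat_eq_iff)
    then show ?thesis by simp
  qed
  have hooks: "(- 1 :: laurent fract) ^ (card (hooks_lt_plus g lam) + card (hooks_lt_plus g lam \<inter> main_diagonal lam)) =
      of_int (?S * ?N)"
    unfolding hook_sign_eq(1)[OF dd] sign_hooks_partition_of[OF n, symmetric]
    by (simp add: lam_def partition_of(2)[OF n])
  have durf: "(- 1 :: laurent fract) ^ durfee lam = - ?M"
    unfolding lam_def by (rule pos_cbeads_partition_of(2)[OF n])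
  have so: "so_char t (mu_of t lam) = of_int (?S * ?P) * alt_det t Xs (level_exp g n) / (msgn (int t) * weyl_det t Xs)"
  proof -
    have "mu_of t lam (Suc b) + int (2 * t) - int (Suc b) = V_coding g t (partition_of n) ! b + 1" for b
      unfolding mu_of_def lam_def g[symmetric] int_g by simp
    then show ?thesis
      unfolding so_char_eq_alt_det[OF t] by (simp only: alt_det_V_coding[OF n])
  qed
  have sq: "?S * ?S = 1"
  proof -
    have "sgn (top_exp n i - top_exp n j) * sgn (top_exp n i - top_exp n j) = 1" if "(i, j) \<in> lt_pairs t" for i j
      using that sgn_top_exp[of i j n] by (auto simp: lt_pairs_def)
    then show ?thesis unfolding prod.distrib[symmetric] by (intro prod.neutral) auto
  qed
  \<comment> \<open>The within-class hook sign and the reflection sign are opposite for each of the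
    t - 1 nonzero classes. The resulting - (-1)^t cancels the (-1)^t of the character denominator
    and the minus sign of class 0 in the Durfee parity.\<close>
  have "?N * ?P = (\<Prod>c\<in>{1..<t}. - 1)"
    unfolding prod.distrib[symmetric] by (intro prod.cong) auto
  also have "\<dots> = - msgn (int t)"
    using t by (cases t) (simp_all add: msgn_def)
  finally have NP: "?N * ?P = - msgn (int t)" .
  have "- ?M * of_int (?S * ?N) * (of_int (?S * ?P) * alt_det t Xs (level_exp g n) / (msgn (int t) * weyl_det t Xs)) =
      - ?M * of_int ((?S * ?S) * (?N * ?P)) * (alt_det t Xs (level_exp g n) / (msgn (int t) * weyl_det t Xs))"
    by (simp add: mult_ac)
  also have "\<dots> = ?M * alt_det t Xs (level_exp g n) / weyl_det t Xs"
    unfolding sq NP by (simp add: msgn_def)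
  finally have key: "- ?M * of_int (?S * ?N) * (of_int (?S * ?P) * alt_det t Xs (level_exp g n) / (msgn (int t) * weyl_det t Xs)) =
      ?M * alt_det t Xs (level_exp g n) / weyl_det t Xs" .
  have pw: "(- 1) ^ k = (fps_const ((- 1) ^ k) :: laurent fract fps)" for k
    by (simp flip: fps_const_power fps_const_neg)
  show ?thesis
    unfolding size pw durf hooks so key[symmetric] by (simp only: fps_const_mult[symmetric] mult_ac)
qed

end

section \<open>The product side\<close>

text \<open>Once a finite subset contains the fibre over \<open>k\<close>, coefficient
  \<open>k\<close> of its partial sum has reached its final value.\<close>

lemma fsum_has_sum:
  fixes A :: "'i \<Rightarrow> 'a::comm_ring_1"
  assumes "finite_fibres I w"
  shows "((\<lambda>i. fps_const (A i) * fps_X ^ w i) has_sum fsum I w A) I"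
  unfolding has_sum_def
proof (rule tendsto_fpsI)
  fix k
  let ?X = "{i \<in> I. w i = k}"
  have "fps_nth (\<Sum>i\<in>Y. fps_const (A i) * fps_X ^ w i) k = fps_nth (fsum I w A) k"
    if Y: "finite Y" "?X \<subseteq> Y" "Y \<subseteq> I" for Y
  proof -
    have "fps_nth (\<Sum>i\<in>Y. fps_const (A i) * fps_X ^ w i) k = (\<Sum>i\<in>Y. if w i = k then A i else 0)"
      by (simp add: fps_sum_nth if_distrib eq_commute[of k] cong: if_cong)
    also have "\<dots> = (\<Sum>i\<in>?X. A i)"
      using Y by (intro sum.mono_neutral_cong_right) auto
    finally show ?thesis by (simp add: fsum_nth)
  qed
  then show "\<forall>\<^sub>F Y in finite_subsets_at_top I.
      fps_nth (\<Sum>i\<in>Y. fps_const (A i) * fps_X ^ w i) k = fps_nth (fsum I w A) k"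
    unfolding eventually_finite_subsets_at_top
    using finite_fibresD[OF assms] by (intro exI[of _ ?X]) auto
qed

lemma qpoch_eq_qprod: "qpoch a = qprod a"
  by (simp add: qpoch_def qprod_def)

lemma product_side_eq:
  "qpoch fps_X ^ t * K_T t * (\<Prod>i = 1..t. qpoch (fps_X * xv i) * qpoch (fps_X * xv_inv i)) =
    qprod fps_X ^ t * root_prod t Xs"
proof -
  have "(\<Prod>i = 1..t. qpoch (fps_X * xv i) * qpoch (fps_X * xv_inv i)) =
      (\<Prod>a<t. qpoch (fps_X * xv (Suc a)) * qpoch (fps_X * xv_inv (Suc a)))"
    by (rule prod.reindex_bij_witness[of _ Suc "\<lambda>i. i - 1"]) auto
  moreover have "K_T t = (\<Prod>(i, j)\<in>lt_pairs t.
     qpoch (fps_X * xv (Suc i) * xv (Suc j)) * qpoch (fps_X * xv (Suc i) * xv_inv (Suc j)) *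
     qpoch (fps_X * xv_inv (Suc i) * xv (Suc j)) * qpoch (fps_X * xv_inv (Suc i) * xv_inv (Suc j)))"
    unfolding K_T_def
    by (rule prod.reindex_bij_witness[of _ "\<lambda>(i, j). (Suc i, Suc j)" "\<lambda>(i, j). (i - 1, j - 1)"])
       (auto simp: lt_pairs_def)
  moreover have "\<dots> = (\<Prod>(i, j)\<in>lt_pairs t.
     (qprod (fps_X * fps_const (posroot Xs (i, j))) * qprod (fps_X * fps_const (inverse (posroot Xs (i, j))))) *
     (qprod (fps_X * fps_const (posroot Xs (j, i))) * qprod (fps_X * fps_const (inverse (posroot Xs (j, i))))))"
    by (intro prod.cong refl)
       (auto simp: lt_pairs_def posroot_def qpoch_eq_qprod divide_inverse mult_ac simp flip: fps_const_mult)
  ultimately show ?thesis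
    unfolding root_prod_def prod.square_split
    by (simp add: qpoch_eq_qprod posroot_def mult_ac)
qed

theorem theorem5p8:
  fixes t g :: nat
  assumes "t \<ge> 3" and "g = 2 * t - 1"
  shows "((\<lambda>lam. (- 1) ^ durfee lam *
             (- 1) ^ (card (hooks_lt_plus g lam) + card (hooks_lt_plus g lam \<inter> main_diagonal lam)) *
             fps_X ^ (sum_list lam div 2) * fps_const (so_char t (mu_of t lam)))
           has_sum
           (qpoch fps_X ^ t * K_T t *
            (\<Prod>i = 1..t. qpoch (fps_X * xv i) * qpoch (fps_X * xv_inv i))))
         (DD_conj_1 t)"
proof -
  have t: "0 < t" using assms by simp
  note g = assms(2)
  let ?E = "\<lambda>n. \<Sum>c<t. en1 t (level_exp g n c)"
  let ?A = "\<lambda>n. (\<Prod>c<t. msgn (n c)) * alt_det t Xs (level_exp g n) / weyl_det t Xs"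
  have nz: "weyl_det t Xs \<noteq> 0" by (rule weyl_det_X[OF t])
  have "qprod fps_X ^ t * root_prod t Xs * fps_const (weyl_det t Xs) =
      fsum (charges t) ?E (\<lambda>n. (\<Prod>c<t. msgn (n c)) * alt_det t Xs (level_exp g n))"
    unfolding g det_columns_expand(1)[symmetric]
    by (rule macdonald_determinant[OF t X_neq_0 weyl_const_X])
  then have "fps_const (1 / weyl_det t Xs) * (qprod fps_X ^ t * root_prod t Xs * fps_const (weyl_det t Xs)) =
      fsum (charges t) ?E ?A"
    by (simp add: fsum_const_mult)
  moreover have "fps_const (1 / weyl_det t Xs) * (qprod fps_X ^ t * root_prod t Xs * fps_const (weyl_det t Xs)) =
      qprod fps_X ^ t * root_prod t Xs * fps_const (1 / weyl_det t Xs * weyl_det t Xs)"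
    by (simp only: fps_const_mult[symmetric] mult_ac)
  ultimately have sum: "fsum (charges t) ?E ?A = qprod fps_X ^ t * root_prod t Xs" using nz by simp
  have "finite_fibres (charges t) ?E" unfolding g by (rule det_columns_expand(2))
  from fsum_has_sum[OF this, of ?A]
  have "((\<lambda>n. fps_const (?A n) * fps_X ^ ?E n) has_sum (qprod fps_X ^ t * root_prod t Xs)) (charges t)"
    unfolding sum .
  then show ?thesis
    unfolding product_side_eq
    by (subst has_sum_reindex_bij_betw[OF bij_betw_partition_of[OF t g], symmetric])
       (simp add: summand_partition_of[OF t g] cong: has_sum_cong)
qed

end
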